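(* The group $\mathrm{Aut}_{\mathbb{K}}(U)$ of $\mathbb{K}$-algebra automorphisms of $U=U_q(\mathfrak{sl}_4^+)$ is isomorphic to the semi-direct product of the $3$-torus $\mathcal{H}=(\mathbb{K}^* )^3$ and the group of order $2$ generated by the diagram automorphism $\eta$ of $U$.
   Context: $\mathbb{K}$ is a field of characteristic $0$ and $q\in\mathbb{K}^*$ is not a root of unity. $U=U_q(\mathfrak{sl}_4^+)$ is the unital associative $\mathbb{K}$-algebra with generators $e_1,e_2,e_3$ subject to the quantum Serre relations $e_1e_3-e_3e_1=0$ and $e_i^2e_j-(q+q^{-1})e_ie_je_i+e_je_i^2=0$ whenever $|i-j|=1$. The torus $\mathcal{H}=(\mathbb{K}^* )^3$ is regarded as a subgroup of $\mathrm{Aut}_{\mathbb{K}}(U)$: $\bar\lambda=(\lambda_1,\lambda_2,\lambda_3)\in\mathcal{H}$ corresponds to the algebra automorphism $\phi_{\bar\lambda}$ with $\phi_{\bar\lambda}(e_i)=\lambda_ie_i$ for $i=1,2,3$. The diagram automorphism $\eta$ of $U$ is the algebra automorphism with $\eta(e_i)=e_{4-i}$ for $i=1,2,3$; $\eta^2$ is the identity. The action in the semi-direct product is conjugation in $\mathrm{Aut}_{\mathbb{K}}(U)$: $\eta\circ\phi_{(\lambda_1,\lambda_2,\lambda_3)}\circ\eta^{-1}=\phi_{(\lambda_3,\lambda_2,\lambda_1)}$. *)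

theory Defs
  imports "HOL-Algebra.Algebra" "HOL-Library.Poly_Mapping"
begin

section \<open>The free algebra on three generators\<close>

datatype gen = E1 | E2 | E3

datatype word = Word (letters: "gen list")

text \<open>Words are written additively, so that the convolution product of
  \<^theory>\<open>HOL-Library.Poly_Mapping\<close> makes \<open>word \<Rightarrow>\<^sub>0 'k\<close> the free associative
  \<open>'k\<close>-algebra on the three generators.\<close>

instantiation word :: monoid_add
begin

definition zero_word :: word
  where "0 = Word []"

definition plus_word :: "word \<Rightarrow> word \<Rightarrow> word"
  where "v + w = Word (letters v @ letters w)"

instance
  by standard (simp_all add: zero_word_def plus_word_def)

end

type_synonym 'k free_alg = "word \<Rightarrow>\<^sub>0 'k"

definition scalar :: "'k :: field \<Rightarrow> 'k free_alg"
  where "scalar c = Poly_Mapping.single 0 c"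

definition free_gen :: "gen \<Rightarrow> 'k :: field free_alg"
  where "free_gen i = Poly_Mapping.single (Word [i]) 1"

definition free_ring :: "'k :: field free_alg ring"
  where "free_ring = \<lparr>carrier = UNIV, monoid.mult = (*), one = 1, ring.zero = 0, add = (+)\<rparr>"


section \<open>The algebra $U_q(\mathfrak{sl}_4^+)$\<close>

definition adjacent :: "(gen \<times> gen) set"
  where "adjacent = {(E1, E2), (E2, E1), (E2, E3), (E3, E2)}"

definition serre_relators :: "'k :: field \<Rightarrow> 'k free_alg set"
  where "serre_relators q =
    {free_gen E1 * free_gen E3 - free_gen E3 * free_gen E1} \<union>
    {free_gen i ^ 2 * free_gen j
       - scalar (q + inverse q) * free_gen i * free_gen j * free_gen i
       + free_gen j * free_gen i ^ 2 | i j. (i, j) \<in> adjacent}"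

definition serre_ideal :: "'k :: field \<Rightarrow> 'k free_alg set"
  where "serre_ideal q = Idl\<^bsub>free_ring\<^esub> (serre_relators q)"

definition to_Uq :: "'k :: field \<Rightarrow> 'k free_alg \<Rightarrow> 'k free_alg set"
  where "to_Uq q x = serre_ideal q +>\<^bsub>free_ring\<^esub> x"

text \<open>The quotient ring, extended by its scalar multiplication.  The record type
  is the one the library calls \<open>module\<close>, here with scalars from the type \<open>'k\<close>.\<close>

definition Uq :: "'k :: field \<Rightarrow> ('k, 'k free_alg set) module"
  where "Uq q =
    ring.extend (free_ring Quot serre_ideal q)
      (module.fields (\<lambda>c u. to_Uq q (scalar c) \<otimes>\<^bsub>free_ring Quot serre_ideal q\<^esub> u))"

definition Uq_gen :: "'k :: field \<Rightarrow> gen \<Rightarrow> 'k free_alg set"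
  where "Uq_gen q i = to_Uq q (free_gen i)"


section \<open>The group of algebra automorphisms\<close>

text \<open>As for \<^const>\<open>AutoGroup\<close>, automorphisms are extensional functions on the
  carrier, and the group operation is composition of functions.\<close>

definition alg_auts :: "('k, 'a) module \<Rightarrow> ('a \<Rightarrow> 'a) set"
  where "alg_auts A =
    {f \<in> ring_hom A A \<inter> Bij (carrier A).
       \<forall>c. \<forall>x \<in> carrier A. f (c \<odot>\<^bsub>A\<^esub> x) = c \<odot>\<^bsub>A\<^esub> f x}"

definition Aut :: "('k, 'a) module \<Rightarrow> ('a \<Rightarrow> 'a) monoid"
  where "Aut A = BijGroup (carrier A) \<lparr>carrier := alg_auts A\<rparr>"


section \<open>The torus and the diagram automorphism\<close>

definition Kstar :: "'k :: field monoid"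
  where "Kstar = \<lparr>carrier = UNIV - {0}, monoid.mult = (*), one = 1\<rparr>"

definition torus :: "('k :: field \<times> 'k \<times> 'k) monoid"
  where "torus = Kstar \<times>\<times> Kstar \<times>\<times> Kstar"

text \<open>Existence and uniqueness of these automorphisms are the lemmas \<open>torus_aut\<close>,
  \<open>diagram_aut\<close> and \<open>Aut_eqI'\<close> below.\<close>

definition torus_aut ::
    "'k :: field \<Rightarrow> 'k \<times> 'k \<times> 'k \<Rightarrow> 'k free_alg set \<Rightarrow> 'k free_alg set"
  where "torus_aut q = (\<lambda>(l1, l2, l3). THE f. f \<in> carrier (Aut (Uq q)) \<and>
    f (Uq_gen q E1) = l1 \<odot>\<^bsub>Uq q\<^esub> Uq_gen q E1 \<and>
    f (Uq_gen q E2) = l2 \<odot>\<^bsub>Uq q\<^esub> Uq_gen q E2 \<and>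
    f (Uq_gen q E3) = l3 \<odot>\<^bsub>Uq q\<^esub> Uq_gen q E3)"

definition diagram_aut :: "'k :: field \<Rightarrow> 'k free_alg set \<Rightarrow> 'k free_alg set"
  where "diagram_aut q = (THE f. f \<in> carrier (Aut (Uq q)) \<and>
    f (Uq_gen q E1) = Uq_gen q E3 \<and> f (Uq_gen q E2) = Uq_gen q E2 \<and> f (Uq_gen q E3) = Uq_gen q E1)"

definition diagram_group ::
    "'k :: field \<Rightarrow> ('k free_alg set \<Rightarrow> 'k free_alg set) monoid"
  where "diagram_group q = Aut (Uq q) \<lparr>carrier := generate (Aut (Uq q)) {diagram_aut q}\<rparr>"

text \<open>The torus is identified with its image under \<^const>\<open>torus_aut\<close>, on which the
  diagram group acts by conjugation in the automorphism group.  The preimage exists and is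
  unique, see \<open>torus_aut_inj\<close> and \<open>conj_action_simps\<close> below.\<close>

definition conj_action :: "'k :: field \<Rightarrow> ('k free_alg set \<Rightarrow> 'k free_alg set) \<Rightarrow>
    'k \<times> 'k \<times> 'k \<Rightarrow> 'k \<times> 'k \<times> 'k"
  where "conj_action q h l = inv_into (carrier torus) (torus_aut q)
    (h \<otimes>\<^bsub>Aut (Uq q)\<^esub> torus_aut q l \<otimes>\<^bsub>Aut (Uq q)\<^esub> inv\<^bsub>Aut (Uq q)\<^esub> h)"

definition semidirect_product :: "('a, 'c) monoid_scheme \<Rightarrow> ('b, 'd) monoid_scheme \<Rightarrow>
    ('b \<Rightarrow> 'a \<Rightarrow> 'a) \<Rightarrow> ('a \<times> 'b) monoid"
  where "semidirect_product N H \<phi> =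
    \<lparr>carrier = carrier N \<times> carrier H,
     monoid.mult = (\<lambda>(n, h) (n', h'). (n \<otimes>\<^bsub>N\<^esub> \<phi> h n', h \<otimes>\<^bsub>H\<^esub> h')),
     one = (\<one>\<^bsub>N\<^esub>, \<one>\<^bsub>H\<^esub>)\<rparr>"


section \<open>Well-definedness\<close>

lemma free_ring_simps [simp]:
  "carrier free_ring = UNIV" "x \<otimes>\<^bsub>free_ring\<^esub> y = x * y" "x \<oplus>\<^bsub>free_ring\<^esub> y = x + y"
  "\<one>\<^bsub>free_ring\<^esub> = 1" "\<zero>\<^bsub>free_ring\<^esub> = 0"
  by (simp_all add: free_ring_def)

lemma free_ring: "ring (free_ring :: 'k :: field free_alg ring)"
proof (rule ringI)
  show "abelian_group (free_ring :: 'k free_alg ring)"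
  proof (rule abelian_groupI)
    fix x :: "'k free_alg" assume "x \<in> carrier free_ring"
    show "\<exists>y\<in>carrier free_ring. y \<oplus>\<^bsub>free_ring\<^esub> x = \<zero>\<^bsub>free_ring\<^esub>"
      by (rule bexI[of _ "- x"]) simp_all
  qed (simp_all add: algebra_simps)
  show "Group.monoid (free_ring :: 'k free_alg ring)"
    by (rule monoidI) (simp_all add: algebra_simps)
qed (simp_all add: algebra_simps)

lemma serre_ideal: "ideal (serre_ideal q) free_ring"
  unfolding serre_ideal_def by (rule ring.genideal_ideal[OF free_ring]) simp

lemma serre_relators_subset: "serre_relators q \<subseteq> serre_ideal q"
  unfolding serre_ideal_def by (rule ring.genideal_self[OF free_ring]) simp

lemma serre_ideal_closed:
  "x \<in> serre_ideal q \<Longrightarrow> y \<in> serre_ideal q \<Longrightarrow> x + y \<in> serre_ideal q"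
  "x \<in> serre_ideal q \<Longrightarrow> y * x \<in> serre_ideal q"
  using ideal.I_l_closed[OF serre_ideal, of x q y]
    additive_subgroup.a_closed[OF ideal.axioms(1)[OF serre_ideal], of x q y] by simp_all

lemma Uq_simps:
  "carrier (Uq q) = range (to_Uq q)"
  "to_Uq q x \<otimes>\<^bsub>Uq q\<^esub> to_Uq q y = to_Uq q (x * y)"
  "to_Uq q x \<oplus>\<^bsub>Uq q\<^esub> to_Uq q y = to_Uq q (x + y)"
  "\<one>\<^bsub>Uq q\<^esub> = to_Uq q 1" "\<zero>\<^bsub>Uq q\<^esub> = to_Uq q 0"
  "c \<odot>\<^bsub>Uq q\<^esub> to_Uq q x = to_Uq q (scalar c * x)"
proof -
  interpret ideal "serre_ideal q" free_ring by (rule serre_ideal)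
  note [simp] = Uq_def ring.defs module.defs FactRing_def
  have m: "[mod serre_ideal q:] to_Uq q x \<Otimes>\<^bsub>free_ring\<^esub> to_Uq q y = to_Uq q (x * y)" for x y
    using rcoset_mult_add[of x y] by (simp add: to_Uq_def)
  show "carrier (Uq q) = range (to_Uq q)"
    by (auto simp: A_RCOSETS_def' to_Uq_def)
  show "to_Uq q x \<otimes>\<^bsub>Uq q\<^esub> to_Uq q y = to_Uq q (x * y)"
    using m by simp
  show "to_Uq q x \<oplus>\<^bsub>Uq q\<^esub> to_Uq q y = to_Uq q (x + y)"
    using a_rcos_sum[of x y] by (simp add: to_Uq_def)
  show "\<one>\<^bsub>Uq q\<^esub> = to_Uq q 1" by (simp add: to_Uq_def)
  show "\<zero>\<^bsub>Uq q\<^esub> = to_Uq q 0"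
    using a_rcos_const[of 0] additive_subgroup.zero_closed[OF is_additive_subgroup] by (simp add: to_Uq_def)
  show "c \<odot>\<^bsub>Uq q\<^esub> to_Uq q x = to_Uq q (scalar c * x)"
    using m by simp
qed

lemma to_Uq_eq_iff: "to_Uq q x = to_Uq q y \<longleftrightarrow> x - y \<in> serre_ideal q"
proof -
  interpret ideal "serre_ideal q" free_ring by (rule serre_ideal)
  have "x \<ominus>\<^bsub>free_ring\<^esub> y = x - y"
  proof -
    have "\<ominus>\<^bsub>free_ring\<^esub> y = - y"
      by (rule minus_equality) simp_all
    then show ?thesis by (simp add: a_minus_def)
  qed
  then show ?thesis
    using quotient_eq_iff_same_a_r_cos[OF serre_ideal, of x y] by (simp add: to_Uq_def)
qed

lemma Uq_hom_memI:
  assumes "\<And>x. f (to_Uq q x) = to_Uq q (F x)" "F 1 = 1"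
    "\<And>x y. F (x * y) = F x * F y" "\<And>x y. F (x + y) = F x + F y"
  shows "f \<in> ring_hom (Uq q) (Uq q)"
  by (rule ring_hom_memI) (auto simp: Uq_simps assms)

lemma free_alg_induct:
  assumes "\<And>w c. P (Poly_Mapping.single w c)" "\<And>x y. P x \<Longrightarrow> P y \<Longrightarrow> P (x + y)"
  shows "P (x :: 'k :: field free_alg)"
proof (induction x rule: update_induct)
  case const
  have "P (Poly_Mapping.single 0 0)" by (rule assms)
  then show ?case by simp
next
  case (update f a b)
  have "Poly_Mapping.update a b f = f + Poly_Mapping.single a b"
    using update by (intro poly_mapping_eqI)
      (auto simp: lookup_update lookup_add lookup_single when_def in_keys_iff)
  then show ?case using update assms by simp
qed

lemma scalar_simps:
  "scalar (a + b) = scalar a + scalar b" "scalar (a * b) = scalar a * scalar b" "scalar 1 = 1"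
  by (simp_all add: scalar_def single_add mult_single)

lemma scalar_commute: "scalar c * x = x * scalar c"
  by (induction x rule: free_alg_induct)
    (simp_all add: scalar_def mult_single algebra_simps)

lemma single_Word: "Poly_Mapping.single (Word w) c = scalar c * prod_list (map free_gen w)"
proof (induction w arbitrary: c)
  case Nil
  then show ?case by (simp add: scalar_def flip: zero_word_def)
next
  case (Cons i w)
  have "Poly_Mapping.single (Word (i # w)) c = free_gen i * Poly_Mapping.single (Word w) c"
    by (simp add: free_gen_def mult_single plus_word_def)
  then show ?case
    by (simp add: Cons.IH) (metis mult.assoc scalar_commute)
qed

definition free_eval :: "('k :: field \<Rightarrow> 'b) \<Rightarrow> (gen \<Rightarrow> 'b) \<Rightarrow> 'k free_alg \<Rightarrow> 'b :: ring_1"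
  where "free_eval s g x =
    (\<Sum>w\<in>Poly_Mapping.keys x. s (Poly_Mapping.lookup x w) * prod_list (map g (letters w)))"

locale scalars =
  fixes s :: "'k :: field \<Rightarrow> 'b :: ring_1"
  assumes s_add: "s (a + b) = s a + s b" and s_mult: "s (a * b) = s a * s b" and s_1: "s 1 = 1"
    and s_commute: "s a * x = x * s a"
begin

lemma s_0: "s 0 = 0"
  using s_add[of 0 0] by simp

lemma eval_single: "free_eval s g (Poly_Mapping.single w c) = s c * prod_list (map g (letters w))"
  by (simp add: free_eval_def s_0)

lemma eval_add: "free_eval s g (x + y) = free_eval s g x + free_eval s g y"
  unfolding free_eval_def
  by (rule setsum_keys_plus_distrib) (simp_all add: s_0 s_add distrib_right)

lemma eval_1: "free_eval s g 1 = 1"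
  using eval_single[of g 0 1] by (simp add: s_1) (simp add: zero_word_def)

lemma eval_mult: "free_eval s g (x * y) = free_eval s g x * free_eval s g y"
proof (induction x rule: free_alg_induct)
  case (1 v c)
  show ?case
  proof (induction y rule: free_alg_induct)
    case (1 w d)
    have "s c * s d * (a * b) = s c * a * (s d * b)" for a b
    proof -
      have "s c * s d * (a * b) = s c * (s d * a) * b" by (simp only: mult.assoc)
      then show ?thesis by (simp only: s_commute[of d a] mult.assoc)
    qed
    from this[of "prod_list (map g (letters v))" "prod_list (map g (letters w))"] show ?case
      unfolding mult_single eval_single s_mult plus_word_def by simp
  qed (simp add: distrib_left eval_add)
qed (simp add: distrib_right eval_add)

lemma eval_scalar: "free_eval s g (scalar c) = s c"
  by (simp add: scalar_def eval_single zero_word_def)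

lemma eval_free_gen: "free_eval s g (free_gen i) = g i"
  by (simp add: free_gen_def eval_single s_1)

lemma eval_minus: "free_eval s g (x - y) = free_eval s g x - free_eval s g y"
  using eval_add[of g "x - y" y] by (simp add: eq_diff_eq)

lemmas eval_simps = eval_add eval_1 eval_mult eval_scalar eval_free_gen eval_minus

end

interpretation scal: scalars scalar
  by (rule scalars.intro) (rule scalar_simps scalar_commute)+

interpretation id_scal: scalars "\<lambda>c :: 'k :: field. c"
  by (rule scalars.intro) (simp_all add: mult.commute)

lemma serre_ideal_subset:
  assumes J: "\<And>r. r \<in> serre_relators q \<Longrightarrow> r \<in> J" "0 \<in> J"
    "\<And>x y. x \<in> J \<Longrightarrow> y \<in> J \<Longrightarrow> x + y \<in> J"
    "\<And>x y. x \<in> J \<Longrightarrow> y * x \<in> J" "\<And>x y. x \<in> J \<Longrightarrow> x * y \<in> J"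
  shows "serre_ideal q \<subseteq> J"
  unfolding serre_ideal_def
proof (rule ring.genideal_minimal[OF free_ring])
  have neg: "- x \<in> J" if "x \<in> J" for x
    using J(4)[OF that, of "- 1"] by simp
  show "ideal J free_ring"
  proof (rule idealI[OF free_ring])
    have "\<ominus>\<^bsub>free_ring\<^esub> x = - x" for x :: "'a free_alg"
      by (rule abelian_group.minus_equality[OF ring.is_abelian_group[OF free_ring]]) simp_all
    then have "inv\<^bsub>add_monoid free_ring\<^esub> x = - x" for x :: "'a free_alg"
      by (simp add: a_inv_def)
    then show "subgroup J (add_monoid free_ring)"
      by (unfold_locales) (auto simp: J neg)
  qed (auto simp: J)
  show "serre_relators q \<subseteq> J" using J by blast
qed

lemma character_vanishes:
  fixes g :: "gen \<Rightarrow> 'k :: field"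
  assumes "g E1 = 0 \<and> g E3 = 0 \<or> g E2 = 0" "x \<in> serre_ideal q"
  shows "free_eval (\<lambda>c. c) g x = 0"
proof -
  have "serre_ideal q \<subseteq> {x. free_eval (\<lambda>c. c) g x = 0}"
    by (rule serre_ideal_subset)
      (use assms(1) in \<open>auto simp: serre_relators_def adjacent_def id_scal.eval_simps power2_eq_square,
        auto simp: free_eval_def\<close>)
  then show ?thesis using assms by blast
qed

abbreviation free_subst :: "(gen \<Rightarrow> 'k :: field free_alg) \<Rightarrow> 'k free_alg \<Rightarrow> 'k free_alg"
  where "free_subst \<equiv> free_eval scalar"

lemma subst_subst:
  assumes "\<And>i. free_subst g (g' i) = free_gen i"
  shows "free_subst g (free_subst g' x) = x"
proof (induction x rule: free_alg_induct)
  case (1 w c)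
  have "free_subst g (free_subst g' (prod_list (map free_gen v))) = prod_list (map free_gen v)" for v
    by (induction v) (simp_all add: scal.eval_simps assms)
  then show ?case
    by (cases w) (simp add: single_Word scal.eval_simps)
qed (simp add: scal.eval_simps)

lemma subst_serre_ideal:
  assumes "\<And>r. r \<in> serre_relators q \<Longrightarrow> free_subst g r \<in> serre_ideal q"
    and "x \<in> serre_ideal q"
  shows "free_subst g x \<in> serre_ideal q"
proof -
  interpret ideal "serre_ideal q" free_ring by (rule serre_ideal)
  have "serre_ideal q \<subseteq> {x. free_subst g x \<in> serre_ideal q}"
  proof (rule serre_ideal_subset; clarsimp simp: scal.eval_simps assms(1))
    show "free_subst g 0 \<in> serre_ideal q"
      using additive_subgroup.zero_closed[OF is_additive_subgroup] by (simp add: free_eval_def)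
  next
    fix x y assume "free_subst g x \<in> serre_ideal q" "free_subst g y \<in> serre_ideal q"
    then show "free_subst g x + free_subst g y \<in> serre_ideal q"
      using serre_ideal_closed(1) by blast
  next
    fix x y assume *: "free_subst g x \<in> serre_ideal q"
    show "free_subst g y * free_subst g x \<in> serre_ideal q" "free_subst g x * free_subst g y \<in> serre_ideal q"
      using I_l_closed[OF *, of "free_subst g y"] I_r_closed[OF *, of "free_subst g y"] by simp_all
  qed
  then show ?thesis using assms(2) by blast
qed

lemma alg_aut_exists:
  assumes "\<And>r. r \<in> serre_relators q \<Longrightarrow> free_subst g r \<in> serre_ideal q"
    and "\<And>r. r \<in> serre_relators q \<Longrightarrow> free_subst g' r \<in> serre_ideal q"
    and "\<And>i. free_subst g (g' i) = free_gen i" "\<And>i. free_subst g' (g i) = free_gen i"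
  obtains f where "f \<in> carrier (Aut (Uq q))" "\<And>x. f (to_Uq q x) = to_Uq q (free_subst g x)"
proof -
  define F where "F h = (\<lambda>u\<in>carrier (Uq q). to_Uq q (free_subst h (SOME x. u = to_Uq q x)))" for h
  have F: "F h (to_Uq q x) = to_Uq q (free_subst h x)"
    if h: "\<And>r. r \<in> serre_relators q \<Longrightarrow> free_subst h r \<in> serre_ideal q" for h x
  proof -
    define y where "y = (SOME y. to_Uq q x = to_Uq q y)"
    have "to_Uq q x = to_Uq q y" unfolding y_def by (rule someI[of _ x]) simp
    then have "free_subst h (x - y) \<in> serre_ideal q"
      by (intro subst_serre_ideal[OF h]) (simp_all add: to_Uq_eq_iff)
    then have "to_Uq q (free_subst h x) = to_Uq q (free_subst h y)"
      by (simp add: to_Uq_eq_iff scal.eval_simps)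
    then show ?thesis
      by (simp add: F_def Uq_simps y_def)
  qed
  note Fg = F[of g, OF assms(1)] and Fg' = F[of g', OF assms(2)]
  have "bij_betw (F g) (carrier (Uq q)) (carrier (Uq q))"
    by (rule bij_betw_byWitness[where f' = "F g'"])
      (auto simp: Uq_simps Fg Fg' subst_subst assms)
  moreover have "F g \<in> ring_hom (Uq q) (Uq q)"
    by (rule Uq_hom_memI[of _ _ "free_subst g"]) (simp_all add: Fg scal.eval_simps)
  moreover have "F g (c \<odot>\<^bsub>Uq q\<^esub> x) = c \<odot>\<^bsub>Uq q\<^esub> F g x" if "x \<in> carrier (Uq q)" for c x
    using that by (auto simp: Uq_simps Fg scal.eval_simps)
  moreover have "F g \<in> extensional (carrier (Uq q))"
    by (simp add: F_def)
  ultimately show ?thesis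
    using that[of "F g"] Fg by (simp add: Aut_def alg_auts_def Bij_def)
qed

lemma AutD:
  assumes "f \<in> carrier (Aut (Uq q))"
  shows "f \<in> extensional (carrier (Uq q))" "f \<in> ring_hom (Uq q) (Uq q)"
    "bij_betw f (carrier (Uq q)) (carrier (Uq q))"
    "x \<in> carrier (Uq q) \<Longrightarrow> f (c \<odot>\<^bsub>Uq q\<^esub> x) = c \<odot>\<^bsub>Uq q\<^esub> f x"
    "x \<in> carrier (Uq q) \<Longrightarrow> f x \<in> carrier (Uq q)"
    "f (to_Uq q (scalar c)) = to_Uq q (scalar c)"
proof -
  show *: "f \<in> extensional (carrier (Uq q))" "f \<in> ring_hom (Uq q) (Uq q)"
    "bij_betw f (carrier (Uq q)) (carrier (Uq q))"
    "\<And>x c. x \<in> carrier (Uq q) \<Longrightarrow> f (c \<odot>\<^bsub>Uq q\<^esub> x) = c \<odot>\<^bsub>Uq q\<^esub> f x"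
    using assms by (auto simp: Aut_def alg_auts_def Bij_def)
  show "x \<in> carrier (Uq q) \<Longrightarrow> f x \<in> carrier (Uq q)"
    using *(3) by (auto simp: bij_betw_def)
  have "f (c \<odot>\<^bsub>Uq q\<^esub> \<one>\<^bsub>Uq q\<^esub>) = c \<odot>\<^bsub>Uq q\<^esub> \<one>\<^bsub>Uq q\<^esub>"
    using *(4)[of "\<one>\<^bsub>Uq q\<^esub>" c] ring_hom_one[OF *(2)] by (simp add: Uq_simps)
  then show "f (to_Uq q (scalar c)) = to_Uq q (scalar c)"
    by (simp add: Uq_simps)
qed

lemma Aut_eqI:
  assumes f: "f \<in> carrier (Aut (Uq q))" and h: "h \<in> carrier (Aut (Uq q))"
    and gens: "\<And>i. f (Uq_gen q i) = h (Uq_gen q i)"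
  shows "f = h"
proof (rule extensionalityI[OF AutD(1)[OF f] AutD(1)[OF h]])
  fix u assume "u \<in> carrier (Uq q)"
  then obtain x where u: "u = to_Uq q x" by (auto simp: Uq_simps)
  have mult: "k (to_Uq q (a * b)) = k (to_Uq q a) \<otimes>\<^bsub>Uq q\<^esub> k (to_Uq q b)"
    and add: "k (to_Uq q (a + b)) = k (to_Uq q a) \<oplus>\<^bsub>Uq q\<^esub> k (to_Uq q b)"
    if "k \<in> carrier (Aut (Uq q))" for k a b
    using ring_hom_mult[OF AutD(2)[OF that], of "to_Uq q a" "to_Uq q b"]
      ring_hom_add[OF AutD(2)[OF that], of "to_Uq q a" "to_Uq q b"] by (simp_all add: Uq_simps)
  have "f (to_Uq q x) = h (to_Uq q x)"
  proof (induction x rule: free_alg_induct)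
    case (1 w c)
    have "f (to_Uq q (prod_list (map free_gen v))) = h (to_Uq q (prod_list (map free_gen v)))" for v
    proof (induction v)
      case Nil
      then show ?case using AutD(6)[OF f, of 1] AutD(6)[OF h, of 1] by (simp add: scalar_simps)
    next
      case (Cons i v)
      then show ?case using gens[of i] by (simp add: mult f h Uq_gen_def)
    qed
    then show ?case
      by (cases w) (simp add: single_Word mult f h AutD(6))
  qed (simp add: add f h)
  then show "f u = h u" by (simp add: u)
qed

lemma group_Aut: "group (Aut (Uq q))"
proof -
  let ?S = "carrier (Uq q)"
  have op: "\<exists>w\<in>?S. w = u \<otimes>\<^bsub>Uq q\<^esub> v" "\<exists>w\<in>?S. w = u \<oplus>\<^bsub>Uq q\<^esub> v" "\<exists>w\<in>?S. w = c \<odot>\<^bsub>Uq q\<^esub> u"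
    if "u \<in> ?S" "v \<in> ?S" for u v c
    using that by (auto simp: Uq_simps)
  have "subgroup (alg_auts (Uq q)) (BijGroup ?S)"
  proof (rule group.subgroupI[OF group_BijGroup])
    show "alg_auts (Uq q) \<subseteq> carrier (BijGroup ?S)"
      by (auto simp: alg_auts_def BijGroup_def)
    have "(\<lambda>x\<in>?S. x) \<in> alg_auts (Uq q)"
      using op by (auto simp: alg_auts_def id_Bij ring_hom_def Uq_simps)
    then show "alg_auts (Uq q) \<noteq> {}" by blast
  next
    fix f assume f: "f \<in> alg_auts (Uq q)"
    then have f': "f \<in> carrier (Aut (Uq q))" by (simp add: Aut_def)
    have B: "f \<in> Bij ?S" using f by (simp add: alg_auts_def)
    let ?g = "\<lambda>x\<in>?S. inv_into ?S f x"
    have fg: "f (?g x) = x" "?g x \<in> ?S" if "x \<in> ?S" for x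
      using that B f_inv_into_f[of x f ?S] Bij_inv_into_mem[OF B that] by (auto simp: Bij_def bij_betw_def)
    have eq: "?g x = y" if "y \<in> ?S" "f y = x" for x y
      using that B by (auto simp: Bij_def bij_betw_def intro: inv_into_f_f)
    have "?g \<in> ring_hom (Uq q) (Uq q)"
    proof (rule ring_hom_memI)
      fix x y assume xy: "x \<in> ?S" "y \<in> ?S"
      show "?g x \<in> ?S" using xy fg by blast
      show "?g (x \<otimes>\<^bsub>Uq q\<^esub> y) = ?g x \<otimes>\<^bsub>Uq q\<^esub> ?g y"
        by (rule eq) (use op[OF fg(2)[OF xy(1)] fg(2)[OF xy(2)]] in blast,
            simp only: ring_hom_mult[OF AutD(2)[OF f']] fg xy)
      show "?g (x \<oplus>\<^bsub>Uq q\<^esub> y) = ?g x \<oplus>\<^bsub>Uq q\<^esub> ?g y"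
        by (rule eq) (use op[OF fg(2)[OF xy(1)] fg(2)[OF xy(2)]] in blast,
            simp only: ring_hom_add[OF AutD(2)[OF f']] fg xy)
    next
      show "?g \<one>\<^bsub>Uq q\<^esub> = \<one>\<^bsub>Uq q\<^esub>"
        by (rule eq) (use ring_hom_one[OF AutD(2)[OF f']] in \<open>auto simp: Uq_simps\<close>)
    qed
    moreover have "?g (c \<odot>\<^bsub>Uq q\<^esub> x) = c \<odot>\<^bsub>Uq q\<^esub> ?g x" if x: "x \<in> ?S" for c x
      by (rule eq) (use op(3)[OF fg(2)[OF x] fg(2)[OF x]] in blast,
          simp only: AutD(4)[OF f'] fg x)
    ultimately show "inv\<^bsub>BijGroup ?S\<^esub> f \<in> alg_auts (Uq q)"
      unfolding inv_BijGroup[OF B] alg_auts_def using restrict_inv_into_Bij[OF B] by blast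
  next
    fix f g assume fg: "f \<in> alg_auts (Uq q)" "g \<in> alg_auts (Uq q)"
    then have fg': "f \<in> carrier (Aut (Uq q))" "g \<in> carrier (Aut (Uq q))" by (simp_all add: Aut_def)
    have B: "f \<in> Bij ?S" "g \<in> Bij ?S" using fg by (simp_all add: alg_auts_def)
    have "compose ?S f g \<in> ring_hom (Uq q) (Uq q)"
    proof (rule ring_hom_memI)
      fix x y assume xy: "x \<in> ?S" "y \<in> ?S"
      note cl = AutD(5)[OF fg'(1)] AutD(5)[OF fg'(2)]
      have "x \<otimes>\<^bsub>Uq q\<^esub> y \<in> ?S" "x \<oplus>\<^bsub>Uq q\<^esub> y \<in> ?S" using op[OF xy] by blast+
      then show "compose ?S f g x \<in> ?S"
        "compose ?S f g (x \<otimes>\<^bsub>Uq q\<^esub> y) = compose ?S f g x \<otimes>\<^bsub>Uq q\<^esub> compose ?S f g y"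
        "compose ?S f g (x \<oplus>\<^bsub>Uq q\<^esub> y) = compose ?S f g x \<oplus>\<^bsub>Uq q\<^esub> compose ?S f g y"
        using xy by (simp_all add: compose_def cl ring_hom_mult[OF AutD(2)[OF fg'(1)]]
          ring_hom_mult[OF AutD(2)[OF fg'(2)]] ring_hom_add[OF AutD(2)[OF fg'(1)]]
          ring_hom_add[OF AutD(2)[OF fg'(2)]])
    next
      show "compose ?S f g \<one>\<^bsub>Uq q\<^esub> = \<one>\<^bsub>Uq q\<^esub>"
        using ring_hom_one[OF AutD(2)[OF fg'(1)]] ring_hom_one[OF AutD(2)[OF fg'(2)]]
        by (auto simp: compose_def Uq_simps)
    qed
    moreover have "compose ?S f g (c \<odot>\<^bsub>Uq q\<^esub> x) = c \<odot>\<^bsub>Uq q\<^esub> compose ?S f g x"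
      if x: "x \<in> ?S" for c x
      using op(3)[OF x x, of c] x by (simp add: compose_def AutD(4)[OF fg'(1)] AutD(4)[OF fg'(2)] AutD(5)[OF fg'(2)])
    ultimately show "f \<otimes>\<^bsub>BijGroup ?S\<^esub> g \<in> alg_auts (Uq q)"
      using B by (simp add: BijGroup_def alg_auts_def compose_Bij)
  qed
  then show ?thesis
    unfolding Aut_def by (rule group.subgroup_imp_group[OF group_BijGroup])
qed

lemma Aut_mult:
  assumes "f \<in> carrier (Aut (Uq q))" "g \<in> carrier (Aut (Uq q))" "x \<in> carrier (Uq q)"
  shows "(f \<otimes>\<^bsub>Aut (Uq q)\<^esub> g) x = f (g x)"
  using assms by (simp add: Aut_def BijGroup_def alg_auts_def compose_def)

lemma Aut_one: "x \<in> carrier (Uq q) \<Longrightarrow> \<one>\<^bsub>Aut (Uq q)\<^esub> x = x"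
  by (simp add: Aut_def BijGroup_def)

lemma Uq_gen_in_carrier: "Uq_gen q i \<in> carrier (Uq q)"
  by (simp add: Uq_gen_def Uq_simps)

lemma Aut_eqI':
  assumes "f \<in> carrier (Aut (Uq q))" "h \<in> carrier (Aut (Uq q))"
    "f (Uq_gen q E1) = h (Uq_gen q E1)" "f (Uq_gen q E2) = h (Uq_gen q E2)"
    "f (Uq_gen q E3) = h (Uq_gen q E3)"
  shows "f = h"
  by (rule Aut_eqI[OF assms(1,2)]) (metis assms(3-5) gen.exhaust)

lemma torus_subst_relator:
  assumes "r \<in> serre_relators q"
  shows "free_subst (\<lambda>i. scalar (l i) * free_gen i) r \<in> serre_ideal q"
proof -
  have scale: "scalar a * x * (scalar b * y) = scalar (a * b) * (x * y)" for a b :: 'a and x y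
    by (simp add: scalar_simps mult.assoc) (metis mult.assoc scalar_commute)
  have "\<exists>c. free_subst (\<lambda>i. scalar (l i) * free_gen i) r = scalar c * r"
    using assms unfolding serre_relators_def
  proof (elim UnE; clarsimp)
    show "\<exists>c. free_subst (\<lambda>i. scalar (l i) * free_gen i)
        (free_gen E1 * free_gen E3 - free_gen E3 * free_gen E1) =
        scalar c * (free_gen E1 * free_gen E3 - free_gen E3 * free_gen E1)"
      by (rule exI[of _ "l E1 * l E3"])
        (simp add: scal.eval_simps scale right_diff_distrib mult.commute[of "l E3"])
  next
    fix i j
    define q' where "q' = q + inverse q"
    have s: "scalar q' * (scalar a * x) = scalar a * (scalar q' * x)" for a and x :: "'a free_alg"
      by (metis mult.assoc scalar_commute)
    have l: "l j * (l i * l i) = l i * l i * l j" "l i * l j * l i = l i * l i * l j" by simp_all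
    show "\<exists>c. free_subst (\<lambda>i. scalar (l i) * free_gen i)
        ((free_gen i)\<^sup>2 * free_gen j - scalar (q + inverse q) * free_gen i * free_gen j * free_gen i +
          free_gen j * (free_gen i)\<^sup>2) =
        scalar c * ((free_gen i)\<^sup>2 * free_gen j
          - scalar (q + inverse q) * free_gen i * free_gen j * free_gen i +
          free_gen j * (free_gen i)\<^sup>2)"
      unfolding q'_def[symmetric]
      by (rule exI[of _ "l i * l i * l j"])
        (simp add: scal.eval_simps power2_eq_square scale s right_diff_distrib distrib_left
          mult.assoc[of "scalar q'"] l)
  qed
  then show ?thesis
    using serre_ideal_closed(2) serre_relators_subset assms by fastforce
qed

lemma torus_aut:
  assumes "l1 \<noteq> 0" "l2 \<noteq> 0" "l3 \<noteq> 0"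
  shows "torus_aut q (l1, l2, l3) \<in> carrier (Aut (Uq q))"
    and "torus_aut q (l1, l2, l3) (Uq_gen q E1) = l1 \<odot>\<^bsub>Uq q\<^esub> Uq_gen q E1"
    and "torus_aut q (l1, l2, l3) (Uq_gen q E2) = l2 \<odot>\<^bsub>Uq q\<^esub> Uq_gen q E2"
    and "torus_aut q (l1, l2, l3) (Uq_gen q E3) = l3 \<odot>\<^bsub>Uq q\<^esub> Uq_gen q E3"
proof -
  define l where "l = case_gen l1 l2 l3"
  have l: "l i \<noteq> 0" for i using assms by (cases i) (simp_all add: l_def)
  have inv: "scalar (inverse (l i)) * (scalar (l i) * x) = x"
    "scalar (l i) * (scalar (inverse (l i)) * x) = x" for i x
    using l[of i] by (simp_all add: mult.assoc[symmetric] scalar_simps(2)[symmetric] scalar_simps(3))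
  obtain f where f: "f \<in> carrier (Aut (Uq q))"
    "\<And>x. f (to_Uq q x) = to_Uq q (free_subst (\<lambda>i. scalar (l i) * free_gen i) x)"
    by (rule alg_aut_exists[OF torus_subst_relator[of _ q l] torus_subst_relator[of _ q "\<lambda>i. inverse (l i)"]])
      (simp_all add: scal.eval_simps inv)
  have "\<exists>!f. f \<in> carrier (Aut (Uq q)) \<and>
    f (Uq_gen q E1) = l1 \<odot>\<^bsub>Uq q\<^esub> Uq_gen q E1 \<and>
    f (Uq_gen q E2) = l2 \<odot>\<^bsub>Uq q\<^esub> Uq_gen q E2 \<and>
    f (Uq_gen q E3) = l3 \<odot>\<^bsub>Uq q\<^esub> Uq_gen q E3" (is "\<exists>!f. ?P f")
  proof (rule ex1I[of _ f])
    show "?P f" using f by (simp add: Uq_gen_def Uq_simps scal.eval_simps l_def)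
    then show "h = f" if "?P h" for h
      using that Aut_eqI'[of h q f] by simp
  qed
  from theI'[OF this] show "torus_aut q (l1, l2, l3) \<in> carrier (Aut (Uq q))"
    "torus_aut q (l1, l2, l3) (Uq_gen q E1) = l1 \<odot>\<^bsub>Uq q\<^esub> Uq_gen q E1"
    "torus_aut q (l1, l2, l3) (Uq_gen q E2) = l2 \<odot>\<^bsub>Uq q\<^esub> Uq_gen q E2"
    "torus_aut q (l1, l2, l3) (Uq_gen q E3) = l3 \<odot>\<^bsub>Uq q\<^esub> Uq_gen q E3"
    by (simp_all add: torus_aut_def)
qed

lemma diagram_subst_relator:
  assumes "r \<in> serre_relators q"
  shows "free_subst (case_gen (free_gen E3) (free_gen E2) (free_gen E1)) r \<in> serre_ideal q"
proof -
  let ?g = "case_gen (free_gen E3) (free_gen E2) (free_gen E1)"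
  have neg: "x - y \<in> serre_ideal q" if "y - x \<in> serre_ideal q" for x y
    using serre_ideal_closed(2)[OF that, of "- 1"] by simp
  show ?thesis
  proof (cases "r = free_gen E1 * free_gen E3 - free_gen E3 * free_gen E1")
    case True
    have "r \<in> serre_ideal q" using assms serre_relators_subset by blast
    then show ?thesis using True neg by (simp add: scal.eval_simps)
  next
    case False
    define f where "f = case_gen E3 E2 E1"
    have g: "free_subst ?g (free_gen i) = free_gen (f i)" for i
      by (cases i) (simp_all add: scal.eval_simps f_def)
    from False assms obtain i j where ij: "(i, j) \<in> adjacent"
      and r: "r = free_gen i ^ 2 * free_gen j
        - scalar (q + inverse q) * free_gen i * free_gen j * free_gen i + free_gen j * free_gen i ^ 2"
      unfolding serre_relators_def by blast
    have "(f i, f j) \<in> adjacent" using ij by (auto simp: adjacent_def f_def)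
    moreover have "free_subst ?g r = free_gen (f i) ^ 2 * free_gen (f j)
        - scalar (q + inverse q) * free_gen (f i) * free_gen (f j) * free_gen (f i)
        + free_gen (f j) * free_gen (f i) ^ 2"
      by (simp only: r scal.eval_add scal.eval_mult scal.eval_minus scal.eval_scalar g power2_eq_square)
    ultimately have "free_subst ?g r \<in> serre_relators q"
      unfolding serre_relators_def by blast
    then show ?thesis using serre_relators_subset by blast
  qed
qed

lemma diagram_aut:
  "diagram_aut q \<in> carrier (Aut (Uq q))"
  "diagram_aut q (Uq_gen q E1) = Uq_gen q E3"
  "diagram_aut q (Uq_gen q E2) = Uq_gen q E2"
  "diagram_aut q (Uq_gen q E3) = Uq_gen q E1"
proof -
  let ?g = "case_gen (free_gen E3) (free_gen E2) (free_gen E1)"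
  obtain f where f: "f \<in> carrier (Aut (Uq q))" "\<And>x. f (to_Uq q x) = to_Uq q (free_subst ?g x)"
    by (rule alg_aut_exists[OF diagram_subst_relator diagram_subst_relator])
      (auto simp: scal.eval_simps split: gen.split)
  have "\<exists>!f. f \<in> carrier (Aut (Uq q)) \<and>
    f (Uq_gen q E1) = Uq_gen q E3 \<and> f (Uq_gen q E2) = Uq_gen q E2 \<and>
    f (Uq_gen q E3) = Uq_gen q E1" (is "\<exists>!f. ?P f")
  proof (rule ex1I[of _ f])
    show "?P f" using f by (simp add: Uq_gen_def Uq_simps scal.eval_simps)
    then show "h = f" if "?P h" for h
      using that Aut_eqI'[of h q f] by simp
  qed
  from theI'[OF this] show "diagram_aut q \<in> carrier (Aut (Uq q))"
    "diagram_aut q (Uq_gen q E1) = Uq_gen q E3"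
    "diagram_aut q (Uq_gen q E2) = Uq_gen q E2"
    "diagram_aut q (Uq_gen q E3) = Uq_gen q E1"
    by (simp_all add: diagram_aut_def)
qed

lemma torus_simps:
  "carrier torus = {(a, b, c). a \<noteq> 0 \<and> b \<noteq> 0 \<and> c \<noteq> 0}"
  "(a, b, c) \<otimes>\<^bsub>torus\<^esub> (a', b', c') = (a * a', b * b', c * c')"
  "\<one>\<^bsub>torus\<^esub> = (1, 1, 1)"
  by (auto simp: torus_def Kstar_def)

lemma group_torus: "group torus"
proof -
  have "group (Kstar :: 'k :: field monoid)"
    by (rule groupI) (auto simp: Kstar_def intro: exI[of _ "inverse _"] left_inverse bexI[of _ "inverse _"])
  then show ?thesis unfolding torus_def by (intro DirProd_group)
qed

lemma Aut_mult_closed: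
  "f \<in> carrier (Aut (Uq q)) \<Longrightarrow> g \<in> carrier (Aut (Uq q)) \<Longrightarrow>
    f \<otimes>\<^bsub>Aut (Uq q)\<^esub> g \<in> carrier (Aut (Uq q))"
  using group.subgroup_self[OF group_Aut] subgroup.m_closed by fast

lemma torus_aut_hom: "torus_aut q \<in> hom torus (Aut (Uq q))"
proof (rule homI)
  fix l m :: "'a \<times> 'a \<times> 'a" assume lm: "l \<in> carrier torus" "m \<in> carrier torus"
  obtain a b c a' b' c' where [simp]: "l = (a, b, c)" "m = (a', b', c')" by (metis prod_cases3)
  have nz: "a \<noteq> 0" "b \<noteq> 0" "c \<noteq> 0" "a' \<noteq> 0" "b' \<noteq> 0" "c' \<noteq> 0" using lm by (simp_all add: torus_simps)
  note T = torus_aut[OF nz(1-3)] torus_aut[OF nz(4-6)]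
  show "torus_aut q (l \<otimes>\<^bsub>torus\<^esub> m) = torus_aut q l \<otimes>\<^bsub>Aut (Uq q)\<^esub> torus_aut q m"
  proof (rule Aut_eqI)
    fix i
    have *: "s \<odot>\<^bsub>Uq q\<^esub> (t \<odot>\<^bsub>Uq q\<^esub> Uq_gen q i) = (t * s) \<odot>\<^bsub>Uq q\<^esub> Uq_gen q i" for s t i
      by (simp add: Uq_gen_def Uq_simps scalar_simps mult.assoc mult.commute[of t]
          flip: scalar_simps(2)) (simp add: scalar_simps mult.assoc)
    show "torus_aut q (l \<otimes>\<^bsub>torus\<^esub> m) (Uq_gen q i) = (torus_aut q l \<otimes>\<^bsub>Aut (Uq q)\<^esub> torus_aut q m) (Uq_gen q i)"
      by (cases i) (simp_all add: torus_simps Aut_mult T nz torus_aut AutD(4) Uq_gen_in_carrier *)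
  qed (use nz in \<open>simp_all add: torus_simps torus_aut Aut_mult_closed\<close>)
qed (auto simp: torus_simps torus_aut)

lemma smult_gen_inj:
  assumes "c \<odot>\<^bsub>Uq q\<^esub> Uq_gen q i = d \<odot>\<^bsub>Uq q\<^esub> Uq_gen q i"
  shows "c = d"
proof -
  have "scalar c * free_gen i - scalar d * free_gen i \<in> serre_ideal q"
    using assms by (simp add: Uq_gen_def Uq_simps to_Uq_eq_iff)
  from character_vanishes[OF _ this, of "\<lambda>j. if j = i then 1 else 0"]
  show ?thesis by (cases i) (auto simp: id_scal.eval_simps)
qed

lemma torus_aut_inj: "inj_on (torus_aut q) (carrier torus)"
proof (rule inj_onI, clarsimp simp: torus_simps)
  fix a b c a' b' c' :: 'a
  assume nz: "a \<noteq> 0" "b \<noteq> 0" "c \<noteq> 0" "a' \<noteq> 0" "b' \<noteq> 0" "c' \<noteq> 0"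
    and eq: "torus_aut q (a, b, c) = torus_aut q (a', b', c')"
  show "a = a' \<and> b = b' \<and> c = c'"
    using torus_aut(2-4)[OF nz(1-3), of q, unfolded eq torus_aut(2-4)[OF nz(4-6), of q]] smult_gen_inj
    by metis
qed

lemma diagram_aut_square: "diagram_aut q \<otimes>\<^bsub>Aut (Uq q)\<^esub> diagram_aut q = \<one>\<^bsub>Aut (Uq q)\<^esub>"
proof (rule Aut_eqI)
  fix i
  show "(diagram_aut q \<otimes>\<^bsub>Aut (Uq q)\<^esub> diagram_aut q) (Uq_gen q i) = \<one>\<^bsub>Aut (Uq q)\<^esub> (Uq_gen q i)"
    by (cases i) (simp_all add: Aut_mult diagram_aut Aut_one Uq_gen_in_carrier)
qed (simp_all add: diagram_aut Aut_mult_closed group.is_monoid[OF group_Aut] monoid.one_closed)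

lemma diagram_aut_inv: "inv\<^bsub>Aut (Uq q)\<^esub> diagram_aut q = diagram_aut q"
  by (rule group.inv_equality[OF group_Aut]) (simp_all add: diagram_aut diagram_aut_square)

lemma diagram_aut_neq_one: "diagram_aut q \<noteq> \<one>\<^bsub>Aut (Uq q)\<^esub>"
proof
  assume "diagram_aut q = \<one>\<^bsub>Aut (Uq q)\<^esub>"
  then have "Uq_gen q E3 = Uq_gen q E1"
    using diagram_aut(2)[of q] Aut_one[OF Uq_gen_in_carrier, of q E1] by simp
  then have "free_gen E3 - free_gen E1 \<in> serre_ideal q"
    by (simp add: Uq_gen_def to_Uq_eq_iff)
  from character_vanishes[OF _ this, of "case_gen 0 0 1"] show False
    by (simp add: id_scal.eval_simps)
qed

lemma carrier_diagram_group: "carrier (diagram_group q) = {\<one>\<^bsub>Aut (Uq q)\<^esub>, diagram_aut q}"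
proof -
  interpret group "Aut (Uq q)" by (rule group_Aut)
  have "subgroup {\<one>\<^bsub>Aut (Uq q)\<^esub>, diagram_aut q} (Aut (Uq q))"
    by (rule subgroupI) (auto simp: diagram_aut diagram_aut_square diagram_aut_inv)
  then have "generate (Aut (Uq q)) {diagram_aut q} \<subseteq> {\<one>\<^bsub>Aut (Uq q)\<^esub>, diagram_aut q}"
    by (intro generate_subgroup_incl) auto
  moreover have "{\<one>\<^bsub>Aut (Uq q)\<^esub>, diagram_aut q} \<subseteq> generate (Aut (Uq q)) {diagram_aut q}"
    by (auto intro: generate.intros)
  ultimately show ?thesis by (auto simp: diagram_group_def)
qed

lemma diagram_group_simps:
  "f \<otimes>\<^bsub>diagram_group q\<^esub> g = f \<otimes>\<^bsub>Aut (Uq q)\<^esub> g" "\<one>\<^bsub>diagram_group q\<^esub> = \<one>\<^bsub>Aut (Uq q)\<^esub>"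
  by (simp_all add: diagram_group_def)

lemma order_diagram_group: "order (diagram_group q) = 2"
  using diagram_aut_neq_one[of q, symmetric] by (simp add: order_def carrier_diagram_group)

lemma diagram_conj_torus:
  assumes "a \<noteq> 0" "b \<noteq> 0" "c \<noteq> 0"
  shows "diagram_aut q \<otimes>\<^bsub>Aut (Uq q)\<^esub> torus_aut q (a, b, c) \<otimes>\<^bsub>Aut (Uq q)\<^esub> inv\<^bsub>Aut (Uq q)\<^esub> diagram_aut q
    = torus_aut q (c, b, a)"
proof (rule Aut_eqI)
  fix i
  show "(diagram_aut q \<otimes>\<^bsub>Aut (Uq q)\<^esub> torus_aut q (a, b, c) \<otimes>\<^bsub>Aut (Uq q)\<^esub>
      inv\<^bsub>Aut (Uq q)\<^esub> diagram_aut q) (Uq_gen q i) = torus_aut q (c, b, a) (Uq_gen q i)"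
    using assms by (cases i) (simp_all add: diagram_aut_inv Aut_mult Aut_mult_closed diagram_aut
        torus_aut AutD(4) AutD(5) Uq_gen_in_carrier)
qed (simp_all add: assms diagram_aut diagram_aut_inv torus_aut Aut_mult_closed)

lemma conj_action_simps:
  assumes "a \<noteq> 0" "b \<noteq> 0" "c \<noteq> 0"
  shows "conj_action q (diagram_aut q) (a, b, c) = (c, b, a)"
    and "conj_action q \<one>\<^bsub>Aut (Uq q)\<^esub> (a, b, c) = (a, b, c)"
proof -
  interpret group "Aut (Uq q)" by (rule group_Aut)
  have "inv_into (carrier torus) (torus_aut q) (torus_aut q l) = l" if "l \<in> carrier torus" for l
    using torus_aut_inj that by (rule inv_into_f_f)
  then show "conj_action q (diagram_aut q) (a, b, c) = (c, b, a)"
    "conj_action q \<one>\<^bsub>Aut (Uq q)\<^esub> (a, b, c) = (a, b, c)"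
    using assms by (simp_all add: conj_action_def diagram_conj_torus torus_aut torus_simps)
qed

lemma group_semidirect: "group (semidirect_product torus (diagram_group q) (conj_action q))"
proof -
  interpret group "Aut (Uq q)" by (rule group_Aut)
  show ?thesis
  proof (rule groupI, goal_cases)
    case (5 x)
    then obtain a b c h where x: "x = ((a, b, c), h)" by (metis prod.exhaust)
    show ?case
      using 5 unfolding x
      by (intro bexI[of _ "(conj_action q h (inverse a, inverse b, inverse c), h)"])
        (auto simp: semidirect_product_def carrier_diagram_group torus_simps conj_action_simps
          diagram_group_simps diagram_aut diagram_aut_square)
  qed (auto simp: semidirect_product_def carrier_diagram_group torus_simps conj_action_simps
      diagram_group_simps diagram_aut diagram_aut_square)
qed

end

(* The idea is Yakimov's rigidity of quantum tori.  Feigin's homomorphism for the reduced word 323123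
embeds U into a quantum torus; it is injective because a PBW basis of U has pairwise distinct leading
exponents.  U contains six quasi-commuting elements (a quantum cluster) that generate the torus.

Comparing the characters of U and their tangent spaces shows that an automorphism preserves the
augmentation ideal, and the Serre relations force its linear part to be diagonal or antidiagonal.  So,
up to the torus and the diagram automorphism, it is unipotent: x is mapped to x + (terms of higher degree).

Let F be unipotent and m a monomial in the cluster.  Expand F^-1(m) in the torus and group its terms by
their commutation factors with the cluster.  F maps different groups to elements whose leading terms
commute differently with the images of the cluster, so no cancellation occurs, and the group containing m
shows that the leading term of F(m) agrees with m modulo the centre.  This holds for an ordering of the
exponents and for the reverse ordering, so F(m) is m times a central element.  For m = e1, [e1,e2]_q and
[e1,e2]_(1/q) this element is a polynomial in the generators of the centre which has an inverse, hence it
is 1.  So F fixes e1 and e2, and e3 by symmetry. *)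

theory Submission
  imports Defs "HOL-Library.Product_Plus" "HOL-Library.Product_Lexorder"
begin

text \<open>An automorphism of U acts on the image \<open>A\<close> of U only, not on the torus, and
  the groups of an expansion need not lie in \<open>A\<close>. A Laurent monomial certainly lies in
  \<open>A\<close> if its cluster exponents are nonnegative; so denominators are cleared by a large
  cluster monomial, whose own image is divided out again at the level of leading exponents.
  Unipotence guarantees that the group of m occurs in the expansion of F^-1(m) at all, and it
  normalises the last remaining scalar to 1. The class of an exponent modulo the centre is its first
  component, so the lexicographic order compares classes first and a bound on leading exponents is a
  bound on classes. The central factor is a polynomial, not merely a Laurent polynomial, because no
  element of \<open>A\<close> has a negative exponent in \<open>D1\<close>, \<open>D3\<close> or
  \<open>D2\<close>; this is why the final step is restricted to monomials in which these three do
  not occur.\<close>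

abbreviation keys :: "('a \<Rightarrow>\<^sub>0 'b :: zero) \<Rightarrow> 'a set"
  where "keys \<equiv> Poly_Mapping.keys"

abbreviation lookup :: "('a \<Rightarrow>\<^sub>0 'b :: zero) \<Rightarrow> 'a \<Rightarrow> 'b"
  where "lookup \<equiv> Poly_Mapping.lookup"

abbreviation single :: "'a \<Rightarrow> 'b :: zero \<Rightarrow> 'a \<Rightarrow>\<^sub>0 'b"
  where "single \<equiv> Poly_Mapping.single"

section \<open>Ordered exponents and finitely supported functions\<close>

instance prod :: (linordered_ab_group_add, linordered_ab_group_add) linordered_ab_group_add
  by standard (auto simp: less_eq_prod_def)

lemma poly_mapping_add_induct:
  fixes x :: "'a \<Rightarrow>\<^sub>0 'b :: comm_monoid_add"
  assumes "\<And>k c. P (single k c)" "\<And>x y. P x \<Longrightarrow> P y \<Longrightarrow> P (x + y)"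
  shows "P x"
proof (induction x rule: update_induct)
  case const
  have "P (single undefined 0)" by (rule assms)
  then show ?case by simp
next
  case (update f a b)
  have "Poly_Mapping.update a b f = f + single a b"
    using update by (intro poly_mapping_eqI)
      (auto simp: lookup_update lookup_add lookup_single when_def in_keys_iff)
  then show ?case using update assms by simp
qed

lemma keys_sum_subset: "keys (\<Sum>i\<in>I. f i) \<subseteq> (\<Union>i\<in>I. keys (f i))"
proof (induction I rule: infinite_finite_induct)
  case (insert i I)
  then show ?case using keys_add[of "f i" "sum f I"] by auto
qed auto

lemma sum_single_lookup: "(\<Sum>a\<in>keys f. single a (lookup f a)) = f"
proof (rule poly_mapping_eqI)
  fix k
  have "lookup (\<Sum>a\<in>keys f. single a (lookup f a)) k
      = (\<Sum>a\<in>keys f. if a = k then lookup f a else 0)"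
    by (simp add: lookup_sum lookup_single when_def)
  also have "\<dots> = lookup f k" by (simp add: in_keys_iff)
  finally show "lookup (\<Sum>a\<in>keys f. single a (lookup f a)) k = lookup f k" .
qed

section \<open>The quantum torus\<close>

text \<open>An exponent \<open>((g, x, y, d), (r, s))\<close> stands for the Laurent monomial with exponents
  \<open>x\<close>, \<open>y\<close>, \<open>g + 3 * d\<close>, \<open>d + r\<close>, \<open>r\<close>, \<open>s\<close> in the six cluster elements \<open>e1\<close>, \<open>e12\<close>, \<open>e12'\<close>, \<open>D1\<close>,
  \<open>D3\<close>, \<open>D2\<close> below.  In these coordinates the central monomials are those with vanishing first
  component.  The shift by \<open>3 * d\<close> makes the lexicographic order select linearly independent
  leading exponents of the PBW generators.\<close>

type_synonym expo = "(int \<times> int \<times> int \<times> int) \<times> (int \<times> int)"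
type_synonym 'k qtorus = "expo \<Rightarrow>\<^sub>0 'k"

text \<open>Only the antisymmetrisation of this form matters: it gives the commutation factors.\<close>

fun bil :: "expo \<Rightarrow> expo \<Rightarrow> int"
  where "bil ((g, x, y, d), _) ((g', x', y', d'), _) =
    - g * x' - g * d' - x * y' + 2 * (x * d') - y * d'"

lemma bil_add: "bil (a + a') b = bil a b + bil a' b" "bil a (b + b') = bil a b + bil a b'"
proof -
  obtain g x y d m g1 x1 y1 d1 m1 g2 x2 y2 d2 m2 g3 x3 y3 d3 m3 where
    "a = ((g, x, y, d), m)" "a' = ((g1, x1, y1, d1), m1)"
    "b = ((g2, x2, y2, d2), m2)" "b' = ((g3, x3, y3, d3), m3)"
    by (metis prod.exhaust)
  then show "bil (a + a') b = bil a b + bil a' b" "bil a (b + b') = bil a b + bil a b'"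
    by (simp_all add: algebra_simps)
qed

lemma bil_0 [simp]: "bil 0 b = 0" "bil a 0 = 0"
  using bil_add(1)[of 0 0 b] bil_add(2)[of a 0 0] by simp_all

lemma bil_uminus: "bil (- a) b = - bil a b" "bil a (- b) = - bil a b"
  using bil_add(1)[of a "- a" b] bil_add(2)[of a b "- b"] by simp_all

definition skew :: "expo \<Rightarrow> expo \<Rightarrow> int"
  where "skew a b = bil a b - bil b a"

lemma skew_simps:
  "skew (a + a') b = skew a b + skew a' b" "skew a (b + b') = skew a b + skew a b'"
  "skew 0 b = 0" "skew a 0 = 0" "skew (- a) b = - skew a b" "skew a (- b) = - skew a b"
  by (simp_all add: skew_def bil_add bil_uminus)

locale qparam =
  fixes q :: "'k :: field_char_0"
  assumes q_nonzero [simp]: "q \<noteq> 0"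
    and q_not_root: "\<And>n :: nat. n > 0 \<Longrightarrow> q ^ n \<noteq> 1"
begin

lemma q_powi_eq_1_iff [simp]: "q powi n = 1 \<longleftrightarrow> n = 0"
proof
  assume *: "q powi n = 1"
  show "n = 0"
  proof (rule ccontr)
    assume "n \<noteq> 0"
    then have "nat \<bar>n\<bar> > 0" by simp
    moreover have "q ^ nat \<bar>n\<bar> = 1"
      using * by (auto simp: power_int_def abs_if power_inverse split: if_splits)
    ultimately show False using q_not_root by blast
  qed
qed simp

lemma q_powi_inject [simp]: "q powi m = q powi n \<longleftrightarrow> m = n"
proof
  assume "q powi m = q powi n"
  then have "q powi (m - n) = 1" by (simp add: power_int_diff)
  then show "m = n" by simp
qed simp

section \<open>Multiplication of the quantum torus\<close>

text \<open>The product \<open>*\<close> of this type is the untwisted, commutative convolution,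
  hence a separate operation. Bilinearity of \<open>bil\<close> is the cocycle condition behind
  associativity.\<close>

definition star :: "'k qtorus \<Rightarrow> 'k qtorus \<Rightarrow> 'k qtorus"  (infixl "\<star>" 70)
  where "f \<star> g = (\<Sum>a\<in>keys f. \<Sum>b\<in>keys g.
    single (a + b) (q powi bil a b * (lookup f a * lookup g b)))"

lemma star_superset:
  assumes "finite A" "keys f \<subseteq> A" "finite B" "keys g \<subseteq> B"
  shows "f \<star> g = (\<Sum>a\<in>A. \<Sum>b\<in>B.
    single (a + b) (q powi bil a b * (lookup f a * lookup g b)))"
  unfolding star_def
  by (intro sum.mono_neutral_cong_left) (use assms in \<open>auto intro!: sum.neutral simp: in_keys_iff\<close>)

lemma star_add_left: "(f + f') \<star> g = f \<star> g + f' \<star> g"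
proof -
  let ?A = "keys f \<union> keys f'"
  have "keys (f + f') \<subseteq> ?A" by (rule keys_add)
  then show ?thesis
    by (simp add: star_superset[of ?A _ "keys g"] lookup_add distrib_left distrib_right single_add sum.distrib)
qed

lemma star_add_right: "f \<star> (g + g') = f \<star> g + f \<star> g'"
proof -
  let ?A = "keys g \<union> keys g'"
  have "keys (g + g') \<subseteq> ?A" by (rule keys_add)
  then show ?thesis
    by (simp add: star_superset[of "keys f" _ ?A] lookup_add distrib_left distrib_right single_add sum.distrib)
qed

lemma star_0 [simp]: "0 \<star> g = 0" "f \<star> 0 = 0"
  by (simp_all add: star_def)

lemma star_sum: "(\<Sum>i\<in>I. f i) \<star> g = (\<Sum>i\<in>I. f i \<star> g)" "g \<star> (\<Sum>i\<in>I. f i) = (\<Sum>i\<in>I. g \<star> f i)"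
  by (induction I rule: infinite_finite_induct) (simp_all add: star_add_left star_add_right)

lemma star_single:
  "single a c \<star> single b d = single (a + b) (q powi bil a b * (c * d))"
  by (subst star_superset[of "{a}" _ "{b}"]) (simp_all split: if_splits)

lemma star_assoc: "(f \<star> g) \<star> h = f \<star> (g \<star> h)"
proof (induction f rule: poly_mapping_add_induct)
  case (1 a u)
  show ?case
  proof (induction g rule: poly_mapping_add_induct)
    case (1 b v)
    show ?case
      by (induction h rule: poly_mapping_add_induct)
        (simp_all add: star_single star_add_right bil_add power_int_add ac_simps)
  qed (simp add: star_add_left star_add_right)
qed (simp add: star_add_left)

definition sc :: "'k \<Rightarrow> 'k qtorus"
  where "sc c = single 0 c"

lemma lookup_map_mult: "lookup (Poly_Mapping.map ((*) c) (f :: 'k qtorus)) a = c * lookup f a"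
  by (simp add: map.rep_eq when_def)

lemma sc_star: "sc c \<star> f = Poly_Mapping.map ((*) c) f" "f \<star> sc c = Poly_Mapping.map ((*) c) f"
  unfolding sc_def
proof -
  have add: "Poly_Mapping.map ((*) c) (x + y) = Poly_Mapping.map ((*) c) x + Poly_Mapping.map ((*) c) y"
    for x y :: "'k qtorus"
    by (rule poly_mapping_eqI) (simp only: lookup_map_mult lookup_add distrib_left)
  show "single 0 c \<star> f = Poly_Mapping.map ((*) c) f" "f \<star> single 0 c = Poly_Mapping.map ((*) c) f"
    by (induction f rule: poly_mapping_add_induct)
      (simp_all add: add star_add_left star_add_right star_single mult.commute)
qed

lemma sc_commute: "sc c \<star> f = f \<star> sc c"
  by (simp add: sc_star)

lemma lookup_sc_star [simp]: "lookup (sc c \<star> f) a = c * lookup f a"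
  by (simp add: sc_star(1) lookup_map_mult)

lemma sc_simps: "sc 1 \<star> f = f" "f \<star> sc 1 = f" "sc 0 = 0" "sc (a + b) = sc a + sc b"
  "sc (- a) = - sc a" "sc (a - b) = sc a - sc b"
  "sc a \<star> sc b = sc (a * b)" "sc a \<star> single e d = single e (a * d)"
proof -
  show f: "sc 1 \<star> f = f" by (rule poly_mapping_eqI) simp
  then show "f \<star> sc 1 = f" by (simp add: sc_commute)
qed (simp_all add: sc_def single_add single_diff single_uminus star_single)

lemma sc_star_left_commute: "f \<star> (sc c \<star> g) = sc c \<star> (f \<star> g)"
  by (simp flip: star_assoc sc_commute)

lemma keys_sc_star: "keys (sc c \<star> f) = (if c = 0 then {} else keys f)"
  by (auto simp: in_keys_iff simp del: keys_eq_empty)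

lemma lookup_star:
  "lookup (f \<star> g) k = (\<Sum>a\<in>keys f. \<Sum>b\<in>keys g. if a + b = k then q powi bil a b * (lookup f a * lookup g b) else 0)"
  unfolding star_def by (simp add: lookup_sum lookup_single when_def)

lemma keys_star: "keys (f \<star> g) \<subseteq> {a + b | a b. a \<in> keys f \<and> b \<in> keys g}"
proof
  fix k assume k: "k \<in> keys (f \<star> g)"
  show "k \<in> {a + b | a b. a \<in> keys f \<and> b \<in> keys g}"
  proof (rule ccontr)
    assume "\<not> ?thesis"
    then have "lookup (f \<star> g) k = 0"
      unfolding lookup_star by (intro sum.neutral ballI) auto
    then show False using k by (simp add: in_keys_iff)
  qed
qed

lemma keys_starE:
  assumes "k \<in> keys (f \<star> g)"
  obtains a b where "k = a + b" "a \<in> keys f" "b \<in> keys g"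
  using subsetD[OF keys_star assms] by blast

text \<open>No cancellation is possible where an exponent arises in one way only; this serves
  products with a monomial as well as leading terms.\<close>

lemma lookup_star_unique:
  assumes "\<And>a b. a \<in> keys f \<Longrightarrow> b \<in> keys g \<Longrightarrow> a + b = a0 + b0 \<Longrightarrow> a = a0 \<and> b = b0"
  shows "lookup (f \<star> g) (a0 + b0) = q powi bil a0 b0 * (lookup f a0 * lookup g b0)"
proof -
  have "lookup (f \<star> g) (a0 + b0) = (\<Sum>a\<in>keys f. \<Sum>b\<in>keys g. if a = a0 \<and> b = b0 then q powi bil a0 b0 * (lookup f a0 * lookup g b0) else 0)"
    unfolding lookup_star by (intro sum.cong refl) (use assms in auto)
  also have "\<dots> = (\<Sum>a\<in>keys f. if a = a0 then \<Sum>b\<in>keys g. if b = b0 then q powi bil a0 b0 * (lookup f a0 * lookup g b0) else 0 else 0)"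
    by (intro sum.cong refl) (auto intro: sum.neutral)
  also have "\<dots> = q powi bil a0 b0 * (lookup f a0 * lookup g b0)"
    by (auto simp: in_keys_iff)
  finally show ?thesis .
qed

lemma lookup_star_single:
  "lookup (f \<star> single b c) (a + b) = q powi bil a b * (lookup f a * c)"
  "lookup (single b c \<star> f) (a + b) = q powi bil b a * (c * lookup f a)"
proof -
  show "lookup (f \<star> single b c) (a + b) = q powi bil a b * (lookup f a * c)"
    by (subst lookup_star_unique) (auto simp del: split_paired_All split: if_splits)
  have "lookup (single b c \<star> f) (b + a) = q powi bil b a * (c * lookup f a)"
    by (subst lookup_star_unique) (auto simp del: split_paired_All split: if_splits)
  then show "lookup (single b c \<star> f) (a + b) = q powi bil b a * (c * lookup f a)"
    by (simp only: add.commute)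
qed

text \<open>Compare the coefficients at \<open>a + b\<close>; as q is not a root of unity, equal
  powers of q have equal exponents.\<close>

lemma commute_single:
  assumes "f \<star> single b 1 = sc (q powi c) \<star> (single b 1 \<star> f)" "a \<in> keys f"
  shows "skew a b = c"
proof -
  have "q powi bil a b * lookup f a = q powi c * (q powi bil b a * lookup f a)"
    using arg_cong[OF assms(1), of "\<lambda>f. lookup f (a + b)"] by (simp add: lookup_star_single)
  then have "q powi bil a b = q powi (c + bil b a)"
    using assms(2) by (simp add: in_keys_iff power_int_add)
  then show ?thesis by (simp add: skew_def)
qed

section \<open>Leading exponents\<close>

text \<open>The maximum is taken after applying \<open>\<theta>\<close>; for an involution the
  leading exponent itself is \<open>\<theta> (lead \<theta> f)\<close>.\<close>

definition lead :: "(expo \<Rightarrow> expo) \<Rightarrow> 'k qtorus \<Rightarrow> expo"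
  where "lead \<theta> f = Max (\<theta> ` keys f)"

end

text \<open>\<open>\<theta>\<close> is the identity or the negation, so that \<open>lead \<theta>\<close> is taken with respect to the
  lexicographic order or its reverse.\<close>

locale qparam_order = qparam +
  fixes \<theta> :: "expo \<Rightarrow> expo"
  assumes \<theta>_add: "\<theta> (a + b) = \<theta> a + \<theta> b" and \<theta>_invol: "\<theta> (\<theta> a) = a"
begin

lemma lead_ge: "a \<in> keys f \<Longrightarrow> \<theta> a \<le> lead \<theta> f"
  by (simp add: lead_def)

lemma lead_in: "f \<noteq> 0 \<Longrightarrow> \<theta> (lead \<theta> f) \<in> keys f"
proof -
  assume "f \<noteq> 0"
  then have "lead \<theta> f \<in> \<theta> ` keys f" unfolding lead_def by (intro Max_in) simp_all
  then show ?thesis by (auto simp: \<theta>_invol)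
qed

text \<open>In an ordered group the sum of two maxima is attained by one pair only, so leading
  coefficients multiply and there are no zero divisors.\<close>

lemma lead_star:
  assumes "f \<noteq> 0" "g \<noteq> 0"
  shows "lead \<theta> (f \<star> g) = lead \<theta> f + lead \<theta> g" "f \<star> g \<noteq> 0"
    "lookup (f \<star> g) (\<theta> (lead \<theta> f) + \<theta> (lead \<theta> g)) =
      q powi bil (\<theta> (lead \<theta> f)) (\<theta> (lead \<theta> g)) * (lookup f (\<theta> (lead \<theta> f)) * lookup g (\<theta> (lead \<theta> g)))"
proof -
  let ?a = "\<theta> (lead \<theta> f)" and ?b = "\<theta> (lead \<theta> g)"
  show l: "lookup (f \<star> g) (?a + ?b) = q powi bil ?a ?b * (lookup f ?a * lookup g ?b)"
  proof (rule lookup_star_unique)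
    fix a b assume ab: "a \<in> keys f" "b \<in> keys g" "a + b = ?a + ?b"
    then have "\<theta> a + \<theta> b = lead \<theta> f + lead \<theta> g" by (metis \<theta>_add \<theta>_invol)
    moreover have "\<theta> a \<le> lead \<theta> f" "\<theta> b \<le> lead \<theta> g" using ab lead_ge by auto
    ultimately have "\<theta> a = lead \<theta> f" "\<theta> b = lead \<theta> g"
      by (metis add_less_le_mono add_le_less_mono order_less_irrefl antisym_conv2)+
    then show "a = ?a \<and> b = ?b" by (metis \<theta>_invol)
  qed
  then have *: "?a + ?b \<in> keys (f \<star> g)"
    using lead_in[OF assms(1)] lead_in[OF assms(2)] by (simp add: in_keys_iff)
  then show "f \<star> g \<noteq> 0" by auto
  show "lead \<theta> (f \<star> g) = lead \<theta> f + lead \<theta> g"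
    unfolding lead_def[of _ "f \<star> g"]
  proof (rule Max_eqI)
    fix y assume "y \<in> \<theta> ` keys (f \<star> g)"
    then obtain a b where "y = \<theta> (a + b)" "a \<in> keys f" "b \<in> keys g" using keys_star by blast
    then show "y \<le> lead \<theta> f + lead \<theta> g" using lead_ge by (simp add: \<theta>_add add_mono)
  next
    show "lead \<theta> f + lead \<theta> g \<in> \<theta> ` keys (f \<star> g)"
      using * by (rule rev_image_eqI) (simp add: \<theta>_add \<theta>_invol)
  qed simp
qed

text \<open>The summand with the largest leading exponent is alone at that exponent. Both the PBW
  theorem and the rigidity argument rest on this absence of cancellation.\<close>

lemma lead_sum_ge:
  assumes "finite I" "\<And>i. i \<in> I \<Longrightarrow> f i \<noteq> 0" "inj_on (\<lambda>i. lead \<theta> (f i)) I" "j \<in> I"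
  shows "(\<Sum>i\<in>I. f i) \<noteq> 0" "lead \<theta> (f j) \<le> lead \<theta> (\<Sum>i\<in>I. f i)"
proof -
  let ?L = "\<lambda>i. lead \<theta> (f i)"
  obtain m where m: "m \<in> I" "\<And>i. i \<in> I \<Longrightarrow> ?L i \<le> ?L m"
  proof -
    have "Max (?L ` I) \<in> ?L ` I" using assms by (intro Max_in) auto
    then obtain m where "m \<in> I" "?L m = Max (?L ` I)" by auto
    with that[of m] assms(1) show ?thesis by auto
  qed
  let ?k = "\<theta> (?L m)"
  have "lookup (f i) ?k = 0" if "i \<in> I" "i \<noteq> m" for i
  proof (rule ccontr)
    assume "lookup (f i) ?k \<noteq> 0"
    then have "\<theta> ?k \<le> ?L i" by (intro lead_ge) (simp add: in_keys_iff)
    then have "?L m = ?L i" using m(2)[OF that(1)] by (simp add: \<theta>_invol)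
    then show False using assms(3) m(1) that by (auto dest: inj_onD)
  qed
  then have "lookup (\<Sum>i\<in>I. f i) ?k = (\<Sum>i\<in>I. if i = m then lookup (f m) ?k else 0)"
    unfolding lookup_sum by (intro sum.cong) auto
  also have "\<dots> = lookup (f m) ?k" using assms(1) m(1) by simp
  finally have *: "?k \<in> keys (\<Sum>i\<in>I. f i)"
    using lead_in[OF assms(2)[OF m(1)]] by (simp add: in_keys_iff)
  then show "(\<Sum>i\<in>I. f i) \<noteq> 0" by auto
  have "?L m \<le> lead \<theta> (\<Sum>i\<in>I. f i)" using lead_ge[OF *] by (simp add: \<theta>_invol)
  then show "?L j \<le> lead \<theta> (\<Sum>i\<in>I. f i)" using m(2)[OF assms(4)] by order
qed

lemma lead_single [simp]: "c \<noteq> 0 \<Longrightarrow> lead \<theta> (single a c) = \<theta> a"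
  by (simp add: lead_def)

text \<open>Both products have their leading term at the same exponent; comparing the coefficients
  there turns a commutation rule of elements into one of leading exponents.\<close>

lemma lead_commutation:
  assumes "f \<noteq> 0" "g \<noteq> 0" "f \<star> g = sc (q powi c) \<star> (g \<star> f)"
  shows "skew (\<theta> (lead \<theta> f)) (\<theta> (lead \<theta> g)) = c"
proof -
  let ?a = "\<theta> (lead \<theta> f)" and ?b = "\<theta> (lead \<theta> g)"
  have nz: "lookup f ?a * lookup g ?b \<noteq> 0"
    using lead_in[OF assms(1)] lead_in[OF assms(2)] by (simp add: in_keys_iff)
  have "lookup (f \<star> g) (?a + ?b) = q powi c * lookup (g \<star> f) (?b + ?a)"
    unfolding assms(3) by (simp only: lookup_sc_star add.commute)
  then have "q powi bil ?a ?b * (lookup f ?a * lookup g ?b)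
      = q powi c * q powi bil ?b ?a * (lookup f ?a * lookup g ?b)"
    unfolding lead_star(3)[OF assms(1,2)] lead_star(3)[OF assms(2,1)] by (simp only: ac_simps)
  then have "q powi bil ?a ?b = q powi (c + bil ?b ?a)"
    using nz by (simp only: power_int_add q_nonzero mult_cancel_right simp_thms)
  then show ?thesis by (simp add: skew_def)
qed

end


section \<open>Feigin's homomorphism\<close>

text \<open>The total degree in the generators of the algebra.\<close>

fun tdeg :: "expo \<Rightarrow> int"
  where "tdeg ((g, x, y, d), (r, s)) = 2 * g + x + 2 * y + 9 * d + 6 * r + 4 * s"

lemma tdeg_add: "tdeg (a + b) = tdeg a + tdeg b"
proof -
  obtain g x y d r s g' x' y' d' r' s' where
    "a = ((g, x, y, d), (r, s))" "b = ((g', x', y', d'), (r', s'))"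
    by (metis prod.exhaust)
  then show ?thesis by simp
qed

lemma tdeg_0 [simp]: "tdeg 0 = 0"
  using tdeg_add[of 0 0] by simp

text \<open>The exponents of \<open>D1\<close>, \<open>D3\<close> and \<open>D2\<close> are nonnegative.\<close>

fun frozen_nonneg :: "expo \<Rightarrow> bool"
  where "frozen_nonneg ((g, x, y, d), (r, s)) \<longleftrightarrow> 0 \<le> d + r \<and> 0 \<le> r \<and> 0 \<le> s"

lemma frozen_nonneg_add: "frozen_nonneg a \<Longrightarrow> frozen_nonneg b \<Longrightarrow> frozen_nonneg (a + b)"
proof -
  obtain g x y d r s g' x' y' d' r' s' where
    "a = ((g, x, y, d), (r, s))" "b = ((g', x', y', d'), (r', s'))"
    by (metis prod.exhaust)
  then show "frozen_nonneg a \<Longrightarrow> frozen_nonneg b \<Longrightarrow> frozen_nonneg (a + b)" by simp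
qed

lemma frozen_nonneg_0 [simp]: "frozen_nonneg 0"
  by (simp add: zero_prod_def)

context qparam
begin

section \<open>Evaluation of the free algebra in the torus\<close>

primrec wev :: "(gen \<Rightarrow> 'k qtorus) \<Rightarrow> gen list \<Rightarrow> 'k qtorus"
  where "wev g [] = sc 1" | "wev g (i # w) = g i \<star> wev g w"

lemma wev_append: "wev g (v @ w) = wev g v \<star> wev g w"
  by (induction v) (simp_all add: sc_simps star_assoc)

definition tev :: "(gen \<Rightarrow> 'k qtorus) \<Rightarrow> 'k free_alg \<Rightarrow> 'k qtorus"
  where "tev g x = (\<Sum>w\<in>keys x. sc (lookup x w) \<star> wev g (letters w))"

lemma tev_single: "tev g (single w c) = sc c \<star> wev g (letters w)"
  by (simp add: tev_def sc_simps)

lemma tev_add: "tev g (x + y) = tev g x + tev g y"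
  unfolding tev_def
  by (rule setsum_keys_plus_distrib) (simp_all add: sc_simps star_add_left)

lemma tev_0 [simp]: "tev g 0 = 0"
  by (simp add: tev_def)

lemma tev_minus: "tev g (x - y) = tev g x - tev g y"
  using tev_add[of g "x - y" y] by (simp add: eq_diff_eq)

lemma tev_sum: "tev g (\<Sum>i\<in>I. f i) = (\<Sum>i\<in>I. tev g (f i))"
  by (induction I rule: infinite_finite_induct) (simp_all add: tev_add)

lemma tev_mult: "tev g (x * y) = tev g x \<star> tev g y"
proof (induction x rule: free_alg_induct)
  case (1 v c)
  show ?case
  proof (induction y rule: free_alg_induct)
    case (1 w d)
    show ?case
      unfolding mult_single tev_single plus_word_def word.sel wev_append sc_simps(7)[symmetric]
      by (simp only: star_assoc sc_star_left_commute[of "wev g (letters v)"])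
  qed (simp add: distrib_left tev_add star_add_right)
qed (simp add: distrib_right tev_add star_add_left)

lemma tev_scalar: "tev g (scalar c) = sc c"
  by (simp add: scalar_def tev_single zero_word_def sc_simps)

lemma tev_1: "tev g 1 = sc 1"
  using tev_scalar[of g 1] by (simp add: scalar_simps)

lemma tev_gen: "tev g (free_gen i) = g i"
  by (simp add: free_gen_def tev_single sc_simps)

lemmas tev_simps = tev_add tev_minus tev_mult tev_scalar tev_1 tev_gen

lemma tev_vanishes:
  assumes "\<And>r. r \<in> serre_relators q \<Longrightarrow> tev g r = 0" "x \<in> serre_ideal q"
  shows "tev g x = 0"
proof -
  have "serre_ideal q \<subseteq> {x. tev g x = 0}"
    by (rule serre_ideal_subset) (auto simp: assms(1) tev_simps)
  then show ?thesis using assms(2) by blast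
qed

lemma tev_keys:
  assumes g: "\<And>i a. a \<in> keys (g i) \<Longrightarrow> tdeg a = 1 \<and> frozen_nonneg a" and "a \<in> keys (tev g x)"
  shows "\<exists>w\<in>keys x. tdeg a = length (letters w)" "frozen_nonneg a"
proof -
  have w: "tdeg a = length v \<and> frozen_nonneg a" if "a \<in> keys (wev g v)" for v a
    using that
  proof (induction v arbitrary: a)
    case Nil
    then show ?case by (simp add: sc_def)
  next
    case (Cons i v)
    then have "a \<in> keys (g i \<star> wev g v)" by simp
    then obtain b c where "a = b + c" "b \<in> keys (g i)" "c \<in> keys (wev g v)"
      by (rule keys_starE)
    then show ?case using g[of b i] Cons.IH[of c] by (simp add: tdeg_add frozen_nonneg_add)
  qed
  obtain v where v: "v \<in> keys x" "a \<in> keys (sc (lookup x v) \<star> wev g (letters v))"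
    using assms(2) keys_sum_subset[of "\<lambda>w. sc (lookup x w) \<star> wev g (letters w)" "keys x"]
    unfolding tev_def by blast
  then have "a \<in> keys (wev g (letters v))" by (simp only: keys_sc_star split: if_splits) simp
  then show "\<exists>w\<in>keys x. tdeg a = length (letters w)" "frozen_nonneg a"
    using w v(1) by blast+
qed

text \<open>The six exponents are the torus variables \<open>t\<^sub>4\<close>; \<open>t\<^sub>2\<close>, \<open>t\<^sub>5\<close>; \<open>t\<^sub>1\<close>, \<open>t\<^sub>3\<close>, \<open>t\<^sub>6\<close> of Feigin's
  homomorphism for the reduced word \<open>323123\<close>.\<close>

definition gexp :: "gen \<Rightarrow> expo set"
  where "gexp = case_gen {((0, 1, 0, 0), (0, 0))} {((1, -1, 0, 0), (0, 0)), ((0, -1, 1, 0), (0, 0))}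
    {((2, 0, 0, -1), (1, 0)), ((-1, 1, -1, 0), (0, 1)), ((-3, 0, -1, 1), (0, 0))}"

text \<open>Only the last three letters \<open>123\<close> of the word are used.\<close>

definition gexp' :: "gen \<Rightarrow> expo set"
  where "gexp' = case_gen {((0, 1, 0, 0), (0, 0))} {((0, -1, 1, 0), (0, 0))} {((-3, 0, -1, 1), (0, 0))}"

section \<open>The Serre relations in the torus\<close>

definition expsum :: "expo set \<Rightarrow> 'k qtorus"
  where "expsum A = (\<Sum>a\<in>A. single a 1)"

lemma star_expsum:
  "expsum A \<star> expsum B = (\<Sum>a\<in>A. \<Sum>b\<in>B. single (a + b) (q powi bil a b))"
  by (simp only: expsum_def star_sum(1)) (simp only: star_sum(2) star_single mult_1_right)

text \<open>The contribution of one triple to the coefficient at \<open>a + a' + b\<close>. The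
  factor q + 1/q is split so that only powers of q occur; after symmetrising in \<open>a\<close> and
  \<open>a'\<close> they cancel in pairs.\<close>

definition serre_coeff :: "expo \<Rightarrow> expo \<Rightarrow> expo \<Rightarrow> 'k"
  where "serre_coeff a a' b = q powi (bil a a' + bil a b + bil a' b)
    - q powi (bil a a' + bil a b + bil b a' + 1) - q powi (bil a a' + bil a b + bil b a' - 1)
    + q powi (bil a a' + bil b a + bil b a')"

lemma serre_coeff_eq:
  "serre_coeff a a' b = q powi bil a a' * q powi (bil a b + bil a' b)
    - q powi bil a a' * ((q + inverse q) * q powi (bil a b + bil b a'))
    + q powi bil a a' * q powi (bil b a + bil b a')"
  by (simp add: serre_coeff_def power_int_add power_int_diff field_simps)

text \<open>The coefficient of a Serre relation at \<open>a + a' + b\<close> is antisymmetric in \<open>a\<close> and \<open>a'\<close>.\<close>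

lemma serre_expsum:
  assumes "\<And>a a' b. a \<in> A \<Longrightarrow> a' \<in> A \<Longrightarrow> b \<in> B \<Longrightarrow> serre_coeff a a' b + serre_coeff a' a b = 0"
  shows "expsum A \<star> expsum A \<star> expsum B - sc (q + inverse q) \<star> expsum A \<star> expsum B \<star> expsum A
    + expsum B \<star> (expsum A \<star> expsum A) = 0" (is "?S = 0")
proof -
  let ?F = "\<lambda>a a' b. single (a + a' + b) (serre_coeff a a' b)"
  have F: "?F a a' b + ?F a' a b = 0" if "a \<in> A" "a' \<in> A" "b \<in> B" for a a' b
    using assms[OF that] by (simp add: add.commute[of a'] flip: single_add)
  have 1: "expsum A \<star> expsum A \<star> expsum B
      = (\<Sum>b\<in>B. \<Sum>a\<in>A. \<Sum>a'\<in>A. single (a + a' + b) (q powi bil a a' * q powi (bil a b + bil a' b)))"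
    unfolding star_expsum unfolding expsum_def
    by (subst sum.swap[of _ _ B]) (simp add: star_sum star_single bil_add power_int_add sum.swap[of _ B] ac_simps)
  have 2: "sc (q + inverse q) \<star> expsum A \<star> expsum B \<star> expsum A
      = (\<Sum>b\<in>B. \<Sum>a\<in>A. \<Sum>a'\<in>A. single (a + a' + b) (q powi bil a a' * ((q + inverse q) * q powi (bil a b + bil b a'))))"
  proof -
    have "expsum A \<star> expsum B \<star> expsum A
        = (\<Sum>a\<in>A. \<Sum>b\<in>B. \<Sum>a'\<in>A. single (a + b + a') (q powi bil a b * q powi (bil a a' + bil b a')))"
      unfolding star_expsum unfolding expsum_def star_sum(1) unfolding star_sum(2) star_single bil_add
      by (simp add: ac_simps)
    also have "\<dots> = (\<Sum>b\<in>B. \<Sum>a\<in>A. \<Sum>a'\<in>A. single (a + a' + b) (q powi bil a a' * q powi (bil a b + bil b a')))"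
      by (subst sum.swap) (simp add: power_int_add ac_simps)
    finally show ?thesis
      by (simp only: star_assoc) (simp only: star_sum(2) sc_simps(8) mult.left_commute)
  qed
  have 3: "expsum B \<star> (expsum A \<star> expsum A)
      = (\<Sum>b\<in>B. \<Sum>a\<in>A. \<Sum>a'\<in>A. single (a + a' + b) (q powi bil a a' * q powi (bil b a + bil b a')))"
    unfolding star_expsum unfolding expsum_def star_sum(1) unfolding star_sum(2) star_single
    by (intro sum.cong refl arg_cong2[where f = single])
      (simp_all only: bil_add power_int_add q_nonzero mult_1_left mult_1_right simp_thms ac_simps)
  have "?S = (\<Sum>b\<in>B. \<Sum>a\<in>A. \<Sum>a'\<in>A. ?F a a' b)"
    unfolding 1 2 3 serre_coeff_eq
    by (simp only: single_add single_diff sum.distrib sum_subtractf)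
  also have "\<dots> = 0"
  proof (rule sum.neutral, rule ballI)
    fix b assume b: "b \<in> B"
    let ?s = "\<Sum>a\<in>A. \<Sum>a'\<in>A. ?F a a' b"
    \<comment> \<open>Exchanging the two summation variables changes the sign of \<open>?s\<close>;
      characteristic 0 then forces it to vanish.\<close>
    have "?s + ?s = (\<Sum>a\<in>A. \<Sum>a'\<in>A. ?F a a' b) + (\<Sum>a\<in>A. \<Sum>a'\<in>A. ?F a' a b)"
      by (subst (2) sum.swap) simp
    also have "\<dots> = 0"
      using F b by (simp flip: sum.distrib)
    finally have *: "?s + ?s = 0" .
    show "?s = 0"
    proof (rule poly_mapping_eqI)
      fix k
      have "lookup ?s k + lookup ?s k = 0" unfolding lookup_add[symmetric] * by (rule lookup_zero)
      then show "lookup ?s k = lookup 0 k" unfolding mult_2[symmetric] by (simp only: mult_eq_0_iff lookup_zero) simp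
    qed
  qed
  finally show ?thesis .
qed

lemma q_powi_minus_numeral: "q powi (- numeral n) = inverse q ^ numeral n" "q powi (-1) = inverse q"
  by (simp_all add: power_int_def power_inverse)

lemma gexp_serre:
  assumes "(i, j) \<in> adjacent" "a \<in> gexp i" "a' \<in> gexp i" "b \<in> gexp j"
  shows "serre_coeff a a' b + serre_coeff a' a b = 0"
  using assms
  by (auto simp: adjacent_def gexp_def serre_coeff_def)

lemma gexp'_subset: "gexp' i \<subseteq> gexp i"
  by (cases i) (simp_all add: gexp_def gexp'_def)

lemma gexp_commute: "a \<in> gexp E1 \<Longrightarrow> b \<in> gexp E3 \<Longrightarrow> bil a b = bil b a"
  by (auto simp: gexp_def)

text \<open>The cancellation takes place within pairs of exponents, so it passes to subsets; this
  yields the homomorphisms for \<open>gexp\<close> and \<open>gexp'\<close> together.\<close>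

lemma expsum_vanish:
  assumes A: "\<And>i. A i \<subseteq> gexp i" and r: "r \<in> serre_relators q"
  shows "tev (\<lambda>i. expsum (A i)) r = 0"
proof -
  from r consider "r = free_gen E1 * free_gen E3 - free_gen E3 * free_gen E1"
    | i j where "(i, j) \<in> adjacent" "r = free_gen i ^ 2 * free_gen j
        - scalar (q + inverse q) * free_gen i * free_gen j * free_gen i + free_gen j * free_gen i ^ 2"
    unfolding serre_relators_def by blast
  then show ?thesis
  proof cases
    case 1
    have "single (a + b) (q powi bil a b) = single (b + a) (q powi bil b a)" if "a \<in> A E1" "b \<in> A E3" for a b
    proof -
      have "bil a b = bil b a" by (rule gexp_commute) (use A that in blast)+
      then show ?thesis by (simp only: add.commute)
    qed
    then have "expsum (A E1) \<star> expsum (A E3) = expsum (A E3) \<star> expsum (A E1)"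
      unfolding star_expsum by (subst sum.swap) (intro sum.cong refl)
    then show ?thesis by (simp add: 1 tev_simps)
  next
    case 2
    have "serre_coeff a a' b + serre_coeff a' a b = 0" if "a \<in> A i" "a' \<in> A i" "b \<in> A j" for a a' b
      using gexp_serre[OF 2(1)] A that by blast
    from serre_expsum[OF this] show ?thesis
      unfolding 2(2) power2_eq_square tev_simps .
  qed
qed

lemma gexp_deg: "a \<in> gexp i \<Longrightarrow> tdeg a = 1 \<and> frozen_nonneg a"
  by (cases i) (auto simp: gexp_def)

lemma keys_expsum: "keys (expsum A) \<subseteq> A"
  unfolding expsum_def using keys_sum_subset[of "\<lambda>a. single a 1" A] by (auto split: if_splits)

definition \<pi> :: "'k free_alg \<Rightarrow> 'k qtorus"
  where "\<pi> = tev (\<lambda>i. expsum (gexp i))"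

definition \<pi>' :: "'k free_alg \<Rightarrow> 'k qtorus"
  where "\<pi>' = tev (\<lambda>i. expsum (gexp' i))"

lemmas \<pi>_simps = tev_simps[of "\<lambda>i. expsum (gexp i)", folded \<pi>_def]
lemmas \<pi>'_simps = tev_simps[of "\<lambda>i. expsum (gexp' i)", folded \<pi>'_def]

lemma \<pi>_vanishes: "x \<in> serre_ideal q \<Longrightarrow> \<pi> x = 0" "x \<in> serre_ideal q \<Longrightarrow> \<pi>' x = 0"
  unfolding \<pi>_def \<pi>'_def by (rule tev_vanishes[OF expsum_vanish]; use gexp'_subset in blast)+

lemma \<pi>_keys:
  assumes "a \<in> keys (\<pi> x)"
  shows "\<exists>w\<in>keys x. tdeg a = length (letters w)" "frozen_nonneg a"
  using tev_keys[OF _ assms[unfolded \<pi>_def]] gexp_deg keys_expsum by blast+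

section \<open>Root vectors and cluster elements\<close>

abbreviation "e1 \<equiv> free_gen E1 :: 'k free_alg"
abbreviation "e2 \<equiv> free_gen E2 :: 'k free_alg"
abbreviation "e3 \<equiv> free_gen E3 :: 'k free_alg"

text \<open>\<open>e12\<close>, \<open>e23\<close> and \<open>D1\<close> are the quantum root
  vectors; \<open>e12'\<close> and \<open>D3\<close> are the same q-commutators with q inverted.
  \<open>D2\<close> corrects \<open>e12 * e23\<close> so that its image is a single central
  monomial. The image of \<open>D1 * D3\<close> is central as well.\<close>

definition "e12 = e1 * e2 - scalar q * (e2 * e1)"
definition "e12' = e1 * e2 - scalar (inverse q) * (e2 * e1)"
definition "e23 = e2 * e3 - scalar q * (e3 * e2)"
definition "D1 = e12 * e3 - scalar q * (e3 * e12)"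
definition "D3 = e12' * e3 - scalar (inverse q) * (e3 * e12')"
definition "D2 = e12 * e23 - scalar (inverse q) * (e2 * D1)"

lemma \<pi>_gens:
  "\<pi> e1 = single ((0, 1, 0, 0), (0, 0)) 1"
  "\<pi> e2 = single ((1, -1, 0, 0), (0, 0)) 1 + single ((0, -1, 1, 0), (0, 0)) 1"
  "\<pi> e3 = single ((2, 0, 0, -1), (1, 0)) 1 + single ((-1, 1, -1, 0), (0, 1)) 1 + single ((-3, 0, -1, 1), (0, 0)) 1"
  by (simp_all add: \<pi>_simps expsum_def gexp_def)

definition "\<kappa> = inverse q - q"

lemma q_sq: "q * q \<noteq> 1" "q * q * q * q \<noteq> 1"
  using q_not_root[of 2] q_not_root[of 4] by (simp_all add: power2_eq_square eval_nat_numeral mult.assoc)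

lemma \<kappa>_nonzero [simp]: "\<kappa> \<noteq> 0"
  using q_sq by (simp add: \<kappa>_def field_simps)

lemma \<pi>_cluster:
  "\<pi> e12 = single ((0, 0, 1, 0), (0, 0)) \<kappa>"
  "\<pi> e12' = single ((1, 0, 0, 0), (0, 0)) (- (\<kappa> / q))"
  "\<pi> e23 = single ((0, 0, -1, 0), (0, 1)) (\<kappa> / q) + single ((-2, -1, -1, 1), (0, 0)) (\<kappa> / q ^ 3)
     + single ((-3, -1, 0, 1), (0, 0)) (\<kappa> / q ^ 3)"
  "\<pi> D1 = single ((-3, 0, 0, 1), (0, 0)) (\<kappa>\<^sup>2)"
  "\<pi> D3 = single ((3, 0, 0, -1), (1, 0)) (\<kappa>\<^sup>2 / q)"
  "\<pi> D2 = single ((0, 0, 0, 0), (0, 1)) (\<kappa>\<^sup>2 / q)"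
proof -
  show 1: "\<pi> e12 = single ((0, 0, 1, 0), (0, 0)) \<kappa>"
    unfolding e12_def \<pi>_simps(1-4) \<pi>_gens star_add_left star_add_right star_single sc_simps
    by (simp add: \<kappa>_def sc_simps q_powi_minus_numeral flip: single_diff)
  show 2: "\<pi> e12' = single ((1, 0, 0, 0), (0, 0)) (- (\<kappa> / q))"
    unfolding e12'_def \<pi>_simps(1-4) \<pi>_gens star_add_left star_add_right star_single sc_simps
    by (rule poly_mapping_eqI)
      (simp add: \<kappa>_def sc_simps q_powi_minus_numeral lookup_add lookup_minus lookup_single when_def field_simps power2_eq_square eval_nat_numeral)
  show 3: "\<pi> e23 = single ((0, 0, -1, 0), (0, 1)) (\<kappa> / q) + single ((-2, -1, -1, 1), (0, 0)) (\<kappa> / q ^ 3)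
     + single ((-3, -1, 0, 1), (0, 0)) (\<kappa> / q ^ 3)"
    unfolding e23_def \<pi>_simps(1-4) \<pi>_gens star_add_left star_add_right star_single sc_simps
    by (rule poly_mapping_eqI)
      (simp add: \<kappa>_def sc_simps q_powi_minus_numeral lookup_add lookup_minus lookup_single when_def field_simps power2_eq_square power3_eq_cube eval_nat_numeral)
  show 4: "\<pi> D1 = single ((-3, 0, 0, 1), (0, 0)) (\<kappa>\<^sup>2)"
    unfolding D1_def \<pi>_simps(1-4) \<pi>_gens 1 star_add_left star_add_right star_single sc_simps
    by (rule poly_mapping_eqI)
      (simp add: \<kappa>_def sc_simps q_powi_minus_numeral lookup_add lookup_minus lookup_single when_def field_simps power2_eq_square power3_eq_cube eval_nat_numeral)
  show 5: "\<pi> D3 = single ((3, 0, 0, -1), (1, 0)) (\<kappa>\<^sup>2 / q)"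
    unfolding D3_def \<pi>_simps(1-4) \<pi>_gens 2 star_add_left star_add_right star_single sc_simps
    by (rule poly_mapping_eqI)
      (simp add: \<kappa>_def sc_simps q_powi_minus_numeral lookup_add lookup_minus lookup_single when_def field_simps power2_eq_square power3_eq_cube eval_nat_numeral)
  show "\<pi> D2 = single ((0, 0, 0, 0), (0, 1)) (\<kappa>\<^sup>2 / q)"
    unfolding D2_def \<pi>_simps(1-4) \<pi>_gens 1 3 4 star_add_left star_add_right star_single sc_simps
    by (rule poly_mapping_eqI)
      (simp add: \<kappa>_def sc_simps q_powi_minus_numeral lookup_add lookup_minus lookup_single when_def field_simps power2_eq_square power3_eq_cube eval_nat_numeral)
qed


section \<open>A PBW basis\<close>

definition cong :: "'k free_alg \<Rightarrow> 'k free_alg \<Rightarrow> bool"  (infix "\<doteq>" 50)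
  where "x \<doteq> y \<longleftrightarrow> to_Uq q x = to_Uq q y"

lemma cong_iff: "x \<doteq> y \<longleftrightarrow> x - y \<in> serre_ideal q"
  by (simp add: cong_def to_Uq_eq_iff)

lemma cong_refl [simp]: "x \<doteq> x"
  by (simp add: cong_def)

lemma cong_trans [trans]: "x \<doteq> y \<Longrightarrow> y \<doteq> z \<Longrightarrow> x \<doteq> z"
  by (simp add: cong_def)

lemma cong_eq_trans [trans]: "x \<doteq> y \<Longrightarrow> y = z \<Longrightarrow> x \<doteq> z" "x = y \<Longrightarrow> y \<doteq> z \<Longrightarrow> x \<doteq> z"
  by simp_all

lemma cong_mult: "x \<doteq> x' \<Longrightarrow> y \<doteq> y' \<Longrightarrow> x * y \<doteq> x' * y'"
  unfolding cong_def by (metis Uq_simps(2))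

lemma cong_add: "x \<doteq> x' \<Longrightarrow> y \<doteq> y' \<Longrightarrow> x + y \<doteq> x' + y'"
  unfolding cong_def by (metis Uq_simps(3))

lemma ideal_closed:
  "x \<in> serre_ideal q \<Longrightarrow> y * x \<in> serre_ideal q" "x \<in> serre_ideal q \<Longrightarrow> x * y \<in> serre_ideal q"
  "x \<in> serre_ideal q \<Longrightarrow> y \<in> serre_ideal q \<Longrightarrow> x + y \<in> serre_ideal q"
  "x \<in> serre_ideal q \<Longrightarrow> y \<in> serre_ideal q \<Longrightarrow> x - y \<in> serre_ideal q"
  "x \<in> serre_ideal q \<Longrightarrow> - x \<in> serre_ideal q"
proof -
  have neg: "- x \<in> serre_ideal q" if "x \<in> serre_ideal q" for x
    using serre_ideal_closed(2)[OF that, of "- 1"] by simp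
  then show "x \<in> serre_ideal q \<Longrightarrow> - x \<in> serre_ideal q" .
  show "x \<in> serre_ideal q \<Longrightarrow> x * y \<in> serre_ideal q"
    using ideal.I_r_closed[OF serre_ideal, of x q y] by simp
  show "x - y \<in> serre_ideal q" if "x \<in> serre_ideal q" "y \<in> serre_ideal q"
    using serre_ideal_closed(1)[OF that(1) neg[OF that(2)]] by simp
qed (use serre_ideal_closed in blast)+

lemma scalar_left_commute: "x * (scalar c * y) = scalar c * (x * y)"
  by (metis mult.assoc scalar_commute)

lemma scalar_scalar: "scalar a * (scalar b * x) = scalar (a * b) * x"
  by (simp add: scalar_simps mult.assoc)

definition "comm13 = e1 * e3 - e3 * e1"

text \<open>The relator in right-nested form with the scalar split, so that identities in the free
  algebra can be checked by expansion with \<open>scalar_push\<close>.\<close>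

definition "serre i j = free_gen i * (free_gen i * free_gen j)
  - (scalar q + scalar (inverse q)) * (free_gen i * (free_gen j * free_gen i))
  + free_gen j * (free_gen i * (free_gen i :: 'k free_alg))"

lemma comm13_in_ideal: "comm13 \<in> serre_ideal q"
  unfolding comm13_def by (rule subsetD[OF serre_relators_subset]) (simp add: serre_relators_def)

lemma serre_in_ideal: "(i, j) \<in> adjacent \<Longrightarrow> serre i j \<in> serre_ideal q"
proof -
  assume ij: "(i, j) \<in> adjacent"
  have "serre i j = free_gen i ^ 2 * free_gen j
      - scalar (q + inverse q) * free_gen i * free_gen j * free_gen i + free_gen j * free_gen i ^ 2"
    by (simp add: serre_def scalar_simps power2_eq_square mult.assoc)
  also have "\<dots> \<in> serre_relators q" using ij unfolding serre_relators_def by blast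
  finally show ?thesis using serre_relators_subset by blast
qed

lemma scalar_push:
  "free_gen i * scalar c = scalar c * free_gen i" "free_gen i * (scalar c * x) = scalar c * (free_gen i * x)"
  "scalar q * scalar (inverse q) = 1" "scalar (inverse q) * scalar q = 1"
  "scalar q * (scalar (inverse q) * x) = x" "scalar (inverse q) * (scalar q * x) = x"
proof -
  show "free_gen i * scalar c = scalar c * free_gen i" by (rule scalar_commute[symmetric])
  show "free_gen i * (scalar c * x) = scalar c * (free_gen i * x)" by (rule scalar_left_commute)
  show q: "scalar q * scalar (inverse q) = 1" "scalar (inverse q) * scalar q = 1"
    by (simp_all add: scalar_simps(3) flip: scalar_simps(2))
  show "scalar q * (scalar (inverse q) * x) = x" "scalar (inverse q) * (scalar q * x) = x"
    by (simp_all add: q flip: mult.assoc)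
qed

section \<open>Commutation relations between root vectors\<close>

definition "rel_a = e12 * e1 - scalar q * (e1 * e12)"
definition "rel_c = D1 * e2 - e2 * D1"
definition "rel_d = D1 * e1 - scalar q * (e1 * D1)"
definition "rel_h = e3 * e23 - scalar q * (e23 * e3)"

text \<open>Certificates in the free algebra: each commutation defect is written as a combination of
  Serre relators, of \<open>comm13\<close> and of other defects, which reduces ideal membership to
  expanding both sides.\<close>

lemma rel_identities:
  "rel_a = - (scalar q * serre E1 E2)"
  "e2 * e12 - scalar q * (e12 * e2) = - (scalar q * serre E2 E1)"
  "e23 * e2 - scalar q * (e2 * e23) = - (scalar q * serre E2 E3)"
  "rel_h = - (scalar q * serre E3 E2)"
  "rel_d = rel_a * e3 - e12 * comm13 - scalar q * (e3 * rel_a) + scalar q * (scalar q * (comm13 * e12))"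
  "D1 * e12 - scalar q * (e12 * D1) = rel_d * e2 + scalar q * (e1 * rel_c) - scalar q * (rel_c * e1) - scalar q * (e2 * rel_d)"
  by (simp_all add: rel_a_def rel_c_def rel_d_def rel_h_def e12_def e23_def D1_def serre_def comm13_def
      algebra_simps scalar_push)

text \<open>The first identity compares the two expressions of \<open>e12 * e23 - e23 * e12\<close> by \<open>D1\<close> and \<open>e2\<close>
  obtained from \<open>D1 = [e12, e3]\<close> and from \<open>D1 = [e1, e23] + z\<close> with \<open>z\<close> in the ideal.\<close>

lemma rel_identities':
  defines "z \<equiv> scalar q * (comm13 * e2 - e2 * comm13)"
  shows "rel_c + scalar q * (scalar q * rel_c) =
      z * e2 - scalar q * (scalar q * (e2 * z)) + scalar q * (serre E2 E1 * e3)
      - scalar q * (scalar q * (scalar q * (e3 * serre E2 E1))) - scalar q * (e1 * serre E2 E3)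
      + scalar q * (scalar q * (scalar q * (serre E2 E3 * e1)))"
    "e3 * D1 - scalar q * (D1 * e3) = e3 * z - scalar q * (z * e3) + e1 * rel_h - comm13 * e23
      - scalar q * (rel_h * e1) + scalar q * (scalar q * (e23 * comm13))"
  by (simp_all add: z_def rel_c_def rel_h_def e12_def e23_def D1_def serre_def comm13_def
      algebra_simps scalar_push)

lemma relations:
  "e3 * e1 \<doteq> scalar 1 * (e1 * e3)" "e12 * e1 \<doteq> scalar q * (e1 * e12)" "e2 * e12 \<doteq> scalar q * (e12 * e2)"
  "e23 * e2 \<doteq> scalar q * (e2 * e23)" "e3 * e23 \<doteq> scalar q * (e23 * e3)"
  "e2 * D1 \<doteq> scalar 1 * (D1 * e2)" "D1 * e12 \<doteq> scalar q * (e12 * D1)" "e3 * D1 \<doteq> scalar q * (D1 * e3)"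
proof -
  note I = ideal_closed comm13_in_ideal serre_in_ideal
  have adj: "(E1, E2) \<in> adjacent" "(E2, E1) \<in> adjacent" "(E2, E3) \<in> adjacent" "(E3, E2) \<in> adjacent"
    by (simp_all add: adjacent_def)
  have a: "rel_a \<in> serre_ideal q" and h: "rel_h \<in> serre_ideal q"
    unfolding rel_identities by (simp_all only: I adj)
  then have d: "rel_d \<in> serre_ideal q"
    unfolding rel_identities(5) by (simp only: I a)
  \<comment> \<open>The available identity shows only that (1 + q^2) \<open>rel_c\<close> lies in
    the ideal; q^4 being different from 1 allows division by the factor.\<close>
  have "1 + q * q \<noteq> 0"
    using q_sq(2) by (metis add.commute add_eq_0_iff mult.assoc mult_minus1 mult_minus1_right square_eq_1_iff)
  then have "rel_c = scalar (inverse (1 + q * q)) * (rel_c + scalar q * (scalar q * rel_c))"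
    by (metis (no_types, lifting) scalar_simps(1,3) scalar_scalar distrib_right left_inverse mult_1)
  also have "\<dots> \<in> serre_ideal q"
    unfolding rel_identities' by (simp only: I adj)
  finally have c: "rel_c \<in> serre_ideal q" .
  show "e3 * e1 \<doteq> scalar 1 * (e1 * e3)"
    using I(5)[OF comm13_in_ideal] by (simp add: cong_iff comm13_def scalar_simps)
  show "e12 * e1 \<doteq> scalar q * (e1 * e12)"
    using a by (simp add: cong_iff rel_a_def)
  show "e2 * e12 \<doteq> scalar q * (e12 * e2)"
    unfolding cong_iff rel_identities by (simp only: I adj)
  show "e23 * e2 \<doteq> scalar q * (e2 * e23)"
    unfolding cong_iff rel_identities by (simp only: I adj)
  show "e3 * e23 \<doteq> scalar q * (e23 * e3)"
    using h by (simp add: cong_iff rel_h_def)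
  show "e2 * D1 \<doteq> scalar 1 * (D1 * e2)"
    using I(5)[OF c] by (simp add: cong_iff rel_c_def scalar_simps)
  show "D1 * e12 \<doteq> scalar q * (e12 * D1)"
    unfolding cong_iff rel_identities(6) by (simp only: I c d)
  show "e3 * D1 \<doteq> scalar q * (D1 * e3)"
    unfolding cong_iff rel_identities' by (simp only: I h)
qed

lemma cong_scalar: "x \<doteq> y \<Longrightarrow> scalar c * x \<doteq> scalar c * y"
  by (rule cong_mult) simp_all

text \<open>The scalar stays existential since spanning does not depend on it; the arbitrary right
  factor \<open>r\<close> makes the rule applicable inside right-nested monomials.\<close>

lemma commute_power:
  assumes "x * y \<doteq> scalar c * (y * x)"
  shows "\<exists>d. \<forall>r. x * (y ^ n * r) \<doteq> scalar d * (y ^ n * (x * r))"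
proof (induction n)
  case 0
  then show ?case by (intro exI[of _ 1]) (simp add: scalar_simps)
next
  case (Suc n)
  then obtain d where d: "\<And>r. x * (y ^ n * r) \<doteq> scalar d * (y ^ n * (x * r))" by blast
  have "x * (y ^ Suc n * r) \<doteq> scalar (c * d) * (y ^ Suc n * (x * r))" for r
  proof -
    have "x * (y ^ Suc n * r) = (x * y) * (y ^ n * r)" by (simp add: mult.assoc)
    also have "\<dots> \<doteq> (scalar c * (y * x)) * (y ^ n * r)" by (rule cong_mult[OF assms cong_refl])
    also have "\<dots> = scalar c * y * (x * (y ^ n * r))" by (simp add: mult.assoc)
    also have "\<dots> \<doteq> scalar c * y * (scalar d * (y ^ n * (x * r)))" by (rule cong_mult[OF cong_refl d])
    also have "\<dots> = scalar (c * d) * (y ^ Suc n * (x * r))"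
      by (simp add: scalar_left_commute[of y] scalar_scalar mult.assoc)
    finally show ?thesis .
  qed
  then show ?case by blast
qed

text \<open>Passing \<open>x\<close> across one \<open>y\<close> leaves a correction
  \<open>z\<close>; since \<open>z\<close> itself q-commutes with \<open>y\<close>, all corrections
  collect in a single term.\<close>

lemma skew_commute_power_Suc:
  assumes "x * y \<doteq> scalar c * (y * x) + scalar c' * z" "z * y \<doteq> scalar d * (y * z)"
  shows "\<exists>a b. \<forall>r. x * (y ^ Suc n * r) \<doteq> scalar a * (y ^ Suc n * (x * r)) + scalar b * (y ^ n * (z * r))"
proof (induction n)
  case 0
  have "x * (y * r) \<doteq> scalar c * (y * (x * r)) + scalar c' * (z * r)" for r
    using cong_mult[OF assms(1) cong_refl[of r]] by (simp add: mult.assoc distrib_right)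
  then show ?case by (intro exI[of _ c] exI[of _ c']) simp
next
  case (Suc n)
  let ?y = "y ^ Suc n"
  obtain a b where ab: "\<And>r. x * (?y * r) \<doteq> scalar a * (?y * (x * r)) + scalar b * (y ^ n * (z * r))"
    using Suc by blast
  obtain e where e: "\<And>r. z * (?y * r) \<doteq> scalar e * (?y * (z * r))"
    using commute_power[OF assms(2)] by blast
  have "x * (y ^ Suc (Suc n) * r)
      \<doteq> scalar (c * a) * (y ^ Suc (Suc n) * (x * r)) + scalar (c * b + c' * e) * (?y * (z * r))" for r
  proof -
    have "x * (y ^ Suc (Suc n) * r) = (x * y) * (?y * r)" by (simp add: mult.assoc)
    also have "\<dots> \<doteq> (scalar c * (y * x) + scalar c' * z) * (?y * r)" by (rule cong_mult[OF assms(1) cong_refl])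
    also have "\<dots> = scalar c * y * (x * (?y * r)) + scalar c' * (z * (?y * r))"
      by (simp only: mult.assoc distrib_right)
    also have "\<dots> \<doteq> scalar c * y * (scalar a * (?y * (x * r)) + scalar b * (y ^ n * (z * r)))
        + scalar c' * (scalar e * (?y * (z * r)))"
      by (intro cong_add cong_mult cong_refl ab e)
    also have "\<dots> = scalar (c * a) * (y ^ Suc (Suc n) * (x * r)) + scalar (c * b + c' * e) * (?y * (z * r))"
      by (simp add: scalar_left_commute[of y] scalar_scalar mult.assoc distrib_left distrib_right scalar_simps(1))
    finally show ?thesis .
  qed
  then show ?case by blast
qed

lemma skew_commute_power:
  assumes "x * y \<doteq> scalar c * (y * x) + scalar c' * z" "z * y \<doteq> scalar d * (y * z)"
  shows "\<exists>a b. \<forall>r. x * (y ^ n * r) \<doteq> scalar a * (y ^ n * (x * r)) + scalar b * (y ^ (n - 1) * (z * r))"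
proof (cases n)
  \<comment> \<open>Here the truncated \<open>n - 1\<close> is again 0, and the correction is
    removed by choosing the coefficient 0.\<close>
  case 0
  have "scalar (0 :: 'k) = 0" by (simp add: scalar_def)
  then have "\<forall>r. x * (y ^ n * r) \<doteq> scalar 1 * (y ^ n * (x * r)) + scalar 0 * (y ^ (n - 1) * (z * r))"
    by (simp add: 0 scalar_simps)
  then show ?thesis by blast
next
  case (Suc m)
  then show ?thesis using skew_commute_power_Suc[OF assms, of m] by simp
qed

lemma straighten:
  "e2 * e1 \<doteq> scalar (inverse q) * (e1 * e2) + scalar (- inverse q) * e12"
  "e3 * e12 \<doteq> scalar (inverse q) * (e12 * e3) + scalar (- inverse q) * D1"
  "e3 * e2 \<doteq> scalar (inverse q) * (e2 * e3) + scalar (- inverse q) * e23"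
proof -
  have m: "scalar (- inverse q) * x = - (scalar (inverse q) * x)" for x
    by (simp add: scalar_def single_uminus)
  have "x * y = scalar (inverse q) * (y * x) + scalar (- inverse q) * (y * x - scalar q * (x * y))" for x y
    by (simp add: m right_diff_distrib scalar_push)
  then show "e2 * e1 \<doteq> scalar (inverse q) * (e1 * e2) + scalar (- inverse q) * e12"
    "e3 * e12 \<doteq> scalar (inverse q) * (e12 * e3) + scalar (- inverse q) * D1"
    "e3 * e2 \<doteq> scalar (inverse q) * (e2 * e3) + scalar (- inverse q) * e23"
    unfolding e12_def[symmetric] D1_def e23_def by (metis cong_refl e12_def)+
qed

section \<open>Ordered monomials span U\<close>

type_synonym pbw_index = "nat \<times> nat \<times> nat \<times> nat \<times> nat \<times> nat"

text \<open>One factor for each of the six positive roots, in a convex order: every root that is a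
  sum of two others stands between them.\<close>

fun pbw :: "pbw_index \<Rightarrow> 'k free_alg"
  where "pbw (a, b, c, d, f, g) = e1 ^ a * (e12 ^ b * (D1 ^ c * (e2 ^ d * (e23 ^ f * e3 ^ g))))"

text \<open>The span is formed in the free algebra; closure under congruence takes the place of
  passing to the quotient.\<close>

inductive_set pbw_span :: "'k free_alg set"
  where
    pbw: "scalar c * pbw n \<in> pbw_span"
  | add: "x \<in> pbw_span \<Longrightarrow> y \<in> pbw_span \<Longrightarrow> x + y \<in> pbw_span"
  | congr: "x \<in> pbw_span \<Longrightarrow> y \<doteq> x \<Longrightarrow> y \<in> pbw_span"

lemma pbw_span_scalar: "x \<in> pbw_span \<Longrightarrow> scalar c * x \<in> pbw_span"
proof (induction rule: pbw_span.induct)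
  case (pbw d n)
  then show ?case by (simp only: scalar_scalar pbw_span.pbw)
next
  case (add x y)
  then show ?case by (simp add: distrib_left pbw_span.add)
next
  case (congr x y)
  then show ?case by (meson pbw_span.congr cong_scalar)
qed

lemma pbw_span_step:
  assumes "u * x \<in> pbw_span" "y \<doteq> scalar a * x"
  shows "u * y \<in> pbw_span"
proof (rule pbw_span.congr)
  show "u * y \<doteq> scalar a * (u * x)"
    using cong_mult[OF cong_refl[of u] assms(2)] by (simp add: scalar_left_commute[of u])
qed (rule pbw_span_scalar[OF assms(1)])

lemma pbw_span_step2:
  assumes "u * x \<in> pbw_span" "u * z \<in> pbw_span" "y \<doteq> scalar a * x + scalar b * z"
  shows "u * y \<in> pbw_span"
proof (rule pbw_span.congr)
  show "u * y \<doteq> scalar a * (u * x) + scalar b * (u * z)"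
    using cong_mult[OF cong_refl[of u] assms(3)] by (simp add: scalar_left_commute[of u] distrib_left)
qed (intro pbw_span.add pbw_span_scalar assms)

lemma pbw_in_span: "pbw n \<in> pbw_span"
  using pbw_span.pbw[of 1 n] by (simp add: scalar_simps)

text \<open>The generator is moved right to its own place. Only e2 past e1, e3 past
  \<open>e12\<close> and e3 past e2 leave corrections, namely \<open>e12\<close>, \<open>D1\<close>
  and \<open>e23\<close>, and each arises exactly at the position where the order wants it, so no
  second reordering is required.\<close>

lemma gen_pbw: "free_gen i * pbw n \<in> pbw_span"
proof -
  obtain a b c d f g where n: "n = (a, b, c, d, f, g)" by (metis prod.exhaust)
  note pb = pbw_in_span[of "(x1, x2, x3, x4, x5, x6)" for x1 x2 x3 x4 x5 x6, unfolded pbw.simps]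
  show ?thesis
  proof (cases i)
    case E1
    show ?thesis using pb[of "Suc a" b c d f g] by (simp add: n E1 mult.assoc)
  next
    case E2
    obtain p1 p1' where 1: "\<And>r. e2 * (e1 ^ a * r) \<doteq> scalar p1 * (e1 ^ a * (e2 * r)) + scalar p1' * (e1 ^ (a - 1) * (e12 * r))"
      using skew_commute_power[OF straighten(1) relations(2)] by blast
    obtain p2 where 2: "\<And>r. e2 * (e12 ^ b * r) \<doteq> scalar p2 * (e12 ^ b * (e2 * r))"
      using commute_power[OF relations(3)] by blast
    obtain p3 where 3: "\<And>r. e2 * (D1 ^ c * r) \<doteq> scalar p3 * (D1 ^ c * (e2 * r))"
      using commute_power[OF relations(6)] by blast
    let ?r = "e2 ^ d * (e23 ^ f * e3 ^ g)"
    have "e1 ^ a * e12 ^ b * (e2 * (D1 ^ c * ?r)) \<in> pbw_span"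
      by (rule pbw_span_step[OF _ 3]) (use pb[of a b c "Suc d" f g] in \<open>simp add: mult.assoc\<close>)
    then have "e1 ^ a * (e2 * (e12 ^ b * (D1 ^ c * ?r))) \<in> pbw_span"
      by (intro pbw_span_step[OF _ 2]) (simp add: mult.assoc)
    then have "1 * (e2 * (e1 ^ a * (e12 ^ b * (D1 ^ c * ?r)))) \<in> pbw_span"
      by (intro pbw_span_step2[OF _ _ 1]) (use pb[of "a - 1" "Suc b" c d f g] in \<open>simp_all add: mult.assoc\<close>)
    then show ?thesis by (simp add: n E2)
  next
    case E3
    obtain p0 where 0: "\<And>r. e3 * (e1 ^ a * r) \<doteq> scalar p0 * (e1 ^ a * (e3 * r))"
      using commute_power[OF relations(1)] by blast
    obtain p1 p1' where 1: "\<And>r. e3 * (e12 ^ b * r) \<doteq> scalar p1 * (e12 ^ b * (e3 * r)) + scalar p1' * (e12 ^ (b - 1) * (D1 * r))"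
      using skew_commute_power[OF straighten(2) relations(7)] by blast
    obtain p2 where 2: "\<And>r. e3 * (D1 ^ c * r) \<doteq> scalar p2 * (D1 ^ c * (e3 * r))"
      using commute_power[OF relations(8)] by blast
    obtain p3 p3' where 3: "\<And>r. e3 * (e2 ^ d * r) \<doteq> scalar p3 * (e2 ^ d * (e3 * r)) + scalar p3' * (e2 ^ (d - 1) * (e23 * r))"
      using skew_commute_power[OF straighten(3) relations(4)] by blast
    obtain p4 where 4: "\<And>r. e3 * (e23 ^ f * r) \<doteq> scalar p4 * (e23 ^ f * (e3 * r))"
      using commute_power[OF relations(5)] by blast
    have "e1 ^ a * e12 ^ b * D1 ^ c * e2 ^ d * (e3 * (e23 ^ f * e3 ^ g)) \<in> pbw_span"
      by (rule pbw_span_step[OF _ 4]) (use pb[of a b c d f "Suc g"] in \<open>simp add: mult.assoc\<close>)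
    then have "e1 ^ a * e12 ^ b * D1 ^ c * (e3 * (e2 ^ d * (e23 ^ f * e3 ^ g))) \<in> pbw_span"
      by (intro pbw_span_step2[OF _ _ 3]) (use pb[of a b c "d - 1" "Suc f" g] in \<open>simp_all add: mult.assoc\<close>)
    then have "e1 ^ a * e12 ^ b * (e3 * (D1 ^ c * (e2 ^ d * (e23 ^ f * e3 ^ g)))) \<in> pbw_span"
      by (intro pbw_span_step[OF _ 2]) (simp add: mult.assoc)
    then have "e1 ^ a * (e3 * (e12 ^ b * (D1 ^ c * (e2 ^ d * (e23 ^ f * e3 ^ g))))) \<in> pbw_span"
      by (intro pbw_span_step2[OF _ _ 1]) (use pb[of a "b - 1" "Suc c" d f g] in \<open>simp_all add: mult.assoc\<close>)
    then have "1 * (e3 * (e1 ^ a * (e12 ^ b * (D1 ^ c * (e2 ^ d * (e23 ^ f * e3 ^ g)))))) \<in> pbw_span"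
      by (intro pbw_span_step[OF _ 0]) simp
    then show ?thesis by (simp add: n E3)
  qed
qed

lemma gen_pbw_span: "x \<in> pbw_span \<Longrightarrow> free_gen i * x \<in> pbw_span"
proof (induction rule: pbw_span.induct)
  case (pbw c n)
  then show ?case by (simp add: scalar_left_commute[of "free_gen i"] pbw_span_scalar gen_pbw)
next
  case (add x y)
  then show ?case by (simp add: distrib_left pbw_span.add)
next
  case (congr x y)
  then show ?case by (meson pbw_span.congr cong_mult cong_refl)
qed

lemma pbw_span_UNIV: "x \<in> pbw_span"
proof (induction x rule: free_alg_induct)
  case (1 w c)
  have "prod_list (map free_gen v) \<in> pbw_span" for v
  proof (induction v)
    case Nil
    show ?case using pbw_in_span[of "(0, 0, 0, 0, 0, 0)"] by simp
  qed (simp add: gen_pbw_span)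
  then show ?case by (cases w) (simp add: single_Word pbw_span_scalar)
qed (rule pbw_span.add)

definition pbw_lin :: "(pbw_index \<Rightarrow>\<^sub>0 'k) \<Rightarrow> 'k free_alg"
  where "pbw_lin c = (\<Sum>n\<in>keys c. scalar (lookup c n) * pbw n)"

lemma ex_pbw_lin: "\<exists>c. x \<doteq> pbw_lin c"
  using pbw_span_UNIV[of x]
proof (induction rule: pbw_span.induct)
  case (pbw c n)
  have "scalar c * pbw n = pbw_lin (single n c)" by (simp add: pbw_lin_def scalar_def)
  then show ?case using cong_refl by metis
next
  case (add x y)
  then obtain c d where "x \<doteq> pbw_lin c" "y \<doteq> pbw_lin d" by blast
  moreover have "pbw_lin (c + d) = pbw_lin c + pbw_lin d"
    unfolding pbw_lin_def
    by (rule setsum_keys_plus_distrib) (simp_all add: scalar_def distrib_right single_add)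
  ultimately show ?case using cong_add by metis
next
  case (congr x y)
  then show ?case using cong_trans by blast
qed

end

section \<open>Leading exponents of the ordered monomials\<close>

sublocale qparam \<subseteq> ord_id: qparam_order q "\<lambda>a. a"
  by unfold_locales simp_all

context qparam
begin

abbreviation "lead_id \<equiv> lead (\<lambda>a. a)"

lemma sc_1_nonzero [simp]: "sc 1 \<noteq> 0"
  by (metis sc_def single_zero lookup_single_eq lookup_zero zero_neq_one)

lemma \<pi>_power:
  assumes "\<pi> x \<noteq> 0" "lead_id (\<pi> x) = ((g, a, b, d), (r, s))"
  shows "\<pi> (x ^ n) \<noteq> 0 \<and> lead_id (\<pi> (x ^ n)) =
    ((int n * g, int n * a, int n * b, int n * d), (int n * r, int n * s))"
proof (induction n)
  case 0
  have "lead_id (sc 1) = 0" unfolding sc_def by (rule ord_id.lead_single) simp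
  moreover have "\<pi> (x ^ 0) = sc 1" by (simp only: power_0 \<pi>_simps(5))
  moreover have "(0 :: expo) = ((0, 0, 0, 0), (0, 0))" by (simp only: zero_prod_def)
  ultimately show ?case by (simp only: of_nat_0 mult_zero_left) simp
next
  case (Suc n)
  then show ?case
    using ord_id.lead_star[OF assms(1), of "\<pi> (x ^ n)"] assms(2) by (simp add: \<pi>_simps algebra_simps)
qed

lemma lead_id_eqI:
  assumes "a \<in> keys f" "\<And>b. b \<in> keys f \<Longrightarrow> b \<le> a"
  shows "f \<noteq> 0 \<and> lead_id f = a"
proof -
  have "Max (keys f) = a" by (rule Max_eqI[OF finite_keys assms(2,1)])
  moreover have "f \<noteq> 0" using assms(1) by (metis keys_zero empty_iff)
  ultimately show ?thesis by (simp only: lead_def image_ident simp_thms)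
qed

lemma lead_\<pi>_gens:
  "\<pi> e1 \<noteq> 0 \<and> lead_id (\<pi> e1) = ((0, 1, 0, 0), (0, 0))"
  "\<pi> e12 \<noteq> 0 \<and> lead_id (\<pi> e12) = ((0, 0, 1, 0), (0, 0))"
  "\<pi> D1 \<noteq> 0 \<and> lead_id (\<pi> D1) = ((-3, 0, 0, 1), (0, 0))"
  "\<pi> e2 \<noteq> 0 \<and> lead_id (\<pi> e2) = ((1, -1, 0, 0), (0, 0))"
  "\<pi> e23 \<noteq> 0 \<and> lead_id (\<pi> e23) = ((0, 0, -1, 0), (0, 1))"
  "\<pi> e3 \<noteq> 0 \<and> lead_id (\<pi> e3) = ((2, 0, 0, -1), (1, 0))"
  unfolding \<pi>_gens \<pi>_cluster
  by (rule lead_id_eqI; auto simp: in_keys_iff lookup_add lookup_single when_def simp del: split_paired_All split: if_splits)+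

text \<open>The index can be read off from this exponent: the second component gives
  \<open>g\<close> and \<open>f\<close>, then \<open>c\<close> and \<open>b\<close> follow, then
  \<open>d\<close>, and finally \<open>a\<close>.\<close>

lemma lead_pbw:
  "\<pi> (pbw (a, b, c, d, f, g)) \<noteq> 0 \<and> lead_id (\<pi> (pbw (a, b, c, d, f, g))) =
    ((int d + 2 * int g - 3 * int c, int a - int d, int b - int f, int c - int g), (int g, int f))"
proof -
  note p = lead_\<pi>_gens[THEN conjunct1] and l = lead_\<pi>_gens[THEN conjunct2]
  note P = \<pi>_power[OF p(1) l(1), of a] \<pi>_power[OF p(2) l(2), of b] \<pi>_power[OF p(3) l(3), of c]
    \<pi>_power[OF p(4) l(4), of d] \<pi>_power[OF p(5) l(5), of f] \<pi>_power[OF p(6) l(6), of g]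
  show ?thesis using P by (simp add: \<pi>_simps(3) ord_id.lead_star)
qed

text \<open>Modulo the ideal, \<open>x\<close> is a combination of ordered monomials, whose images
  have pairwise distinct leading exponents; a combination with image 0 is therefore trivial. This
  gives the PBW theorem and injectivity at once.\<close>

lemma \<pi>_eq_0_iff: "\<pi> x = 0 \<longleftrightarrow> x \<in> serre_ideal q"
proof
  assume 0: "\<pi> x = 0"
  obtain c where c: "x \<doteq> pbw_lin c" using ex_pbw_lin by blast
  have "x - pbw_lin c \<in> serre_ideal q" using c by (simp add: cong_iff)
  then have "\<pi> (x - pbw_lin c) = 0" by (rule \<pi>_vanishes)
  then have "\<pi> (pbw_lin c) = 0" using 0 by (simp add: \<pi>_simps)
  then have sum: "(\<Sum>n\<in>keys c. sc (lookup c n) \<star> \<pi> (pbw n)) = 0"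
    by (simp add: pbw_lin_def \<pi>_def tev_sum tev_simps)
  have "keys c = {}"
  proof (rule ccontr)
    assume "keys c \<noteq> {}"
    then obtain m where m: "m \<in> keys c" by blast
    have nz: "sc (lookup c n) \<star> \<pi> (pbw n) \<noteq> 0" and ld: "lead_id (sc (lookup c n) \<star> \<pi> (pbw n)) = lead_id (\<pi> (pbw n))"
      if "n \<in> keys c" for n
    proof -
      have k: "keys (sc (lookup c n) \<star> \<pi> (pbw n)) = keys (\<pi> (pbw n))"
        using that by (auto simp: keys_sc_star in_keys_iff simp del: split_paired_All)
      have "\<pi> (pbw n) \<noteq> 0" using lead_pbw by (cases n) auto
      then show "sc (lookup c n) \<star> \<pi> (pbw n) \<noteq> 0" using k by (metis keys_eq_empty)
      show "lead_id (sc (lookup c n) \<star> \<pi> (pbw n)) = lead_id (\<pi> (pbw n))" by (simp add: lead_def k)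
    qed
    have "inj_on (\<lambda>n. lead_id (sc (lookup c n) \<star> \<pi> (pbw n))) (keys c)"
    proof (rule inj_onI)
      fix n n' assume "n \<in> keys c" "n' \<in> keys c"
        "lead_id (sc (lookup c n) \<star> \<pi> (pbw n)) = lead_id (sc (lookup c n') \<star> \<pi> (pbw n'))"
      then have eq: "lead_id (\<pi> (pbw n)) = lead_id (\<pi> (pbw n'))" by (simp add: ld)
      obtain a b c d f g a' b' c' d' f' g' where "n = (a, b, c, d, f, g)" "n' = (a', b', c', d', f', g')"
        by (metis prod.exhaust)
      then show "n = n'" using eq by (simp add: lead_pbw del: pbw.simps)
    qed
    from ord_id.lead_sum_ge(1)[OF _ nz this m] sum show False by simp
  qed
  then have "pbw_lin c = 0" by (simp add: pbw_lin_def)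
  then show "x \<in> serre_ideal q" using c by (simp add: cong_iff)
qed (rule \<pi>_vanishes)

lemma cong_iff_\<pi>: "x \<doteq> y \<longleftrightarrow> \<pi> x = \<pi> y"
  using \<pi>_eq_0_iff[of "x - y"] by (simp add: cong_iff \<pi>_simps)

end


section \<open>Rigidity of unipotent automorphisms\<close>

text \<open>The exponents of the monomials in the cluster, without denominators.\<close>

fun cone :: "expo \<Rightarrow> bool"
  where "cone ((g, x, y, d), (r, s)) \<longleftrightarrow>
    0 \<le> x \<and> 0 \<le> y \<and> 0 \<le> g + 3 * d \<and> 0 \<le> d + r \<and> 0 \<le> r \<and> 0 \<le> s"

lemma cone_add: "cone a \<Longrightarrow> cone b \<Longrightarrow> cone (a + b)"
proof -
  obtain g x y d r s g' x' y' d' r' s' where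
    "a = ((g, x, y, d), (r, s))" "b = ((g', x', y', d'), (r', s'))"
    by (metis prod.exhaust)
  then show "cone a \<Longrightarrow> cone b \<Longrightarrow> cone (a + b)" by simp
qed

lemma bil_cong: "fst a = fst a' \<Longrightarrow> fst b = fst b' \<Longrightarrow> bil a b = bil a' b'"
  by (metis bil.simps prod.exhaust prod.sel(1))

lemma skew_cong: "fst a = fst a' \<Longrightarrow> fst b = fst b' \<Longrightarrow> skew a b = skew a' b'"
  unfolding skew_def by (metis bil_cong)

text \<open>Testing against the exponents of \<open>e1\<close>, \<open>e12\<close>,
  \<open>e12'\<close> and \<open>D1\<close> already determines the first component.\<close>

lemma skew_nondegenerate:
  assumes "\<And>b. cone b \<Longrightarrow> skew a b = 0"
  shows "fst a = 0"
proof -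
  obtain g x y d m where a: "a = ((g, x, y, d), m)" by (metis prod.exhaust)
  show ?thesis
    using assms[of "((0, 1, 0, 0), (0, 0))"] assms[of "((0, 0, 1, 0), (0, 0))"]
      assms[of "((1, 0, 0, 0), (0, 0))"] assms[of "((-3, 0, 0, 1), (0, 0))"]
    by (simp add: a skew_def zero_prod_def)
qed

text \<open>Up to scalars, the first shift multiplies by the N-th powers of all six cluster
  elements, the second by those of \<open>D1\<close>, \<open>D3\<close> and \<open>D2\<close> alone.
  The latter is a central factor and suffices for exponents of class 0.\<close>

lemma ex_cone_shift:
  assumes "finite B"
  shows "\<exists>N \<ge> 0. \<forall>b\<in>B. cone (b + ((N, N, N, 0), (N, N)))"
    and "(\<And>b. b \<in> B \<Longrightarrow> fst b = 0) \<Longrightarrow> \<exists>N \<ge> 0. \<forall>b\<in>B. cone (b + ((0, 0, 0, 0), (N, N)))"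
proof -
  let ?n = "\<lambda>((g, x, y, d), (r, s)). \<bar>g\<bar> + \<bar>x\<bar> + \<bar>y\<bar> + 4 * \<bar>d\<bar> + \<bar>r\<bar> + \<bar>s\<bar>"
  define N where "N = Max (insert 0 (?n ` B))"
  have N: "?n b \<le> N" "0 \<le> N" if "b \<in> B" for b
    using assms that by (auto simp: N_def simp del: split_paired_All)
  have N0: "0 \<le> N" using assms by (simp add: N_def)
  have "cone (b + ((N, N, N, 0), (N, N)))" if "b \<in> B" for b
  proof -
    obtain g x y d r s where b: "b = ((g, x, y, d), (r, s))" by (metis prod.exhaust)
    show ?thesis using N(1)[OF that] unfolding b by simp linarith
  qed
  then show "\<exists>N \<ge> 0. \<forall>b\<in>B. cone (b + ((N, N, N, 0), (N, N)))" using N0 by blast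
  assume 0: "\<And>b. b \<in> B \<Longrightarrow> fst b = 0"
  have "cone (b + ((0, 0, 0, 0), (N, N)))" if "b \<in> B" for b
  proof -
    obtain g x y d r s where b: "b = ((g, x, y, d), (r, s))" by (metis prod.exhaust)
    show ?thesis using N(1)[OF that] 0[OF that] unfolding b by (simp add: zero_prod_def) linarith
  qed
  then show "\<exists>N \<ge> 0. \<forall>b\<in>B. cone (b + ((0, 0, 0, 0), (N, N)))" using N0 by blast
qed

lemma fst_mono_lex: "a \<le> b \<Longrightarrow> fst a \<le> fst b"
  for a b :: "'a :: order \<times> 'b :: ord"
  by (auto simp: less_eq_prod_def)

context qparam
begin

lemma single_nonzero: "single b (1 :: 'k) \<noteq> 0"
  by (metis lookup_single_eq lookup_zero zero_neq_one)

text \<open>By the PBW theorem this subalgebra of the quantum torus is isomorphic to \<open>Uq q\<close>.\<close>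

definition A :: "'k qtorus set"
  where "A = range \<pi>"

lemma algebra_closed:
  "s \<in> A \<Longrightarrow> t \<in> A \<Longrightarrow> s + t \<in> A" "s \<in> A \<Longrightarrow> t \<in> A \<Longrightarrow> s - t \<in> A"
  "s \<in> A \<Longrightarrow> t \<in> A \<Longrightarrow> s \<star> t \<in> A" "sc c \<in> A" "0 \<in> A"
  unfolding A_def by (auto simp flip: \<pi>_simps intro: rangeI) (metis \<pi>_eq_0_iff cong_iff cong_refl rangeI)

lemma A_sum: "(\<And>i. i \<in> I \<Longrightarrow> f i \<in> A) \<Longrightarrow> (\<Sum>i\<in>I. f i) \<in> A"
  by (induction I rule: infinite_finite_induct) (simp_all add: algebra_closed)

lemma \<pi>_single_power:
  assumes "\<pi> m = single ((g, x, y, d), (r, s)) c" "c \<noteq> 0"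
  shows "\<exists>c'. c' \<noteq> 0 \<and> \<pi> (m ^ n) =
    single ((int n * g, int n * x, int n * y, int n * d), (int n * r, int n * s)) c'"
proof (induction n)
  case 0
  have "(0 :: expo) = ((0, 0, 0, 0), (0, 0))" by (simp only: zero_prod_def)
  then show ?case by (intro exI[of _ 1]) (simp add: \<pi>_simps sc_def)
next
  case (Suc n)
  then obtain c' where c': "c' \<noteq> 0" "\<pi> (m ^ n) =
    single ((int n * g, int n * x, int n * y, int n * d), (int n * r, int n * s)) c'" by blast
  have "\<pi> (m ^ Suc n) = \<pi> m \<star> \<pi> (m ^ n)" by (simp add: \<pi>_simps)
  also have "\<dots> = single ((int (Suc n) * g, int (Suc n) * x, int (Suc n) * y, int (Suc n) * d), (int (Suc n) * r, int (Suc n) * s))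
      (q powi bil ((g, x, y, d), (r, s)) ((int n * g, int n * x, int n * y, int n * d), (int n * r, int n * s)) * (c * c'))"
    unfolding assms(1) c'(2) star_single by (simp add: algebra_simps)
  finally show ?case using assms(2) c'(1) by (metis mult_eq_0_iff power_int_eq_0_iff q_nonzero)
qed

text \<open>All cluster elements map to monomials, so an ordered product of their powers realises
  the exponent up to a nonzero scalar.\<close>

lemma cone_in_A:
  assumes "cone a"
  shows "single a c \<in> A"
proof -
  obtain g x y d r s where a: "a = ((g, x, y, d), (r, s))" by (metis prod.exhaust)
  have nz: "- (\<kappa> / q) \<noteq> 0" "\<kappa>\<^sup>2 / q \<noteq> 0" "\<kappa>\<^sup>2 \<noteq> 0" "(1 :: 'k) \<noteq> 0" by simp_all
  note P = \<pi>_single_power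
  obtain c1 where 1: "c1 \<noteq> 0" "\<pi> (e1 ^ nat x) = single ((0, x, 0, 0), (0, 0)) c1"
    using P[OF \<pi>_gens(1), of "nat x"] assms by (auto simp: a)
  obtain c2 where 2: "c2 \<noteq> 0" "\<pi> (e12 ^ nat y) = single ((0, 0, y, 0), (0, 0)) c2"
    using P[OF \<pi>_cluster(1), of "nat y"] assms by (auto simp: a)
  obtain c3 where 3: "c3 \<noteq> 0" "\<pi> (e12' ^ nat (g + 3 * d)) = single ((g + 3 * d, 0, 0, 0), (0, 0)) c3"
    using P[OF \<pi>_cluster(2) nz(1), of "nat (g + 3 * d)"] assms by (auto simp: a)
  obtain c4 where 4: "c4 \<noteq> 0" "\<pi> (D1 ^ nat (d + r)) = single ((- 3 * (d + r), 0, 0, d + r), (0, 0)) c4"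
    using P[OF \<pi>_cluster(4) nz(3), of "nat (d + r)"] assms by (auto simp: a mult.commute)
  obtain c5 where 5: "c5 \<noteq> 0" "\<pi> (D3 ^ nat r) = single ((3 * r, 0, 0, - r), (r, 0)) c5"
    using P[OF \<pi>_cluster(5) nz(2), of "nat r"] assms by (auto simp: a mult.commute)
  obtain c6 where 6: "c6 \<noteq> 0" "\<pi> (D2 ^ nat s) = single ((0, 0, 0, 0), (0, s)) c6"
    using P[OF \<pi>_cluster(6) nz(2), of "nat s"] assms by (auto simp: a)
  define m where "m = e1 ^ nat x * (e12 ^ nat y * (e12' ^ nat (g + 3 * d) * (D1 ^ nat (d + r) * (D3 ^ nat r * D2 ^ nat s))))"
  have "\<exists>c'. c' \<noteq> 0 \<and> \<pi> m = single a c'"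
    using 1(1) 2(1) 3(1) 4(1) 5(1) 6(1)
    by (simp add: m_def \<pi>_simps(3) 1(2) 2(2) 3(2) 4(2) 5(2) 6(2) star_single a)
      (metis mult_eq_0_iff power_int_eq_0_iff q_nonzero)
  then obtain c' where c': "c' \<noteq> 0" "\<pi> m = single a c'" by blast
  then have "\<pi> (scalar (c / c') * m) = single a c" by (simp add: \<pi>_simps sc_simps)
  then show ?thesis unfolding A_def by (metis rangeI)
qed

lemma keys_cone_in_A:
  assumes "\<And>a. a \<in> keys t \<Longrightarrow> cone a"
  shows "t \<in> A"
proof -
  have "(\<Sum>a\<in>keys t. single a (lookup t a)) \<in> A"
    by (intro A_sum cone_in_A assms)
  then show ?thesis by (simp only: sum_single_lookup)
qed

lemma A_frozen: "t \<in> A \<Longrightarrow> a \<in> keys t \<Longrightarrow> frozen_nonneg a"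
  unfolding A_def using \<pi>_keys(2) by blast

text \<open>The skew form sees only the class, i.e. the first component, so all terms of
  \<open>t\<close> produce the same commutation factor.\<close>

lemma star_single_class:
  assumes "\<And>a. a \<in> keys t \<Longrightarrow> fst a = fst a0"
  shows "t \<star> single b c = sc (q powi skew a0 b) \<star> (single b c \<star> t)"
proof (rule poly_mapping_eqI)
  fix k
  define a where "a = k - b"
  have k: "k = a + b" by (simp add: a_def)
  show "lookup (t \<star> single b c) k = lookup (sc (q powi skew a0 b) \<star> (single b c \<star> t)) k"
  proof (cases "a \<in> keys t")
    case True
    have "skew a0 b = skew a b" using assms[OF True] by (intro skew_cong) simp_all
    then show ?thesis
      by (simp only: k lookup_star_single lookup_sc_star) (simp add: skew_def power_int_diff)
  next
    case False
    then show ?thesis by (simp only: k lookup_star_single lookup_sc_star) (simp add: in_keys_iff)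
  qed
qed

lemma central_commute:
  assumes "\<And>a. a \<in> keys t \<Longrightarrow> fst a = 0"
  shows "t \<star> s = s \<star> t"
proof (induction s rule: poly_mapping_add_induct)
  case (1 b c)
  have "t \<star> single b c = sc (q powi skew 0 b) \<star> (single b c \<star> t)"
    by (rule star_single_class) (simp add: assms)
  then show ?case by (simp add: skew_simps sc_simps)
qed (simp add: star_add_left star_add_right)

lemma single_cancel:
  "single a 1 \<star> t = single a 1 \<star> t' \<Longrightarrow> t = t'" "t \<star> single a 1 = t' \<star> single a 1 \<Longrightarrow> t = t'"
proof -
  show "t = t'" if "single a 1 \<star> t = single a 1 \<star> t'"
  proof (rule poly_mapping_eqI)
    fix k
    show "lookup t k = lookup t' k"
      using arg_cong[OF that, of "\<lambda>f. lookup f (k + a)"] by (simp add: lookup_star_single)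
  qed
  show "t = t'" if "t \<star> single a 1 = t' \<star> single a 1"
  proof (rule poly_mapping_eqI)
    fix k
    show "lookup t k = lookup t' k"
      using arg_cong[OF that, of "\<lambda>f. lookup f (k + a)"] by (simp add: lookup_star_single)
  qed
qed

lemma sc_cancel: "c \<noteq> 0 \<Longrightarrow> sc c \<star> s = sc c \<star> t \<Longrightarrow> s = t"
proof (rule poly_mapping_eqI)
  fix k assume "c \<noteq> 0" "sc c \<star> s = sc c \<star> t"
  from this(1) arg_cong[OF this(2), of "\<lambda>f. lookup f k"] show "lookup s k = lookup t k"
    by simp
qed

lemma ex_single_quotient:
  obtains t' where "single a 1 \<star> t' = t" "\<And>k. k \<in> keys t' \<Longrightarrow> \<exists>b\<in>keys t. k = b - a"
proof
  \<comment> \<open>The scalar compensates the twist of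
    \<open>single a 1 \<star> single (- a) 1\<close>, which is q to the power
    \<open>- bil a a\<close>.\<close>
  let ?t = "sc (q powi bil a a) \<star> (single (- a) 1 \<star> t)"
  have "single a 1 \<star> ?t = sc (q powi bil a a) \<star> ((single a 1 \<star> single (- a) 1) \<star> t)"
    by (simp only: sc_star_left_commute[of "single a 1"] star_assoc)
  also have "single a 1 \<star> single (- a) 1 = sc (inverse (q powi bil a a))"
    by (simp add: star_single sc_def bil_uminus power_int_minus)
  finally show "single a 1 \<star> ?t = t" by (simp add: sc_simps flip: star_assoc)
  fix k assume "k \<in> keys ?t"
  then have "k \<in> keys (single (- a) 1 \<star> t)" by (simp add: keys_sc_star)
  then show "\<exists>b\<in>keys t. k = b - a" by (elim keys_starE) (auto simp del: split_paired_Ex split_paired_All split: if_splits)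
qed

end

section \<open>Leading classes under unipotent automorphisms\<close>

text \<open>All conditions are confined to \<open>A\<close>. The inverse is a second parameter,
  which makes the hypotheses symmetric, so that each result holds for \<open>\<Psi>\<close>
  too.\<close>

locale unipotent_pair = qparam q for q :: "'k :: field_char_0" +
  fixes \<Phi> \<Psi> :: "'k qtorus \<Rightarrow> 'k qtorus"
  assumes \<Phi>_A: "t \<in> A \<Longrightarrow> \<Phi> t \<in> A" and \<Psi>_A: "t \<in> A \<Longrightarrow> \<Psi> t \<in> A"
    and \<Phi>_add: "s \<in> A \<Longrightarrow> t \<in> A \<Longrightarrow> \<Phi> (s + t) = \<Phi> s + \<Phi> t"
    and \<Psi>_add: "s \<in> A \<Longrightarrow> t \<in> A \<Longrightarrow> \<Psi> (s + t) = \<Psi> s + \<Psi> t"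
    and \<Phi>_star: "s \<in> A \<Longrightarrow> t \<in> A \<Longrightarrow> \<Phi> (s \<star> t) = \<Phi> s \<star> \<Phi> t"
    and \<Psi>_star: "s \<in> A \<Longrightarrow> t \<in> A \<Longrightarrow> \<Psi> (s \<star> t) = \<Psi> s \<star> \<Psi> t"
    and \<Phi>_sc: "\<Phi> (sc c) = sc c" and \<Psi>_sc: "\<Psi> (sc c) = sc c"
    and \<Phi>_\<Psi>: "t \<in> A \<Longrightarrow> \<Phi> (\<Psi> t) = t" and \<Psi>_\<Phi>: "t \<in> A \<Longrightarrow> \<Psi> (\<Phi> t) = t"
    and \<Phi>_unipotent: "t \<in> A \<Longrightarrow> (\<And>a. a \<in> keys t \<Longrightarrow> n \<le> tdeg a) \<Longrightarrow> a \<in> keys (\<Phi> t - t) \<Longrightarrow> n < tdeg a"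
    and \<Psi>_unipotent: "t \<in> A \<Longrightarrow> (\<And>a. a \<in> keys t \<Longrightarrow> n \<le> tdeg a) \<Longrightarrow> a \<in> keys (\<Psi> t - t) \<Longrightarrow> n < tdeg a"
begin

lemma swap: "unipotent_pair q \<Psi> \<Phi>"
  by unfold_locales (rule \<Phi>_A \<Psi>_A \<Phi>_add \<Psi>_add \<Phi>_star \<Psi>_star \<Phi>_sc \<Psi>_sc \<Phi>_\<Psi> \<Psi>_\<Phi> \<Phi>_unipotent \<Psi>_unipotent; assumption)+

lemma \<Phi>_0 [simp]: "\<Phi> 0 = 0"
  using \<Phi>_sc[of 0] by (simp add: sc_simps)

lemma \<Psi>_0 [simp]: "\<Psi> 0 = 0"
  using \<Psi>_sc[of 0] by (simp add: sc_simps)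

lemma \<Phi>_sum: "(\<And>i. i \<in> I \<Longrightarrow> f i \<in> A) \<Longrightarrow> \<Phi> (\<Sum>i\<in>I. f i) = (\<Sum>i\<in>I. \<Phi> (f i))"
  by (induction I rule: infinite_finite_induct) (simp_all add: \<Phi>_add A_sum)

lemma \<Phi>_nonzero: "t \<in> A \<Longrightarrow> t \<noteq> 0 \<Longrightarrow> \<Phi> t \<noteq> 0"
  using \<Psi>_\<Phi> by force

text \<open>The correction to a monomial has strictly higher degree than the monomial, so it cannot
  touch this coefficient.\<close>

lemma lookup_unipotent:
  assumes "cone a"
  shows "lookup (\<Phi> (single a 1)) a = 1" "lookup (\<Psi> (single a 1)) a = 1"
proof -
  have "a \<notin> keys (\<Phi> (single a 1) - single a 1)"
    using \<Phi>_unipotent[OF cone_in_A[OF assms], of 1 "tdeg a" a] by auto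
  then show "lookup (\<Phi> (single a 1)) a = 1" by (simp add: in_keys_iff lookup_minus)
  have "a \<notin> keys (\<Psi> (single a 1) - single a 1)"
    using \<Psi>_unipotent[OF cone_in_A[OF assms], of 1 "tdeg a" a] by auto
  then show "lookup (\<Psi> (single a 1)) a = 1" by (simp add: in_keys_iff lookup_minus)
qed

text \<open>A central \<open>z\<close> commutes with \<open>\<Psi>\<close> of every cluster
  monomial; applying \<open>\<Phi>\<close>, its image commutes with the monomials themselves, and
  the skew form is nondegenerate on classes.\<close>

lemma \<Phi>_central:
  assumes "z \<in> A" "\<And>a. a \<in> keys z \<Longrightarrow> fst a = 0" "a \<in> keys (\<Phi> z)"
  shows "fst a = 0"
proof (rule skew_nondegenerate)
  fix b assume b: "cone b"
  let ?s = "single b 1 :: 'k qtorus"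
  have s: "?s \<in> A" using cone_in_A[OF b] .
  have "\<Phi> z \<star> \<Phi> (\<Psi> ?s) = \<Phi> (\<Psi> ?s) \<star> \<Phi> z"
    using central_commute[OF assms(2), of z "\<Psi> ?s"] \<Phi>_star[OF assms(1) \<Psi>_A[OF s]]
      \<Phi>_star[OF \<Psi>_A[OF s] assms(1)] by simp
  then have "\<Phi> z \<star> ?s = sc (q powi 0) \<star> (?s \<star> \<Phi> z)"
    by (simp add: \<Phi>_\<Psi>[OF s] sc_simps)
  then show "skew a b = 0" using assms(3) by (rule commute_single)
qed

end

locale unipotent_pair_order = unipotent_pair q \<Phi> \<Psi> + qparam_order q \<theta>
  for q :: "'k :: field_char_0" and \<Phi> \<Psi> \<theta>
begin

text \<open>An element of a single class q-commutes with every monomial, \<open>\<Phi>\<close>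
  preserves the relation, and \<open>lead_commutation\<close> passes to leading exponents. Thus the
  leading exponent of the image remembers the class.\<close>

lemma \<Phi>_class_lead:
  assumes "t \<in> A" "t \<noteq> 0" "\<And>a. a \<in> keys t \<Longrightarrow> fst a = fst a0" "cone b"
  shows "skew (\<theta> (lead \<theta> (\<Phi> t))) (\<theta> (lead \<theta> (\<Phi> (single b 1)))) = skew a0 b"
proof (rule lead_commutation)
  have b: "single b 1 \<in> A" "single b 1 \<noteq> (0 :: 'k qtorus)"
    by (rule cone_in_A[OF assms(4)], rule single_nonzero)
  show "\<Phi> t \<noteq> 0" "\<Phi> (single b 1) \<noteq> 0" by (rule \<Phi>_nonzero[OF assms(1,2)], rule \<Phi>_nonzero[OF b])
  have "\<Phi> (t \<star> single b 1) = \<Phi> (sc (q powi skew a0 b) \<star> (single b 1 \<star> t))"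
    by (simp only: star_single_class[OF assms(3)])
  then show "\<Phi> t \<star> \<Phi> (single b 1) = sc (q powi skew a0 b) \<star> (\<Phi> (single b 1) \<star> \<Phi> t)"
    using assms(1) b by (simp add: \<Phi>_star \<Phi>_sc algebra_closed)
qed

text \<open>With \<open>t = \<Psi> (single a 1) \<star> s\<close>, the image of \<open>t\<close> is
  \<open>single a 1 \<star> \<Phi> s\<close>, whose leading exponent bounds that of the image of
  each group of \<open>t\<close>. For the group of \<open>a + n\<close> the leading class is that of
  \<open>\<Phi> (single a 1)\<close> plus that of \<open>\<Phi> s\<close>, and the latter
  cancels.\<close>

lemma fst_lead_\<Phi>_le:
  assumes fst_\<theta>: "\<And>a. fst a = 0 \<Longrightarrow> fst (\<theta> a) = 0" and a: "cone a"
  shows "fst (lead \<theta> (\<Phi> (single a 1))) \<le> fst (\<theta> a)"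
proof -
  note in_A = cone_in_A[of _ 1]
  define f where "f = \<Psi> (single a 1)"
  \<comment> \<open>Unipotence of \<open>\<Psi>\<close> puts \<open>a\<close> among the exponents of
    \<open>f\<close>, so the group used below is not empty.\<close>
  have f: "f \<in> A" "\<Phi> f = single a 1" "a \<in> keys f"
    using in_A[OF a] lookup_unipotent(2)[OF a] by (simp_all add: f_def \<Psi>_A \<Phi>_\<Psi> in_keys_iff)
  \<comment> \<open>Clearing the denominators of all exponents of \<open>f\<close> places every
    group of the product in \<open>A\<close>, where \<open>\<Phi>\<close> may be applied.\<close>
  obtain N where N: "N \<ge> 0" "\<And>b. b \<in> keys f \<Longrightarrow> cone (b + ((N, N, N, 0), (N, N)))"
    using ex_cone_shift(1)[OF finite_keys] by blast
  define n :: expo where "n = ((N, N, N, 0), (N, N))"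
  have n: "cone n" using N(1) by (simp add: n_def)
  define s where "s = single n (1 :: 'k)"
  have s: "s \<in> A" "\<Phi> s \<noteq> 0" using in_A[OF n] \<Phi>_nonzero[OF in_A[OF n] single_nonzero] by (simp_all add: s_def)
  define t where "t = f \<star> s"
  have t: "t \<in> A" using f s by (simp add: t_def algebra_closed)
  have t_cone: "cone b" if "b \<in> keys t" for b
    using that N(2) unfolding t_def s_def by (elim keys_starE) (simp add: n_def)
  have a0: "a + n \<in> keys t"
    using f(3) by (simp add: in_keys_iff t_def s_def lookup_star_single)
  have \<Phi>_t: "\<Phi> t = single a 1 \<star> \<Phi> s" using f s by (simp add: t_def \<Phi>_star)
  have lead_t: "lead \<theta> (\<Phi> t) = \<theta> a + lead \<theta> (\<Phi> s)"
    unfolding \<Phi>_t using lead_star(1)[OF single_nonzero s(2)] by (simp add: lead_single)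
  define part where "part c = (\<Sum>b\<in>{b \<in> keys t. fst b = c}. single b (lookup t b))" for c
  have lookup_part: "lookup (part c) b = (if fst b = c then lookup t b else 0)" for b c
  proof -
    have "lookup (part c) b = (\<Sum>b'\<in>{b \<in> keys t. fst b = c}. if b' = b then lookup t b' else 0)"
      by (simp add: part_def lookup_sum lookup_single when_def)
    also have "\<dots> = (if fst b = c then lookup t b else 0)"
      by (simp add: in_keys_iff)
    finally show ?thesis .
  qed
  have part: "part c \<in> A" "b \<in> keys (part c) \<Longrightarrow> fst b = c" "b \<in> keys (part c) \<Longrightarrow> cone b" for b c
  proof -
    show 1: "b \<in> keys (part c) \<Longrightarrow> fst b = c" for b
      by (simp add: in_keys_iff lookup_part split: if_splits)
    show 2: "b \<in> keys (part c) \<Longrightarrow> cone b" for b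
      by (rule t_cone) (simp add: in_keys_iff lookup_part split: if_splits)
    show "part c \<in> A" by (rule keys_cone_in_A) (rule 2)
  qed
  have part_nz: "part c \<noteq> 0" if "c \<in> fst ` keys t" for c
  proof -
    obtain b where "b \<in> keys t" "fst b = c" using \<open>c \<in> fst ` keys t\<close> by blast
    then have "lookup (part c) b \<noteq> 0" by (simp add: lookup_part in_keys_iff)
    then show ?thesis by (metis lookup_zero)
  qed
  have sum: "(\<Sum>c\<in>fst ` keys t. part c) = t"
  proof -
    have "(\<Sum>c\<in>fst ` keys t. part c) = (\<Sum>b\<in>keys t. single b (lookup t b))"
      unfolding part_def by (rule sum.image_gen[symmetric]) simp
    then show ?thesis by (simp only: sum_single_lookup)
  qed
  txt \<open>The class of an element is determined by how its image commutes with the images of the cluster.\<close>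
  have inj: "inj_on (\<lambda>c. lead \<theta> (\<Phi> (part c))) (fst ` keys t)"
  proof (rule inj_onI)
    fix c c' assume c: "c \<in> fst ` keys t" "c' \<in> fst ` keys t"
      and eq: "lead \<theta> (\<Phi> (part c)) = lead \<theta> (\<Phi> (part c'))"
    have "skew ((c, (0, 0)) - (c', (0, 0))) b = 0" if "cone b" for b
    proof -
      have "skew (c, (0, 0)) b = skew (c', (0, 0)) b"
        using \<Phi>_class_lead[OF part(1) part_nz[OF c(1)], of "(c, (0, 0))" b]
          \<Phi>_class_lead[OF part(1) part_nz[OF c(2)], of "(c', (0, 0))" b] part(2) that eq by simp
      then show ?thesis by (simp only: diff_conv_add_uminus skew_simps)
    qed
    from skew_nondegenerate[OF this] show "c = c'" by (simp only: fst_diff fst_conv) simp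
  qed
  let ?c = "fst (a + n)"
  have c: "?c \<in> fst ` keys t" using a0 by blast
  have "lead \<theta> (\<Phi> (part ?c)) \<le> lead \<theta> (\<Sum>c\<in>fst ` keys t. \<Phi> (part c))"
    by (rule lead_sum_ge(2)[OF _ _ inj c]) (rule finite_imageI[OF finite_keys], rule \<Phi>_nonzero[OF part(1) part_nz])
  also have "(\<Sum>c\<in>fst ` keys t. \<Phi> (part c)) = \<Phi> t"
    using \<Phi>_sum[of "fst ` keys t" part] part(1) by (simp only: sum)
  finally have le: "lead \<theta> (\<Phi> (part ?c)) \<le> \<theta> a + lead \<theta> (\<Phi> s)" by (simp only: lead_t)

  txt \<open>\<open>part ?c\<close> is the monomial \<open>a + n\<close> times a central Laurent polynomial, and \<open>\<Phi>\<close> preserves the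
    centre, so both have images with the same leading class.\<close>
  obtain \<zeta>' where \<zeta>': "single (a + n) 1 \<star> \<zeta>' = part ?c" "\<And>k. k \<in> keys \<zeta>' \<Longrightarrow> \<exists>b\<in>keys (part ?c). k = b - (a + n)"
    using ex_single_quotient by blast
  have \<zeta>'_fst: "fst k = 0" if k: "k \<in> keys \<zeta>'" for k
  proof -
    obtain b where "b \<in> keys (part ?c)" "k = b - (a + n)" using \<zeta>'(2)[OF k] by blast
    then show ?thesis using part(2)[of b ?c] by (simp only: fst_diff) simp
  qed
  \<comment> \<open>The quotient is only a central Laurent polynomial and may lie outside
    \<open>A\<close>; a central monomial brings it back without changing classes.\<close>
  obtain M where M: "M \<ge> 0" "\<And>b. b \<in> keys \<zeta>' \<Longrightarrow> cone (b + ((0, 0, 0, 0), (M, M)))"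
  proof -
    have "\<exists>M \<ge> 0. \<forall>b\<in>keys \<zeta>'. cone (b + ((0, 0, 0, 0), (M, M)))"
      by (rule ex_cone_shift(2)[OF finite_keys \<zeta>'_fst])
    then show ?thesis using that by (elim exE conjE) (rule that, assumption, erule bspec)
  qed
  define m :: expo where "m = ((0, 0, 0, 0), (M, M))"
  have m: "cone m" "fst m = 0" using M(1) by (simp_all add: m_def zero_prod_def)
  define \<zeta> where "\<zeta> = \<zeta>' \<star> single m 1"
  have \<zeta>_keys: "cone k \<and> fst k = 0" if "k \<in> keys \<zeta>" for k
  proof -
    obtain b b' where b: "k = b + b'" "b \<in> keys \<zeta>'" "b' \<in> keys (single m (1 :: 'k))"
      using \<open>k \<in> keys \<zeta>\<close> unfolding \<zeta>_def by (rule keys_starE)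
    then have "k = b + m" by simp
    then show ?thesis
      using M(2)[OF b(2), folded m_def] \<zeta>'_fst[OF b(2)] m(2) by (simp only: fst_add) simp
  qed
  have \<zeta>_A: "\<zeta> \<in> A" by (rule keys_cone_in_A) (simp add: \<zeta>_keys)
  have eq: "part ?c \<star> single m 1 = single (a + n) 1 \<star> \<zeta>"
    by (simp only: \<zeta>_def flip: star_assoc \<zeta>'(1))
  have an: "cone (a + n)" using a n by (rule cone_add)
  have "part ?c \<star> single m 1 \<noteq> 0" using lead_star(2)[OF part_nz[OF c] single_nonzero] .
  then have \<zeta>_nz: "\<zeta> \<noteq> 0" unfolding eq by auto
  have fst_central: "fst (lead \<theta> (\<Phi> z)) = 0" if "z \<in> A" "z \<noteq> 0" "\<And>k. k \<in> keys z \<Longrightarrow> fst k = 0" for z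
  proof -
    have "fst (\<theta> (lead \<theta> (\<Phi> z))) = 0"
      using \<Phi>_central[OF that(1,3) lead_in[OF \<Phi>_nonzero[OF that(1,2)]]] .
    from fst_\<theta>[OF this] show ?thesis by (simp only: \<theta>_invol)
  qed
  have "\<Phi> (part ?c) \<star> \<Phi> (single m 1) = \<Phi> (single (a + n) 1) \<star> \<Phi> \<zeta>"
    using arg_cong[OF eq, of \<Phi>] \<Phi>_star part(1) in_A[OF m(1)] in_A[OF an] \<zeta>_A by simp
  then have "lead \<theta> (\<Phi> (part ?c)) + lead \<theta> (\<Phi> (single m 1)) = lead \<theta> (\<Phi> (single (a + n) 1)) + lead \<theta> (\<Phi> \<zeta>)"
    using lead_star(1)[OF \<Phi>_nonzero[OF part(1) part_nz[OF c]] \<Phi>_nonzero[OF in_A[OF m(1)] single_nonzero]]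
      lead_star(1)[OF \<Phi>_nonzero[OF in_A[OF an] single_nonzero] \<Phi>_nonzero[OF \<zeta>_A \<zeta>_nz]] by simp
  then have "fst (lead \<theta> (\<Phi> (part ?c))) + fst (lead \<theta> (\<Phi> (single m 1)))
      = fst (lead \<theta> (\<Phi> (single (a + n) 1))) + fst (lead \<theta> (\<Phi> \<zeta>))"
    by (metis fst_add)
  moreover have "fst (lead \<theta> (\<Phi> (single m 1))) = 0"
    by (rule fst_central[OF in_A[OF m(1)] single_nonzero]) (simp add: m(2))
  moreover have "fst (lead \<theta> (\<Phi> \<zeta>)) = 0"
    by (rule fst_central[OF \<zeta>_A \<zeta>_nz]) (simp add: \<zeta>_keys)
  ultimately have 1: "fst (lead \<theta> (\<Phi> (part ?c))) = fst (lead \<theta> (\<Phi> (single (a + n) 1)))"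
    by simp
  have an_eq: "single (a + n) 1 = sc (inverse (q powi bil a n)) \<star> (single a 1 \<star> s)"
    by (simp add: s_def star_single sc_simps)
  have "\<Phi> (single (a + n) 1) = sc (inverse (q powi bil a n)) \<star> (\<Phi> (single a 1) \<star> \<Phi> s)"
    unfolding an_eq using in_A[OF a] s(1) by (simp add: \<Phi>_star \<Phi>_sc algebra_closed)
  moreover have "keys (sc (inverse (q powi bil a n)) \<star> (\<Phi> (single a 1) \<star> \<Phi> s)) = keys (\<Phi> (single a 1) \<star> \<Phi> s)"
    by (simp add: keys_sc_star)
  ultimately have "lead \<theta> (\<Phi> (single (a + n) 1)) = lead \<theta> (\<Phi> (single a 1) \<star> \<Phi> s)"
    by (simp only: lead_def)
  also have "\<dots> = lead \<theta> (\<Phi> (single a 1)) + lead \<theta> (\<Phi> s)"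
    by (rule lead_star(1)[OF \<Phi>_nonzero[OF in_A[OF a] single_nonzero] s(2)])
  finally have 2: "fst (lead \<theta> (\<Phi> (single (a + n) 1))) = fst (lead \<theta> (\<Phi> (single a 1))) + fst (lead \<theta> (\<Phi> s))"
    by (simp only: fst_add)
  from fst_mono_lex[OF le] show ?thesis
    unfolding fst_add 1[unfolded fst_add] 2[unfolded fst_add] by simp
qed

end

section \<open>Monomials fixed by unipotent automorphisms\<close>

context unipotent_pair
begin

text \<open>The order and its reverse bound the classes of all terms from above and from below by
  the class of \<open>a\<close>.\<close>

lemma \<Phi>_class:
  assumes "cone a" "b \<in> keys (\<Phi> (single a 1))"
  shows "fst b = fst a"
proof (rule antisym)
  interpret i: unipotent_pair_order q \<Phi> \<Psi> "\<lambda>a. a" by unfold_locales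
  interpret u: unipotent_pair_order q \<Phi> \<Psi> uminus by unfold_locales simp_all
  show "fst b \<le> fst a"
    using fst_mono_lex[OF ord_id.lead_ge[OF assms(2)]] i.fst_lead_\<Phi>_le[OF _ assms(1)] by simp
  have "fst (- b) \<le> fst (- a)"
    using fst_mono_lex[OF u.lead_ge[OF assms(2)]] u.fst_lead_\<Phi>_le[OF _ assms(1)]
    by (simp only: fst_uminus) (meson neg_equal_0_iff_equal order_trans)
  then show "fst a \<le> fst b" by (simp only: fst_uminus neg_le_iff_le)
qed

text \<open>Such a monomial contains none of \<open>D1\<close>, \<open>D3\<close>,
  \<open>D2\<close>, so division by it keeps their exponents in the image, which are nonnegative
  throughout \<open>A\<close>.\<close>

lemma ex_central_quotient:
  assumes "a = ((g, x, y, 0), (0, 0))" "cone a"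
  obtains \<zeta> where "\<Phi> (single a 1) = single a 1 \<star> \<zeta>" "\<zeta> \<in> A"
    "\<And>k. k \<in> keys \<zeta> \<Longrightarrow> \<exists>r s. k = (0, (r, s)) \<and> r \<ge> 0 \<and> s \<ge> 0"
proof -
  obtain \<zeta> where \<zeta>: "single a 1 \<star> \<zeta> = \<Phi> (single a 1)"
    "\<And>k. k \<in> keys \<zeta> \<Longrightarrow> \<exists>b\<in>keys (\<Phi> (single a 1)). k = b - a"
    using ex_single_quotient by blast
  have k: "\<exists>r s. k = (0, (r, s)) \<and> r \<ge> 0 \<and> s \<ge> 0" if "k \<in> keys \<zeta>" for k
  proof -
    obtain b where b: "b \<in> keys (\<Phi> (single a 1))" "k = b - a" using \<zeta>(2)[OF \<open>k \<in> keys \<zeta>\<close>] by blast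
    have "frozen_nonneg b" using A_frozen[OF \<Phi>_A[OF cone_in_A[OF assms(2)]] b(1)] .
    moreover have "fst b = fst a" using \<Phi>_class[OF assms(2) b(1)] .
    moreover obtain r s where "snd b = (r, s)" by (metis prod.exhaust)
    ultimately have b': "b = ((g, x, y, 0), (r, s))" and "frozen_nonneg b"
      using assms(1) by (simp_all add: prod_eq_iff)
    then have "0 \<le> r" "0 \<le> s" by simp_all
    then show ?thesis using b(2) b' assms(1) by (simp add: zero_prod_def)
  qed
  have "\<zeta> \<in> A"
  proof (rule keys_cone_in_A)
    fix k assume "k \<in> keys \<zeta>"
    from k[OF this] show "cone k" by (auto simp: zero_prod_def)
  qed
  with \<zeta>(1) k show ?thesis using that by metis
qed

text \<open>The inverse of the central factor \<open>\<zeta>\<close> is \<open>\<Phi>\<close> of the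
  corresponding factor for \<open>\<Psi>\<close>. Both leading exponents are nonnegative and add up
  to 0, so the largest exponent of \<open>\<zeta>\<close> is 0 and there is no other.\<close>

lemma \<Phi>_fixes:
  assumes a: "a = ((g, x, y, 0), (0, 0))" "cone a"
  shows "\<Phi> (single a 1) = single a 1"
proof -
  interpret sw: unipotent_pair q \<Psi> \<Phi> by (rule swap)
  have s: "single a 1 \<in> A" using cone_in_A[OF a(2)] .
  obtain \<zeta> where \<zeta>: "\<Phi> (single a 1) = single a 1 \<star> \<zeta>" "\<zeta> \<in> A"
    "\<And>k. k \<in> keys \<zeta> \<Longrightarrow> \<exists>r s. k = (0, (r, s)) \<and> r \<ge> 0 \<and> s \<ge> 0"
    using ex_central_quotient[OF a] by blast
  obtain \<xi> where \<xi>: "\<Psi> (single a 1) = single a 1 \<star> \<xi>" "\<xi> \<in> A"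
    "\<And>k. k \<in> keys \<xi> \<Longrightarrow> \<exists>r s. k = (0, (r, s)) \<and> r \<ge> 0 \<and> s \<ge> 0"
    using sw.ex_central_quotient[OF a] by blast
  have "single a 1 = \<Phi> (single a 1) \<star> \<Phi> \<xi>"
    using \<Phi>_\<Psi>[OF s] \<Phi>_star[OF s \<xi>(2)] by (simp add: \<xi>(1))
  then have "single a 1 \<star> sc 1 = single a 1 \<star> (\<zeta> \<star> \<Phi> \<xi>)"
    by (simp add: \<zeta>(1) star_assoc sc_simps)
  then have prod: "\<zeta> \<star> \<Phi> \<xi> = sc 1" by (metis single_cancel(1))
  then have nz: "\<zeta> \<noteq> 0" "\<Phi> \<xi> \<noteq> 0" by force+
  have sc_lead: "lead_id (sc 1) = 0" unfolding sc_def by (rule ord_id.lead_single) simp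
  have sum: "lead_id \<zeta> + lead_id (\<Phi> \<xi>) = 0"
    using ord_id.lead_star(1)[OF nz] by (simp only: prod sc_lead)
  have nonneg: "k \<ge> 0" if "\<exists>r s. k = (0, (r, s)) \<and> r \<ge> 0 \<and> s \<ge> 0" for k :: expo
    using that by (auto simp: zero_prod_def)
  have 1: "lead_id \<zeta> \<ge> 0" by (rule nonneg[OF \<zeta>(3)[OF ord_id.lead_in[OF nz(1)]]])
  have "lead_id (\<Phi> \<xi>) \<ge> 0"
  proof (rule nonneg)
    let ?k = "lead_id (\<Phi> \<xi>)"
    have k: "?k \<in> keys (\<Phi> \<xi>)" using ord_id.lead_in[OF nz(2)] .
    have "fst ?k = 0" by (rule \<Phi>_central[OF \<xi>(2) _ k]) (use \<xi>(3) in force)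
    moreover have "frozen_nonneg ?k" using A_frozen[OF \<Phi>_A[OF \<xi>(2)] k] .
    moreover obtain r s where "snd ?k = (r, s)" by (metis prod.exhaust)
    ultimately have k': "?k = (0, (r, s))" and "frozen_nonneg ?k" by (simp_all add: prod_eq_iff)
    then have "frozen_nonneg ((0, 0, 0, 0), (r, s))" by (simp only: zero_prod_def)
    with k' show "\<exists>r s. ?k = (0, (r, s)) \<and> r \<ge> 0 \<and> s \<ge> 0" by (intro exI[of _ r] exI[of _ s]) simp
  qed
  with 1 sum have lead0: "lead_id \<zeta> = 0" by (simp add: add_nonneg_eq_0_iff)
  have "k = 0" if k: "k \<in> keys \<zeta>" for k
  proof (rule antisym)
    show "k \<le> 0" using ord_id.lead_ge[OF k] by (simp only: lead0)
    show "0 \<le> k" by (rule nonneg[OF \<zeta>(3)[OF k]])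
  qed
  then have "\<zeta> = (\<Sum>k\<in>keys \<zeta>. single 0 (lookup \<zeta> k))"
    by (subst sum_single_lookup[of \<zeta>, symmetric]) (rule sum.cong[OF refl], metis)
  also have "keys \<zeta> = {0}"
    using \<open>\<And>k. k \<in> keys \<zeta> \<Longrightarrow> k = 0\<close> nz(1) by (metis keys_eq_empty subsetI subset_singleton_iff singletonI)
  finally have "\<zeta> = sc (lookup \<zeta> 0)" by (simp add: sc_def)
  then obtain c where c: "\<zeta> = sc c" by blast
  have "\<Phi> (single a 1) = single a c" unfolding \<zeta>(1) c by (simp add: sc_simps flip: sc_commute)
  moreover from this have "c = 1" using lookup_unipotent(1)[OF a(2)] by simp
  ultimately show ?thesis by simp
qed

text \<open>The image of e2 is not a monomial, but \<open>e12' - e12\<close> is a nonzero multiple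
  of \<open>e2 * e1\<close>, and the monomial \<open>\<pi> e1\<close> can be cancelled in the
  torus.\<close>

lemma \<Phi>_fixes_gens: "\<Phi> (\<pi> e1) = \<pi> e1" "\<Phi> (\<pi> e2) = \<pi> e2"
proof -
  have \<pi>_A: "\<pi> x \<in> A" for x by (simp add: A_def)
  show 1: "\<Phi> (\<pi> e1) = \<pi> e1"
    unfolding \<pi>_gens by (rule \<Phi>_fixes[OF refl]) simp
  have scaled: "\<Phi> (single ((g, x, y, 0), (0, 0)) c) = single ((g, x, y, 0), (0, 0)) c"
    if "cone ((g, x, y, 0), (0, 0))" for g x y c
  proof -
    have "\<Phi> (sc c \<star> single ((g, x, y, 0), (0, 0)) 1) = sc c \<star> single ((g, x, y, 0), (0, 0)) 1"
      using \<Phi>_star[OF algebra_closed(4) cone_in_A[OF that], of c 1] by (simp only: \<Phi>_fixes[OF refl that] \<Phi>_sc)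
    then show ?thesis by (simp add: sc_simps)
  qed
  have fix12: "\<Phi> (\<pi> e12) = \<pi> e12" "\<Phi> (\<pi> e12') = \<pi> e12'"
    unfolding \<pi>_cluster by (rule scaled, simp)+
  have "e12' - e12 = scalar (q - inverse q) * (e2 * e1)"
  proof -
    have "scalar (q - inverse q) = scalar q - scalar (inverse q)" by (simp add: scalar_def single_diff)
    then show ?thesis unfolding e12_def e12'_def by (simp add: left_diff_distrib)
  qed
  then have "\<pi> e12' = \<pi> e12 + sc (q - inverse q) \<star> (\<pi> e2 \<star> \<pi> e1)"
    by (metis \<pi>_simps(1,3,4) diff_add_cancel add.commute)
  moreover from this have "\<Phi> (\<pi> e12') = \<Phi> (\<pi> e12) + sc (q - inverse q) \<star> (\<Phi> (\<pi> e2) \<star> \<pi> e1)"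
    by (simp add: \<Phi>_add \<Phi>_star \<Phi>_sc algebra_closed \<pi>_A 1)
  ultimately have "sc (q - inverse q) \<star> (\<Phi> (\<pi> e2) \<star> \<pi> e1) = sc (q - inverse q) \<star> (\<pi> e2 \<star> \<pi> e1)"
    unfolding fix12 by (metis add_left_cancel)
  moreover have "q - inverse q \<noteq> 0" using \<kappa>_nonzero by (simp add: \<kappa>_def)
  ultimately have "\<Phi> (\<pi> e2) \<star> \<pi> e1 = \<pi> e2 \<star> \<pi> e1" by (rule sc_cancel[rotated])
  then show "\<Phi> (\<pi> e2) = \<pi> e2" unfolding \<pi>_gens(1) by (rule single_cancel(2))
qed

end


section \<open>Linear parts of automorphisms\<close>

abbreviation wlen :: "word \<Rightarrow> nat"
  where "wlen w \<equiv> length (letters w)"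

definition Fge :: "nat \<Rightarrow> 'k :: field free_alg set"
  where "Fge n = {x. \<forall>w\<in>keys x. n \<le> wlen w}"

definition Fhom :: "nat \<Rightarrow> 'k :: field free_alg set"
  where "Fhom n = {x. \<forall>w\<in>keys x. wlen w = n}"

lemma keys_free_mult:
  "w \<in> keys (x * y) \<Longrightarrow> \<exists>u\<in>keys x. \<exists>v\<in>keys y. wlen w = wlen u + wlen v"
  for x y :: "'k :: field free_alg"
  using keys_mult[of x y] by (force simp: plus_word_def)

lemma Fge_add: "x \<in> Fge n \<Longrightarrow> y \<in> Fge n \<Longrightarrow> x + y \<in> Fge n"
  using keys_add[of x y] by (auto simp: Fge_def)

lemma Fge_diff: "x \<in> Fge n \<Longrightarrow> y \<in> Fge n \<Longrightarrow> x - y \<in> Fge n"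
  using keys_diff[of x y] by (auto simp: Fge_def)

lemma Fge_mult: "x \<in> Fge m \<Longrightarrow> y \<in> Fge n \<Longrightarrow> x * y \<in> Fge (m + n)"
  unfolding Fge_def using keys_free_mult by (fastforce intro: add_mono)

lemma Fge_mono: "x \<in> Fge n \<Longrightarrow> m \<le> n \<Longrightarrow> x \<in> Fge m"
  by (auto simp: Fge_def)

lemma Fge_0 [simp]: "x \<in> Fge 0"
  by (simp add: Fge_def)

lemma zero_in_Fge [simp]: "0 \<in> Fge n"
  by (simp add: Fge_def)

lemma Fge_scalar: "x \<in> Fge n \<Longrightarrow> scalar c * x \<in> Fge n"
  using Fge_mult[of "scalar c" 0 x n] by simp

lemma Fge_free_gen: "free_gen i \<in> Fge 1"
  by (simp add: Fge_def free_gen_def)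

lemma Fhom_closed:
  "x \<in> Fhom n \<Longrightarrow> y \<in> Fhom n \<Longrightarrow> x + y \<in> Fhom n"
  "x \<in> Fhom n \<Longrightarrow> y \<in> Fhom n \<Longrightarrow> x - y \<in> Fhom n"
  "x \<in> Fhom m \<Longrightarrow> y \<in> Fhom n \<Longrightarrow> x * y \<in> Fhom (m + n)"
  "scalar c \<in> Fhom 0" "free_gen i \<in> Fhom 1"
proof -
  show "x \<in> Fhom m \<Longrightarrow> y \<in> Fhom n \<Longrightarrow> x * y \<in> Fhom (m + n)"
    unfolding Fhom_def using keys_free_mult by fastforce
  show "scalar c \<in> Fhom 0" by (simp add: Fhom_def scalar_def zero_word_def)
  show "free_gen i \<in> Fhom 1" by (simp add: Fhom_def free_gen_def)
qed (use keys_add[of x y] keys_diff[of x y] in \<open>auto simp: Fhom_def\<close>)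

lemma poly_mapping_keys_induct:
  fixes x :: "'a \<Rightarrow>\<^sub>0 'b :: comm_monoid_add"
  assumes "P 0" "\<And>k. k \<in> keys x \<Longrightarrow> P (single k (lookup x k))" "\<And>x y. P x \<Longrightarrow> P y \<Longrightarrow> P (x + y)"
  shows "P x"
proof -
  have "P (\<Sum>k\<in>S. single k (lookup x k))" if "finite S" "S \<subseteq> keys x" for S
    using that by (induction S rule: finite_induct) (simp_all add: assms)
  from this[of "keys x"] show ?thesis by (simp only: sum_single_lookup) simp
qed

lemma eval_0 [simp]: "free_subst g 0 = 0"
  by (simp add: free_eval_def)

lemma subst_single:
  "free_subst g (single w c) = scalar c * prod_list (map g (letters w))"
  by (rule scal.eval_single)

text \<open>Telescoping over the letters of a word: each exchange of a factor \<open>g i\<close> for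
  \<open>l i\<close> gains one degree. For linear \<open>l\<close> the second claim identifies the
  lowest part of a substitution.\<close>

lemma subst_approx:
  assumes "\<And>i. g i \<in> Fge 1" "\<And>i. l i \<in> Fge 1" "\<And>i. g i - l i \<in> Fge 2" "x \<in> Fge n"
  shows "free_subst g x \<in> Fge n" "free_subst g x - free_subst l x \<in> Fge (Suc n)"
proof -
  have w: "prod_list (map k v) \<in> Fge (length v)" if "\<And>i. k i \<in> Fge 1" for k :: "gen \<Rightarrow> 'a free_alg" and v
  proof (induction v)
    case (Cons i v)
    then show ?case using Fge_mult[OF that Cons.IH, of i] by simp
  qed simp
  have d: "prod_list (map g v) - prod_list (map l v) \<in> Fge (Suc (length v))" for v
  proof (induction v)
    case (Cons i v)
    have "(g i - l i) * prod_list (map g v) \<in> Fge (2 + length v)"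
      by (rule Fge_mult[OF assms(3) w[OF assms(1)]])
    moreover have "l i * (prod_list (map g v) - prod_list (map l v)) \<in> Fge (1 + Suc (length v))"
      by (rule Fge_mult[OF assms(2) Cons.IH])
    ultimately have "(g i - l i) * prod_list (map g v) + l i * (prod_list (map g v) - prod_list (map l v))
        \<in> Fge (Suc (length (i # v)))"
      by (intro Fge_add) simp_all
    then show ?case by (simp add: algebra_simps)
  qed simp
  have "free_subst g x \<in> Fge n \<and> free_subst g x - free_subst l x \<in> Fge (Suc n)"
  proof (induction x rule: poly_mapping_keys_induct)
    case (2 u)
    then have u: "n \<le> wlen u" using assms(4) by (auto simp: Fge_def)
    show ?case
      unfolding subst_single right_diff_distrib[symmetric]
      using Fge_mono[OF w[of g "letters u", OF assms(1)] u] Fge_mono[OF d[of "letters u"], of "Suc n"] u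
      by (simp add: Fge_scalar)
  next
    case (3 x y)
    then have "(free_subst g x - free_subst l x) + (free_subst g y - free_subst l y) \<in> Fge (Suc n)"
      by (intro Fge_add) simp_all
    with 3 show ?case by (simp add: scal.eval_simps Fge_add algebra_simps)
  qed simp
  then show "free_subst g x \<in> Fge n" "free_subst g x - free_subst l x \<in> Fge (Suc n)" by simp_all
qed

lemma subst_id: "free_subst free_gen x = x"
proof -
  have "free_subst free_gen (single w c) = single w c" for w :: word and c :: 'a
    by (cases w, simp only: subst_single word.sel) (simp only: single_Word)
  then show ?thesis
    by (induction x rule: free_alg_induct) (simp_all add: scal.eval_simps)
qed

definition lin_coeff :: "gen \<Rightarrow> 'k :: field free_alg \<Rightarrow> 'k"
  where "lin_coeff i x = lookup x (Word [i])"

definition const_coeff :: "'k :: field free_alg \<Rightarrow> 'k"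
  where "const_coeff x = lookup x 0"

text \<open>The constant term is the augmentation character, and the linear coefficients are
  derivations over it, i.e. tangent vectors.\<close>

lemma const_lin_mult:
  "const_coeff (x * y) = const_coeff x * const_coeff y" "lin_coeff i (x * y) = lin_coeff i x * const_coeff y + const_coeff x * lin_coeff i y"
proof -
  have "const_coeff (x * y) = const_coeff x * const_coeff y \<and> lin_coeff i (x * y) = lin_coeff i x * const_coeff y + const_coeff x * lin_coeff i y"
  proof (induction x rule: free_alg_induct)
    case (1 v c)
    show ?case
    proof (induction y rule: free_alg_induct)
      case (1 w d)
      obtain a b where "v = Word a" "w = Word b" by (metis word.exhaust)
      then show ?case
        by (auto simp: const_coeff_def lin_coeff_def mult_single plus_word_def zero_word_def lookup_single when_def
            append_eq_Cons_conv)
    qed (auto simp: const_coeff_def lin_coeff_def lookup_add distrib_left distrib_right)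
  qed (auto simp: const_coeff_def lin_coeff_def lookup_add distrib_left distrib_right)
  then show "const_coeff (x * y) = const_coeff x * const_coeff y" "lin_coeff i (x * y) = lin_coeff i x * const_coeff y + const_coeff x * lin_coeff i y" by simp_all
qed

lemma const_lin_simps:
  "const_coeff (x + y) = const_coeff x + const_coeff y" "const_coeff (x - y) = const_coeff x - const_coeff y" "const_coeff (scalar c) = c" "const_coeff (free_gen i) = 0" "const_coeff 0 = 0"
  "lin_coeff i (x + y) = lin_coeff i x + lin_coeff i y" "lin_coeff i (x - y) = lin_coeff i x - lin_coeff i y" "lin_coeff i (scalar c) = 0"
  "lin_coeff i (free_gen j) = (if i = j then 1 else 0)" "lin_coeff i 0 = 0"
  by (auto simp: const_coeff_def lin_coeff_def lookup_add lookup_minus scalar_def free_gen_def zero_word_def lookup_single when_def)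

lemma Fge_1_iff: "x \<in> Fge 1 \<longleftrightarrow> const_coeff x = 0"
proof
  assume "x \<in> Fge 1"
  then show "const_coeff x = 0" by (force simp: Fge_def const_coeff_def zero_word_def in_keys_iff)
next
  assume "const_coeff x = 0"
  then have "w \<noteq> Word []" if "w \<in> keys x" for w
    using that by (auto simp: const_coeff_def zero_word_def in_keys_iff)
  then show "x \<in> Fge 1"
    unfolding Fge_def by (auto simp: Suc_le_eq) (metis word.collapse)
qed

lemma Fge_2_iff: "x \<in> Fge 2 \<longleftrightarrow> const_coeff x = 0 \<and> (\<forall>i. lin_coeff i x = 0)"
proof
  assume "x \<in> Fge 2"
  then show "const_coeff x = 0 \<and> (\<forall>i. lin_coeff i x = 0)" by (force simp: Fge_def const_coeff_def lin_coeff_def zero_word_def in_keys_iff)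
next
  assume *: "const_coeff x = 0 \<and> (\<forall>i. lin_coeff i x = 0)"
  show "x \<in> Fge 2"
    unfolding Fge_def
  proof (clarify)
    fix w assume w: "w \<in> keys x"
    obtain v where v: "w = Word v" by (metis word.exhaust)
    show "2 \<le> wlen w"
    proof (cases v)
      case Nil
      then show ?thesis using * w v by (simp add: const_coeff_def zero_word_def in_keys_iff)
    next
      case (Cons i u)
      then show ?thesis using * w v by (cases u) (auto simp: lin_coeff_def in_keys_iff)
    qed
  qed
qed

text \<open>The relators have neither constant nor linear terms; hence \<open>const_coeff\<close>
  and \<open>lin_coeff\<close> are well defined on U.\<close>

lemma serre_ideal_Fge: "x \<in> serre_ideal q \<Longrightarrow> x \<in> Fge 2"
proof -
  have "serre_ideal q \<subseteq> Fge 2"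
  proof (rule serre_ideal_subset)
    fix r assume "r \<in> serre_relators q"
    then show "r \<in> Fge 2"
      unfolding Fge_2_iff serre_relators_def by (auto simp: const_lin_simps const_lin_mult power2_eq_square)
  next
    fix x y :: "'a free_alg" assume "x \<in> Fge 2"
    then show "y * x \<in> Fge 2" "x * y \<in> Fge 2" using Fge_mult[of y 0 x 2] Fge_mult[of x 2 y 0] by (simp_all add: numeral_2_eq_2)
  qed (simp_all add: Fge_add)
  then show "x \<in> serre_ideal q \<Longrightarrow> x \<in> Fge 2" by blast
qed

definition det3 :: "(gen \<Rightarrow> gen \<Rightarrow> 'k :: comm_ring_1) \<Rightarrow> 'k"
  where "det3 d = d E1 E1 * (d E2 E2 * d E3 E3 - d E2 E3 * d E3 E2)
    - d E1 E2 * (d E2 E1 * d E3 E3 - d E2 E3 * d E3 E1)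
    + d E1 E3 * (d E2 E1 * d E3 E2 - d E2 E2 * d E3 E1)"

lemma det3_nonzero:
  fixes d m :: "gen \<Rightarrow> gen \<Rightarrow> 'k :: field"
  assumes "\<And>k i. d k E1 * m E1 i + d k E2 * m E2 i + d k E3 * m E3 i = (if k = i then 1 else 0)"
  shows "det3 d \<noteq> 0"
proof -
  have "det3 d * det3 m = det3 (\<lambda>k i. d k E1 * m E1 i + d k E2 * m E2 i + d k E3 * m E3 i)"
    unfolding det3_def by (simp add: algebra_simps)
  also have "\<dots> = 1" unfolding assms by (simp add: det3_def)
  finally show ?thesis by auto
qed

section \<open>Lifts of automorphisms to the free algebra\<close>

context qparam
begin

text \<open>An automorphism of U and its inverse, given by representatives of the images of the
  generators.\<close>

definition lift_pair :: "(gen \<Rightarrow> 'k free_alg) \<Rightarrow> (gen \<Rightarrow> 'k free_alg) \<Rightarrow> bool"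
  where "lift_pair g h \<longleftrightarrow>
    (\<forall>x\<in>serre_ideal q. free_subst g x \<in> serre_ideal q) \<and> (\<forall>x\<in>serre_ideal q. free_subst h x \<in> serre_ideal q) \<and>
    (\<forall>x. free_subst g (free_subst h x) \<doteq> x) \<and> (\<forall>x. free_subst h (free_subst g x) \<doteq> x)"

lemma lift_pair_swap: "lift_pair g h \<Longrightarrow> lift_pair h g"
  unfolding lift_pair_def by blast

lemma relator_in_ideal:
  "(i, j) \<in> adjacent \<Longrightarrow> free_gen i * (free_gen i * free_gen j)
    - scalar (q + inverse q) * (free_gen i * (free_gen j * free_gen i)) + free_gen j * (free_gen i * free_gen i) \<in> serre_ideal q"
  using serre_in_ideal[of i j] by (simp add: serre_def scalar_simps)

lemma q_ne_1: "q \<noteq> 1"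
  using q_not_root[of 1] by simp

lemma two_minus: "2 - (q + inverse q) \<noteq> 0"
proof -
  have "2 - (q + inverse q) = - ((q - 1)\<^sup>2 / q)" by (simp add: field_simps power2_eq_square)
  then show ?thesis using q_ne_1 by simp
qed

text \<open>\<open>x \<mapsto> lin_coeff k (free_subst g x)\<close> is a derivation over the character \<open>x \<mapsto> const_coeff (free_subst g x)\<close>,
  so it is determined by its values on the generators.\<close>

lemma lift_pair_lin_det:
  assumes "lift_pair g h"
  shows "det3 (\<lambda>k i. lin_coeff k (g i)) \<noteq> 0"
proof -
  define d where "d k i = lin_coeff k (g i)" for k i
  \<comment> \<open>The coefficients \<open>m\<close> are the same for all \<open>k\<close>. For
    \<open>x = h i\<close> they will form a right inverse of the matrix \<open>d\<close>.\<close>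
  have "\<exists>m. \<forall>k. lin_coeff k (free_subst g x) = d k E1 * m E1 + d k E2 * m E2 + d k E3 * m E3" for x
  proof (induction x rule: free_alg_induct)
    case (1 w c)
    have "\<exists>m. \<forall>k. lin_coeff k (free_subst g (prod_list (map free_gen v))) = d k E1 * m E1 + d k E2 * m E2 + d k E3 * m E3" for v
    proof (induction v)
      case Nil
      then show ?case using const_lin_simps(8)[of _ "1 :: 'k"] by (intro exI[of _ "\<lambda>_. 0"]) (simp add: scal.eval_simps scalar_simps)
    next
      case (Cons i v)
      let ?x = "free_subst g (prod_list (map free_gen v))"
      from Cons obtain m where m: "\<And>k. lin_coeff k ?x = d k E1 * m E1 + d k E2 * m E2 + d k E3 * m E3" by blast
      have "lin_coeff k (free_subst g (prod_list (map free_gen (i # v)))) = d k i * const_coeff ?x + const_coeff (g i) * lin_coeff k ?x" for k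
        by (simp add: scal.eval_simps const_lin_mult d_def)
      then show ?case
        by (intro exI[of _ "\<lambda>j. (if j = i then const_coeff ?x else 0) + const_coeff (g i) * m j"])
          (cases i; simp add: m algebra_simps)
    qed
    then obtain m where "\<And>k. lin_coeff k (free_subst g (prod_list (map free_gen (letters w)))) = d k E1 * m E1 + d k E2 * m E2 + d k E3 * m E3"
      by blast
    then show ?case
      by (intro exI[of _ "\<lambda>j. c * m j"])
        (cases w; simp add: single_Word scal.eval_simps const_lin_mult const_lin_simps algebra_simps)
  next
    case (2 x y)
    then obtain m m' where "\<And>k. lin_coeff k (free_subst g x) = d k E1 * m E1 + d k E2 * m E2 + d k E3 * m E3"
      "\<And>k. lin_coeff k (free_subst g y) = d k E1 * m' E1 + d k E2 * m' E2 + d k E3 * m' E3" by blast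
    then show ?case
      by (intro exI[of _ "\<lambda>j. m j + m' j"]) (simp add: scal.eval_simps const_lin_simps algebra_simps)
  qed
  then obtain m where m: "\<And>x k. lin_coeff k (free_subst g x) = d k E1 * m x E1 + d k E2 * m x E2 + d k E3 * m x E3"
    by metis
  have "lin_coeff k (free_subst g (h i)) = (if k = i then 1 else 0)" for k i
  proof -
    have "free_subst g (free_subst h (free_gen i)) \<doteq> free_gen i" using assms by (simp add: lift_pair_def)
    then have "free_subst g (h i) - free_gen i \<in> Fge 2"
      by (intro serre_ideal_Fge) (simp add: cong_iff scal.eval_simps)
    then have "lin_coeff k (free_subst g (h i) - free_gen i) = 0" by (simp add: Fge_2_iff)
    then show ?thesis by (simp add: const_lin_simps)
  qed
  then have "det3 d \<noteq> 0"
    by (intro det3_nonzero[of d "\<lambda>j i. m (h i) j"]) (simp add: m)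
  then show ?thesis by (simp add: d_def[abs_def])
qed

text \<open>At a character different from the augmentation the linearised relations confine the derivations to
  a proper subspace, whereas at the augmentation there is no restriction.\<close>

lemma lift_pair_const:
  assumes "lift_pair g h"
  shows "const_coeff (g i) = 0"
proof (rule ccontr)
  assume nz: "const_coeff (g i) \<noteq> 0"
  obtain j where ij: "(i, j) \<in> adjacent" by (cases i) (auto simp: adjacent_def)
  let ?s = "q + inverse q"
  let ?r = "g i * (g i * g j) - scalar ?s * (g i * (g j * g i)) + g j * (g i * g i)"
  have "?r \<in> serre_ideal q"
  proof -
    let ?x = "free_gen i * (free_gen i * free_gen j) - scalar ?s * (free_gen i * (free_gen j * free_gen i))
      + free_gen j * (free_gen i * free_gen i)"
    have "free_subst g ?x \<in> serre_ideal q"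
      using relator_in_ideal[OF ij] assms unfolding lift_pair_def by blast
    then show ?thesis by (simp add: scal.eval_simps)
  qed
  then have r: "const_coeff ?r = 0" "lin_coeff k ?r = 0" for k
    using serre_ideal_Fge Fge_2_iff by blast+
  have "(2 - ?s) * (const_coeff (g i) * (const_coeff (g i) * const_coeff (g j))) = 0"
    using r(1) by (simp add: const_lin_simps const_lin_mult algebra_simps)
  then have j0: "const_coeff (g j) = 0" using nz two_minus by simp
  \<comment> \<open>With the constant term of \<open>g j\<close> gone, the linear terms of the
    relation involve \<open>g j\<close> only: a whole column of the determinant vanishes.\<close>
  have "(2 - ?s) * (const_coeff (g i) * (const_coeff (g i) * lin_coeff k (g j))) = 0" for k
    using r(2)[of k] by (simp add: const_lin_simps const_lin_mult j0 algebra_simps)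
  then have "lin_coeff k (g j) = 0" for k using nz two_minus by simp
  then have "det3 (\<lambda>k i. lin_coeff k (g i)) = 0" by (cases j) (simp_all add: det3_def)
  then show False using lift_pair_lin_det[OF assms] by contradiction
qed

section \<open>Constraints on the linear part\<close>

definition lin_part :: "(gen \<Rightarrow> 'k free_alg) \<Rightarrow> gen \<Rightarrow> 'k free_alg"
  where "lin_part g i = scalar (lin_coeff E1 (g i)) * e1 + scalar (lin_coeff E2 (g i)) * e2 + scalar (lin_coeff E3 (g i)) * e3"

text \<open>U is graded; this is read off from the injective map to the torus, where word length
  becomes \<open>tdeg\<close>.\<close>

lemma Fhom_Fge_disjoint:
  assumes "x \<in> Fhom n" "x - y \<in> serre_ideal q" "y \<in> Fge (Suc n)"
  shows "x \<in> serre_ideal q"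
proof -
  have eq: "\<pi> x = \<pi> y" using assms(2) by (simp add: cong_iff flip: cong_iff_\<pi>)
  have "keys (\<pi> x) = {}"
  proof (rule ccontr)
    assume "keys (\<pi> x) \<noteq> {}"
    then obtain a where a: "a \<in> keys (\<pi> x)" by blast
    then have "tdeg a = n" using \<pi>_keys(1)[of a x] assms(1) by (auto simp: Fhom_def)
    moreover have "tdeg a \<ge> Suc n" using \<pi>_keys(1)[of a y] a eq assms(3) by (force simp: Fge_def)
    ultimately show False by simp
  qed
  then show ?thesis using \<pi>_eq_0_iff by simp
qed

text \<open>The lowest part of the relation satisfied by \<open>g\<close> is the relation for its
  linear part, and by the grading it holds in U by itself.\<close>

lemma lin_part_serre:
  assumes "lift_pair g h" "(i, j) \<in> adjacent"
  shows "lin_part g i * (lin_part g i * lin_part g j)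
    - scalar (q + inverse q) * (lin_part g i * (lin_part g j * lin_part g i))
    + lin_part g j * (lin_part g i * lin_part g i) \<in> serre_ideal q"
proof -
  let ?l = "lin_part g"
  let ?r = "free_gen i * (free_gen i * free_gen j)
    - scalar (q + inverse q) * (free_gen i * (free_gen j * free_gen i)) + free_gen j * (free_gen i * free_gen i)"
  have g1: "g i \<in> Fge 1" for i using lift_pair_const[OF assms(1)] Fge_1_iff by blast
  have l1: "?l i \<in> Fhom 1" for i
    using Fhom_closed(3)[OF Fhom_closed(4,5)] unfolding lin_part_def
    by (intro Fhom_closed(1)) (simp_all only: add_0)
  then have l1': "?l i \<in> Fge 1" for i by (simp add: Fge_def Fhom_def)
  have gl: "g i - ?l i \<in> Fge 2" for i
  proof -
    have "lin_coeff k (g i - ?l i) = 0" for k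
      by (cases k) (simp_all add: lin_part_def const_lin_simps const_lin_mult)
    moreover have "const_coeff (g i - ?l i) = 0"
      using lift_pair_const[OF assms(1)] by (simp add: lin_part_def const_lin_simps const_lin_mult)
    ultimately show ?thesis by (simp add: Fge_2_iff)
  qed
  have three: "x * (y * z) \<in> Fhom 3" if "x \<in> Fhom 1" "y \<in> Fhom 1" "z \<in> Fhom 1" for x y z :: "'k free_alg"
    using Fhom_closed(3)[OF that(1) Fhom_closed(3)[OF that(2,3)]] by (simp add: numeral_3_eq_3)
  have sthree: "scalar c * (x * (y * z)) \<in> Fhom 3" if "x \<in> Fhom 1" "y \<in> Fhom 1" "z \<in> Fhom 1"
    for x y z :: "'k free_alg" and c
    using Fhom_closed(3)[OF Fhom_closed(4) three[OF that]] by simp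
  have r3: "?r \<in> Fhom 3"
    by (intro Fhom_closed(1,2) three sthree Fhom_closed(5))
  have L: "free_subst ?l ?r = ?l i * (?l i * ?l j) - scalar (q + inverse q) * (?l i * (?l j * ?l i)) + ?l j * (?l i * ?l i)"
    by (simp add: scal.eval_simps)
  have "free_subst ?l ?r \<in> serre_ideal q"
  proof (rule Fhom_Fge_disjoint)
    show "free_subst ?l ?r \<in> Fhom 3"
      unfolding L by (intro Fhom_closed(1,2) three sthree l1)
    have "?r \<in> Fge 3" using r3 by (simp add: Fge_def Fhom_def)
    from subst_approx(2)[OF g1 l1' gl this]
    have *: "free_subst g ?r - free_subst ?l ?r \<in> Fge (Suc 3)" .
    show "- (free_subst g ?r - free_subst ?l ?r) \<in> Fge (Suc 3)"
      using Fge_diff[OF zero_in_Fge *] by simp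
    have "free_subst g ?r \<in> serre_ideal q"
      using assms(1) relator_in_ideal[OF assms(2)] unfolding lift_pair_def by blast
    then show "free_subst ?l ?r - - (free_subst g ?r - free_subst ?l ?r) \<in> serre_ideal q" by simp
  qed
  then show ?thesis by (simp only: L)
qed

text \<open>At a character the factors commute, and the relation collapses to (2 - (q + 1/q)) times
  the square of \<open>l i\<close> times \<open>l j\<close>.\<close>

lemma lin_part_adjacent:
  assumes "lift_pair g h" "(i, j) \<in> adjacent" "p E1 = 0 \<and> p E3 = 0 \<or> p E2 = 0"
  defines "l \<equiv> \<lambda>i. lin_coeff E1 (g i) * p E1 + lin_coeff E2 (g i) * p E2 + lin_coeff E3 (g i) * p E3"
  shows "l i * l j = 0"
proof -
  have ev: "free_eval (\<lambda>c. c) p (lin_part g i) = l i" for i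
    by (simp add: lin_part_def id_scal.eval_simps l_def)
  have "free_eval (\<lambda>c. c) p (lin_part g i * (lin_part g i * lin_part g j)
    - scalar (q + inverse q) * (lin_part g i * (lin_part g j * lin_part g i))
    + lin_part g j * (lin_part g i * lin_part g i)) = 0"
    by (rule character_vanishes[OF assms(3) lin_part_serre[OF assms(1,2)]])
  then have "(2 - (q + inverse q)) * (l i * (l i * l j)) = 0"
    by (simp add: id_scal.eval_simps ev algebra_simps)
  then show ?thesis using two_minus by auto
qed

lemma q_sq_ne: "(q + inverse q)\<^sup>2 \<noteq> 4"
proof -
  have "(q + inverse q)\<^sup>2 - 4 = \<kappa>\<^sup>2" by (simp add: \<kappa>_def field_simps power2_eq_square)
  then show ?thesis using \<kappa>_nonzero by (metis cancel_comm_monoid_add_class.diff_cancel power_eq_0_iff)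
qed

text \<open>Characters do not exclude a mixture of e1 and e3, so a noncommutative test is made; the
  three-monomial homomorphism \<open>\<pi>'\<close> is enough.\<close>

lemma mixed_serre:
  assumes "x = scalar a * e1 + scalar b * e3" "c \<noteq> 0"
    "x * (x * (scalar c * e2)) - scalar (q + inverse q) * (x * (scalar c * e2 * x)) + scalar c * e2 * (x * x) \<in> serre_ideal q"
  shows "a * b = 0"
proof -
  have g: "\<pi>' e1 = single ((0, 1, 0, 0), (0, 0)) 1" "\<pi>' e2 = single ((0, -1, 1, 0), (0, 0)) 1"
    "\<pi>' e3 = single ((-3, 0, -1, 1), (0, 0)) 1"
    by (simp_all add: \<pi>'_simps expsum_def gexp'_def)
  have "\<pi>' (x * (x * (scalar c * e2)) - scalar (q + inverse q) * (x * (scalar c * e2 * x)) + scalar c * e2 * (x * x)) = 0"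
    using assms(3) by (rule \<pi>_vanishes(2))
  \<comment> \<open>This is the sum of the exponents of e1, e2 and e3, so only terms with one factor
    of each contribute. Up to a sign and a power of q they yield
    \<open>a * b * c * ((q + inverse q)\<^sup>2 - 4)\<close>.\<close>
  then have "lookup (\<pi>' (x * (x * (scalar c * e2)) - scalar (q + inverse q) * (x * (scalar c * e2 * x)) + scalar c * e2 * (x * x)))
    ((-3, 0, 0, 1), (0, 0)) = 0" by simp
  moreover have "lookup (2 * y) k = 2 * lookup y k" for y :: "'k qtorus" and k
    by (simp only: mult_2 lookup_add)
  ultimately have "a * b * c * ((q + inverse q)\<^sup>2 - 4) = 0"
    unfolding assms(1) \<pi>'_simps(1-4) g star_add_left star_add_right star_single sc_simps
    by (simp add: sc_simps star_single star_add_left star_add_right lookup_add lookup_minus lookup_single when_def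
        q_powi_minus_numeral field_simps eval_nat_numeral)
  then show ?thesis using assms(2) q_sq_ne by simp
qed

text \<open>Characters with one nonzero value give \<open>row\<close>; the one with value 1 at e1
  and e3 gives \<open>cross\<close>. If the image of e2 involved e1 or e3, columns 1 and 3 would be
  concentrated in a single row, against the determinant. In the remaining 2 by 2 block
  \<open>mixed_serre\<close> leaves one entry per column.\<close>

lemma lift_pair_shape:
  assumes "lift_pair g h"
  defines "d \<equiv> \<lambda>k i. lin_coeff k (g i)"
  shows "d E1 E2 = 0" "d E3 E2 = 0" "d E2 E1 = 0" "d E2 E3 = 0" "d E2 E2 \<noteq> 0"
    "(d E1 E1 \<noteq> 0 \<and> d E3 E3 \<noteq> 0 \<and> d E1 E3 = 0 \<and> d E3 E1 = 0) \<or>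
     (d E1 E3 \<noteq> 0 \<and> d E3 E1 \<noteq> 0 \<and> d E1 E1 = 0 \<and> d E3 E3 = 0)"
proof -
  have det: "det3 d \<noteq> 0" using lift_pair_lin_det[OF assms(1)] by (simp add: d_def[abs_def])
  have adj: "(E1, E2) \<in> adjacent" "(E3, E2) \<in> adjacent" by (simp_all add: adjacent_def)
  have L: "(d E1 i * p E1 + d E2 i * p E2 + d E3 i * p E3) * (d E1 j * p E1 + d E2 j * p E2 + d E3 j * p E3) = 0"
    if "(i, j) \<in> adjacent" "p E1 = 0 \<and> p E3 = 0 \<or> p E2 = 0" for i j p
    using lin_part_adjacent[OF assms(1) that] by (simp add: d_def)
  have row: "d k i * d k j = 0" if "(i, j) \<in> adjacent" for k i j
    using L[OF that, of "\<lambda>m. if m = k then 1 else 0"] by (cases k) auto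
  have cross: "d E1 i * d E3 j + d E3 i * d E1 j = 0" if "(i, j) \<in> adjacent" for i j
  proof -
    have "(d E1 i + d E3 i) * (d E1 j + d E3 j) = 0"
      using L[OF that, of "case_gen 1 0 1"] by simp
    then have "d E1 i * d E1 j + d E3 i * d E3 j + (d E1 i * d E3 j + d E3 i * d E1 j) = 0" by (simp add: algebra_simps)
    then show ?thesis by (simp add: row[OF that])
  qed
  show 12: "d E1 E2 = 0"
  proof (rule ccontr)
    assume nz: "d E1 E2 \<noteq> 0"
    have "d E1 E1 = 0" "d E1 E3 = 0" using row[OF adj(1), of E1] row[OF adj(2), of E1] nz by auto
    moreover from this have "d E3 E1 = 0" "d E3 E3 = 0" using cross[OF adj(1)] cross[OF adj(2)] nz by auto
    ultimately show False using det by (simp add: det3_def)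
  qed
  show 32: "d E3 E2 = 0"
  proof (rule ccontr)
    assume nz: "d E3 E2 \<noteq> 0"
    have "d E3 E1 = 0" "d E3 E3 = 0" using row[OF adj(1), of E3] row[OF adj(2), of E3] nz by auto
    moreover from this have "d E1 E1 = 0" "d E1 E3 = 0" using cross[OF adj(1)] cross[OF adj(2)] nz by auto
    ultimately show False using det by (simp add: det3_def)
  qed
  show 22: "d E2 E2 \<noteq> 0" using det 12 32 by (auto simp: det3_def)
  show 21: "d E2 E1 = 0" "d E2 E3 = 0" using row[OF adj(1), of E2] row[OF adj(2), of E2] 22 by auto
  have s0: "scalar (0 :: 'k) = 0" by (simp add: scalar_def)
  have l2: "lin_part g E2 = scalar (d E2 E2) * e2"
    using 12 32 by (simp add: lin_part_def s0 d_def)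
  have l13: "lin_part g i = scalar (d E1 i) * e1 + scalar (d E3 i) * e3" if "d E2 i = 0" for i
    using that by (simp add: lin_part_def s0 d_def)
  have mixed: "d E1 i * d E3 i = 0" if "(i, E2) \<in> adjacent" "d E2 i = 0" for i
    by (rule mixed_serre[OF l13[OF that(2)] 22]) (use lin_part_serre[OF assms(1) that(1)] in \<open>simp only: l2\<close>)
  have "d E1 E1 * d E3 E1 = 0" "d E1 E3 * d E3 E3 = 0" using mixed adj 21 by auto
  moreover have "d E1 E1 * d E3 E3 - d E1 E3 * d E3 E1 \<noteq> 0"
    using det 12 32 21 by (auto simp: det3_def algebra_simps)
  ultimately show "(d E1 E1 \<noteq> 0 \<and> d E3 E3 \<noteq> 0 \<and> d E1 E3 = 0 \<and> d E3 E1 = 0) \<or>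
     (d E1 E3 \<noteq> 0 \<and> d E3 E1 \<noteq> 0 \<and> d E1 E1 = 0 \<and> d E3 E3 = 0)" by auto
qed

lemma subst_cong: "lift_pair g h \<Longrightarrow> \<pi> x = \<pi> y \<Longrightarrow> \<pi> (free_subst g x) = \<pi> (free_subst g y)"
proof -
  assume lp: "lift_pair g h" and "\<pi> x = \<pi> y"
  then have "x - y \<in> serre_ideal q" by (simp add: cong_iff flip: cong_iff_\<pi>)
  then have "free_subst g (x - y) \<in> serre_ideal q" using lp by (simp add: lift_pair_def)
  then show ?thesis by (simp add: scal.eval_simps cong_iff flip: cong_iff_\<pi>)
qed

section \<open>From lifts to unipotent pairs\<close>

definition induced :: "(gen \<Rightarrow> 'k free_alg) \<Rightarrow> 'k qtorus \<Rightarrow> 'k qtorus"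
  where "induced g t = \<pi> (free_subst g (SOME x. \<pi> x = t))"

lemma induced_\<pi>: "lift_pair g h \<Longrightarrow> induced g (\<pi> x) = \<pi> (free_subst g x)"
  unfolding induced_def by (rule subst_cong) (auto intro: someI)

lemma induced_unipotent:
  assumes lp: "lift_pair g h" and uni: "\<And>i. g i - free_gen i \<in> Fge 2"
    and t: "t \<in> A" "\<And>a. a \<in> keys t \<Longrightarrow> n \<le> tdeg a" and a: "a \<in> keys (induced g t - t)"
  shows "n < tdeg a"
proof -
  have g1: "g i \<in> Fge 1" for i using lift_pair_const[OF lp] Fge_1_iff by blast
  obtain x where x: "t = \<pi> x" using t(1) by (auto simp: A_def)
  \<comment> \<open>A representative without short words is needed: the words shorter than
    \<open>n\<close> together map to 0, since neither \<open>t\<close> nor the image of the rest has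
    exponents of such low degree.\<close>
  define lo where "lo = (\<Sum>w\<in>{w \<in> keys x. int (wlen w) < n}. single w (lookup x w))"
  have lookup_lo: "lookup lo w = (if int (wlen w) < n then lookup x w else 0)" for w
  proof -
    have "lookup lo w = (\<Sum>v\<in>{w \<in> keys x. int (wlen w) < n}. if v = w then lookup x w else 0)"
      by (simp add: lo_def lookup_sum lookup_single when_def)
    then show ?thesis by (simp add: in_keys_iff)
  qed
  define hi where "hi = x - lo"
  have hi: "hi \<in> Fge (nat n)"
    unfolding Fge_def by (auto simp: hi_def in_keys_iff lookup_minus lookup_lo split: if_splits)
  have "keys (\<pi> lo) = {}"
  proof (rule ccontr)
    assume "keys (\<pi> lo) \<noteq> {}"
    then obtain b where b: "b \<in> keys (\<pi> lo)" by blast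
    then have lt: "tdeg b < n"
      using \<pi>_keys(1)[OF b] by (auto simp: in_keys_iff lookup_lo split: if_splits)
    have "\<pi> lo = \<pi> x - \<pi> hi" by (simp add: hi_def \<pi>_simps)
    then have "b \<in> keys t \<or> b \<in> keys (\<pi> hi)" using b keys_diff[of "\<pi> x" "\<pi> hi"] by (auto simp: x)
    then show False
      using t(2)[of b] \<pi>_keys(1)[of b hi] hi lt by (force simp: Fge_def)
  qed
  then have eq: "\<pi> x = \<pi> hi" by (simp add: hi_def \<pi>_simps)
  have "induced g t - t = \<pi> (free_subst g hi - free_subst free_gen hi)"
    unfolding x eq by (simp add: induced_\<pi>[OF lp] \<pi>_simps subst_id)
  moreover have "free_subst g hi - free_subst free_gen hi \<in> Fge (Suc (nat n))"
    by (rule subst_approx(2)[OF g1 Fge_free_gen uni hi])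
  ultimately show ?thesis
    using \<pi>_keys(1)[of a "free_subst g hi - free_subst free_gen hi"] a by (force simp: Fge_def)
qed

text \<open>Applying \<open>h\<close> to \<open>g i - free_gen i\<close> stays in degree at least 2,
  and \<open>h\<close> maps \<open>g i\<close> back to the generator modulo an ideal that starts in
  degree 2.\<close>

lemma lift_pair_unipotent:
  assumes "lift_pair g h" "\<And>i. g i - free_gen i \<in> Fge 2"
  shows "h i - free_gen i \<in> Fge 2"
proof -
  have h1: "h j \<in> Fge 1" for j using lift_pair_const[OF lift_pair_swap[OF assms(1)]] Fge_1_iff by blast
  have "free_subst h (g i - free_gen i) \<in> Fge 2"
    by (rule subst_approx(1)[of h h, OF h1 h1 _ assms(2)]) simp
  then have 1: "free_subst h (g i) - h i \<in> Fge 2" by (simp add: scal.eval_simps)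
  have "free_subst h (free_subst g (free_gen i)) \<doteq> free_gen i" using assms(1) by (simp add: lift_pair_def)
  then have "free_subst h (g i) - free_gen i \<in> Fge 2"
    by (intro serre_ideal_Fge) (simp add: cong_iff scal.eval_simps)
  from Fge_diff[OF this 1] show ?thesis by simp
qed

lemma unipotent_fixes:
  assumes "lift_pair g h" "\<And>i. g i - free_gen i \<in> Fge 2"
  shows "g E1 \<doteq> e1" "g E2 \<doteq> e2"
proof -
  note lp = assms(1) lift_pair_swap[OF assms(1)]
  note uni = assms(2) lift_pair_unipotent[OF assms]
  have pair: "\<pi> (free_subst g' (free_subst h' x)) = \<pi> x" if "lift_pair g' h'" for g' h' x
    using that by (simp add: lift_pair_def cong_iff_\<pi>)
  interpret unipotent_pair q "induced g" "induced h"
  proof unfold_locales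
    fix s t :: "'k qtorus" assume "s \<in> A" "t \<in> A"
    then obtain x y where xy: "s = \<pi> x" "t = \<pi> y" by (auto simp: A_def)
    show "induced g (s + t) = induced g s + induced g t" "induced h (s + t) = induced h s + induced h t"
      "induced g (s \<star> t) = induced g s \<star> induced g t" "induced h (s \<star> t) = induced h s \<star> induced h t"
      unfolding xy \<pi>_simps(1,3)[symmetric] induced_\<pi>[OF lp(1)] induced_\<pi>[OF lp(2)]
      by (simp_all add: scal.eval_simps \<pi>_simps)
  next
    fix t :: "'k qtorus" assume "t \<in> A"
    then obtain x where x: "t = \<pi> x" by (auto simp: A_def)
    show "induced g t \<in> A" "induced h t \<in> A" by (simp_all add: induced_def A_def)
    show "induced g (induced h t) = t" "induced h (induced g t) = t"
      unfolding x induced_\<pi>[OF lp(1)] induced_\<pi>[OF lp(2)] by (simp_all add: pair lp)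
  next
    fix c
    show "induced g (sc c) = sc c" "induced h (sc c) = sc c"
      using induced_\<pi>[OF lp(1), of "scalar c"] induced_\<pi>[OF lp(2), of "scalar c"]
      by (simp_all add: scal.eval_simps \<pi>_simps)
  qed (fact induced_unipotent[OF lp(1) uni(1)], fact induced_unipotent[OF lp(2) uni(2)])
  show "g E1 \<doteq> e1" "g E2 \<doteq> e2"
    using \<Phi>_fixes_gens by (simp_all add: cong_iff_\<pi> induced_\<pi>[OF lp(1)] scal.eval_simps)
qed


section \<open>The automorphism group\<close>

abbreviation "Aut_Uq \<equiv> Aut (Uq q)"

lemma Aut_apply:
  assumes f: "f \<in> carrier Aut_Uq" and g: "\<And>i. f (Uq_gen q i) = to_Uq q (g i)"
  shows "f (to_Uq q x) = to_Uq q (free_subst g x)"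
proof -
  note hom = ring_hom_mult[OF AutD(2)[OF f]] ring_hom_add[OF AutD(2)[OF f]]
  have mult: "f (to_Uq q (a * b)) = f (to_Uq q a) \<otimes>\<^bsub>Uq q\<^esub> f (to_Uq q b)"
    and add: "f (to_Uq q (a + b)) = f (to_Uq q a) \<oplus>\<^bsub>Uq q\<^esub> f (to_Uq q b)" for a b
    using hom(1)[of "to_Uq q a" "to_Uq q b"] hom(2)[of "to_Uq q a" "to_Uq q b"] by (simp_all add: Uq_simps)
  show ?thesis
  proof (induction x rule: free_alg_induct)
    case (1 w c)
    have "f (to_Uq q (prod_list (map free_gen v))) = to_Uq q (free_subst g (prod_list (map free_gen v)))" for v
    proof (induction v)
      case Nil
      then show ?case using AutD(6)[OF f, of 1] by (simp add: scalar_simps scal.eval_simps)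
    next
      case (Cons i v)
      then show ?case using g[of i] by (simp add: mult Uq_gen_def Uq_simps scal.eval_simps)
    qed
    then show ?case
      by (cases w) (simp add: single_Word mult Uq_simps AutD(6)[OF f] scal.eval_simps)
  qed (simp add: add Uq_simps scal.eval_simps)
qed

lemma Aut_lift:
  assumes "f \<in> carrier Aut_Uq"
  obtains g where "\<And>i. f (Uq_gen q i) = to_Uq q (g i)"
proof -
  have "\<exists>x. f (Uq_gen q i) = to_Uq q x" for i
    using AutD(5)[OF assms Uq_gen_in_carrier] by (auto simp: Uq_simps(1))
  then show ?thesis using that by metis
qed

lemma Aut_lift_pair:
  assumes f: "f \<in> carrier Aut_Uq" and g: "\<And>i. f (Uq_gen q i) = to_Uq q (g i)"
  shows "\<exists>h. lift_pair g h"
proof -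
  interpret group Aut_Uq by (rule group_Aut)
  have f': "inv\<^bsub>Aut_Uq\<^esub> f \<in> carrier Aut_Uq" using f by simp
  obtain h where h: "\<And>i. (inv\<^bsub>Aut_Uq\<^esub> f) (Uq_gen q i) = to_Uq q (h i)" using Aut_lift[OF f'] by blast
  have to_Uq_in: "to_Uq q x \<in> carrier (Uq q)" for x by (simp add: Uq_simps)
  have "f ((inv\<^bsub>Aut_Uq\<^esub> f) u) = u" "(inv\<^bsub>Aut_Uq\<^esub> f) (f u) = u" if "u \<in> carrier (Uq q)" for u
    using Aut_mult[OF f f' that] Aut_mult[OF f' f that] f that by (simp_all add: Aut_one)
  from this[OF to_Uq_in]
  have "to_Uq q (free_subst g (free_subst h x)) = to_Uq q x" "to_Uq q (free_subst h (free_subst g x)) = to_Uq q x" for x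
    by (simp_all add: Aut_apply[OF f g] Aut_apply[OF f' h])
  moreover have ideal: "free_subst k x \<in> serre_ideal q"
    if "x \<in> serre_ideal q" "\<phi> \<in> carrier Aut_Uq" "\<And>i. \<phi> (Uq_gen q i) = to_Uq q (k i)" for k x \<phi>
  proof -
    have "to_Uq q x = to_Uq q 0" using that(1) by (simp add: to_Uq_eq_iff)
    then have "to_Uq q (free_subst k x) = to_Uq q (free_subst k 0)" by (metis Aut_apply[OF that(2,3)])
    then show ?thesis by (simp add: to_Uq_eq_iff)
  qed
  ultimately have "lift_pair g h"
    unfolding lift_pair_def cong_def using ideal[OF _ f g] ideal[OF _ f' h] by blast
  then show ?thesis by blast
qed

lemma diagram_aut_apply:
  "diagram_aut q (to_Uq q x) = to_Uq q (free_subst (case_gen e3 e2 e1) x)"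
proof (rule Aut_apply[OF diagram_aut(1)])
  fix i show "diagram_aut q (Uq_gen q i) = to_Uq q (case_gen e3 e2 e1 i)"
    by (cases i) (simp_all add: diagram_aut, simp_all add: Uq_gen_def)
qed

text \<open>Rigidity yields e1 and e2. For e3 it is applied to the conjugate by the diagram
  automorphism, which is again unipotent and whose value at e1 encodes that of \<open>f\<close> at
  e3.\<close>

lemma unipotent_Aut:
  assumes f: "f \<in> carrier Aut_Uq" and g: "\<And>i. f (Uq_gen q i) = to_Uq q (g i)"
    and uni: "\<And>i. g i - free_gen i \<in> Fge 2"
  shows "f = \<one>\<^bsub>Aut_Uq\<^esub>"
proof -
  interpret group Aut_Uq by (rule group_Aut)
  have fixes12: "\<phi> (Uq_gen q E1) = Uq_gen q E1" "\<phi> (Uq_gen q E2) = Uq_gen q E2"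
    if \<phi>: "\<phi> \<in> carrier Aut_Uq" "\<And>i. \<phi> (Uq_gen q i) = to_Uq q (k i)" "\<And>i. k i - free_gen i \<in> Fge 2" for \<phi> k
  proof -
    obtain h where "lift_pair k h" using Aut_lift_pair[OF \<phi>(1,2)] by blast
    from unipotent_fixes[OF this \<phi>(3)]
    show "\<phi> (Uq_gen q E1) = Uq_gen q E1" "\<phi> (Uq_gen q E2) = Uq_gen q E2"
      by (simp_all add: \<phi>(2) cong_def, simp_all add: Uq_gen_def)
  qed
  let ?\<eta> = "diagram_aut q" and ?\<sigma> = "case_gen E3 E2 E1" and ?s = "case_gen e3 e2 e1"
  have \<eta>_gen: "?\<eta> (Uq_gen q i) = Uq_gen q (?\<sigma> i)" for i by (cases i) (simp_all add: diagram_aut)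
  let ?f = "?\<eta> \<otimes>\<^bsub>Aut_Uq\<^esub> f \<otimes>\<^bsub>Aut_Uq\<^esub> ?\<eta>"
  have eval: "?f (Uq_gen q i) = ?\<eta> (f (Uq_gen q (?\<sigma> i)))" for i
    using f by (simp add: Aut_mult Aut_mult_closed diagram_aut(1) Uq_gen_in_carrier AutD(5) \<eta>_gen)
  have s1: "?s i \<in> Fge 1" for i by (cases i) (use Fge_free_gen in auto)
  have s: "free_subst ?s (free_gen (?\<sigma> i)) = free_gen i" for i by (cases i) (simp_all add: scal.eval_simps)
  have "?f (Uq_gen q E1) = Uq_gen q E1"
  proof (rule fixes12(1))
    show "?f \<in> carrier Aut_Uq" using f by (simp add: Aut_mult_closed diagram_aut(1))
    show "?f (Uq_gen q i) = to_Uq q (free_subst ?s (g (?\<sigma> i)))" for i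
      by (simp only: eval g diagram_aut_apply)
    have "free_subst ?s (g (?\<sigma> i) - free_gen (?\<sigma> i)) \<in> Fge 2" for i
      by (rule subst_approx(1)[of ?s ?s, OF s1 s1 _ uni]) simp
    then show "free_subst ?s (g (?\<sigma> i)) - free_gen i \<in> Fge 2" for i
      unfolding scal.eval_minus s .
  qed
  then have "?\<eta> (f (Uq_gen q E3)) = Uq_gen q E1" by (simp add: eval)
  then have "?\<eta> (?\<eta> (f (Uq_gen q E3))) = Uq_gen q E3" by (simp add: diagram_aut)
  moreover have "?\<eta> (?\<eta> u) = u" if "u \<in> carrier (Uq q)" for u
    using Aut_mult[OF diagram_aut(1) diagram_aut(1) that] that by (simp add: diagram_aut_square Aut_one)
  ultimately have "f (Uq_gen q E3) = Uq_gen q E3" using AutD(5)[OF f Uq_gen_in_carrier] by simp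
  then show ?thesis
    using fixes12[OF f g uni]
    by (intro Aut_eqI'[OF f one_closed]) (simp_all only: Aut_one[OF Uq_gen_in_carrier])
qed

text \<open>Composition with the inverse torus element turns the linear part into the
  identity.\<close>

lemma diagonal_Aut:
  assumes f: "f \<in> carrier Aut_Uq" and g: "\<And>i. f (Uq_gen q i) = to_Uq q (g i)"
    and l: "\<And>i. l i \<noteq> 0" and lin: "\<And>k i. lin_coeff k (g i) = (if k = i then l i else 0)"
  shows "f = torus_aut q (l E1, l E2, l E3)"
proof -
  interpret group Aut_Uq by (rule group_Aut)
  let ?t = "torus_aut q (l E1, l E2, l E3)"
  let ?t' = "torus_aut q (inverse (l E1), inverse (l E2), inverse (l E3))"
  have l': "inverse (l i) \<noteq> 0" for i using l by simp
  note t = torus_aut[OF l l l] and t' = torus_aut[OF l' l' l']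
  have t'_gen: "?t' (Uq_gen q i) = inverse (l i) \<odot>\<^bsub>Uq q\<^esub> Uq_gen q i" for i
    by (cases i) (simp_all only: t')
  have "?t' \<otimes>\<^bsub>Aut_Uq\<^esub> ?t = torus_aut q ((inverse (l E1), inverse (l E2), inverse (l E3)) \<otimes>\<^bsub>torus\<^esub> (l E1, l E2, l E3))"
    by (rule hom_mult[OF torus_aut_hom, symmetric]) (simp_all add: l torus_simps)
  also have "\<dots> = torus_aut q \<one>\<^bsub>torus\<^esub>" using l by (simp add: torus_simps)
  also have "\<dots> = \<one>\<^bsub>Aut_Uq\<^esub>"
    by (rule hom_one[OF torus_aut_hom group_torus group_Aut])
  finally have tt: "?t' \<otimes>\<^bsub>Aut_Uq\<^esub> ?t = \<one>\<^bsub>Aut_Uq\<^esub>" .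
  have "f \<otimes>\<^bsub>Aut_Uq\<^esub> ?t' = \<one>\<^bsub>Aut_Uq\<^esub>"
  proof (rule unipotent_Aut)
    show "f \<otimes>\<^bsub>Aut_Uq\<^esub> ?t' \<in> carrier Aut_Uq" using f t'(1) by simp
    show "(f \<otimes>\<^bsub>Aut_Uq\<^esub> ?t') (Uq_gen q i) = to_Uq q (scalar (inverse (l i)) * g i)" for i
      by (simp add: Aut_mult[OF f t'(1) Uq_gen_in_carrier] t'_gen AutD(4)[OF f Uq_gen_in_carrier] g Uq_simps)
    obtain h where "lift_pair g h" using Aut_lift_pair[OF f g] by blast
    from lift_pair_const[OF this] show "scalar (inverse (l i)) * g i - free_gen i \<in> Fge 2" for i
      using l[of i] by (auto simp: Fge_2_iff const_lin_simps const_lin_mult lin)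
  qed
  then show ?thesis
    using tt f t(1) t'(1) by (metis m_assoc l_one r_one)
qed

lemma Aut_cases:
  assumes f: "f \<in> carrier Aut_Uq"
  obtains l h where "l \<in> carrier torus" "h \<in> carrier (diagram_group q)" "f = torus_aut q l \<otimes>\<^bsub>Aut_Uq\<^esub> h"
proof -
  interpret group Aut_Uq by (rule group_Aut)
  obtain g where g: "\<And>i. f (Uq_gen q i) = to_Uq q (g i)" using Aut_lift[OF f] by blast
  obtain h where lp: "lift_pair g h" using Aut_lift_pair[OF f g] by blast
  let ?\<eta> = "diagram_aut q" and ?\<sigma> = "case_gen E3 E2 E1"
  note shape = lift_pair_shape[OF lp]
  from shape(6) show ?thesis
  proof
    assume d: "lin_coeff E1 (g E1) \<noteq> 0 \<and> lin_coeff E3 (g E3) \<noteq> 0 \<and> lin_coeff E1 (g E3) = 0 \<and> lin_coeff E3 (g E1) = 0"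
    define l where "l i = lin_coeff i (g i)" for i
    have l: "l i \<noteq> 0" for i using d shape(5) by (cases i) (simp_all add: l_def)
    have "lin_coeff k (g i) = (if k = i then l i else 0)" for k i
      using d shape(1-4) by (cases k; cases i) (simp_all add: l_def)
    then have "f = torus_aut q (l E1, l E2, l E3)" by (rule diagonal_Aut[OF f g l])
    then show ?thesis
      using that[of "(l E1, l E2, l E3)" "\<one>\<^bsub>Aut_Uq\<^esub>"] f l by (simp add: torus_simps carrier_diagram_group)
  next
    assume d: "lin_coeff E1 (g E3) \<noteq> 0 \<and> lin_coeff E3 (g E1) \<noteq> 0 \<and> lin_coeff E1 (g E1) = 0 \<and> lin_coeff E3 (g E3) = 0"
    define l where "l i = lin_coeff i (g (?\<sigma> i))" for i
    have l: "l i \<noteq> 0" for i using d shape(5) by (cases i) (simp_all add: l_def)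
    have \<eta>: "?\<eta> (Uq_gen q i) = Uq_gen q (?\<sigma> i)" for i by (cases i) (simp_all add: diagram_aut)
    \<comment> \<open>Composing with the involution exchanges columns 1 and 3, so the antidiagonal
      linear part becomes diagonal.\<close>
    have "f \<otimes>\<^bsub>Aut_Uq\<^esub> ?\<eta> = torus_aut q (l E1, l E2, l E3)"
    proof (rule diagonal_Aut[OF _ _ l])
      show "f \<otimes>\<^bsub>Aut_Uq\<^esub> ?\<eta> \<in> carrier Aut_Uq" using f by (simp add: diagram_aut(1))
      show "(f \<otimes>\<^bsub>Aut_Uq\<^esub> ?\<eta>) (Uq_gen q i) = to_Uq q (g (?\<sigma> i))" for i
        by (simp only: Aut_mult[OF f diagram_aut(1) Uq_gen_in_carrier] \<eta> g)
      show "lin_coeff k (g (?\<sigma> i)) = (if k = i then l i else 0)" for k i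
        using d shape(1-4) by (cases k; cases i) (simp_all add: l_def)
    qed
    then have "f = torus_aut q (l E1, l E2, l E3) \<otimes>\<^bsub>Aut_Uq\<^esub> ?\<eta>"
      using f diagram_aut(1) diagram_aut_square by (metis m_assoc r_one)
    then show ?thesis
      using that[of "(l E1, l E2, l E3)" ?\<eta>] l by (simp add: torus_simps carrier_diagram_group)
  qed
qed

text \<open>The two sides map e1 to nonzero multiples of different generators, which the linear
  coefficients tell apart.\<close>

lemma torus_aut_neq_diagram:
  assumes "l \<in> carrier torus" "m \<in> carrier torus"
  shows "torus_aut q l \<otimes>\<^bsub>Aut_Uq\<^esub> diagram_aut q \<noteq> torus_aut q m"
proof
  assume eq: "torus_aut q l \<otimes>\<^bsub>Aut_Uq\<^esub> diagram_aut q = torus_aut q m"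
  obtain a b c a' b' c' where lm: "l = (a, b, c)" "m = (a', b', c')" by (metis prod_cases3)
  have nz: "a \<noteq> 0" "b \<noteq> 0" "c \<noteq> 0" "a' \<noteq> 0" "b' \<noteq> 0" "c' \<noteq> 0" using assms by (simp_all add: lm torus_simps)
  have "(torus_aut q l \<otimes>\<^bsub>Aut_Uq\<^esub> diagram_aut q) (Uq_gen q E1) = torus_aut q m (Uq_gen q E1)" by (simp only: eq)
  then have "c \<odot>\<^bsub>Uq q\<^esub> Uq_gen q E3 = a' \<odot>\<^bsub>Uq q\<^esub> Uq_gen q E1"
    using nz by (simp add: lm Aut_mult torus_aut diagram_aut Uq_gen_in_carrier)
  then have "scalar c * e3 - scalar a' * e1 \<in> serre_ideal q"
    by (simp add: Uq_gen_def Uq_simps to_Uq_eq_iff)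
  from serre_ideal_Fge[OF this] have "lin_coeff E3 (scalar c * e3 - scalar a' * e1) = 0" by (simp add: Fge_2_iff)
  then show False using nz by (simp add: const_lin_simps const_lin_mult)
qed

lemma semidirect_iso:
  "(\<lambda>(l, h). torus_aut q l \<otimes>\<^bsub>Aut_Uq\<^esub> h) \<in> iso (semidirect_product torus (diagram_group q) (conj_action q)) Aut_Uq"
    (is "?\<Theta> \<in> iso ?S _")
proof (rule isoI)
  interpret group Aut_Uq by (rule group_Aut)
  have T: "torus_aut q l \<in> carrier Aut_Uq" if "l \<in> carrier torus" for l
    using hom_in_carrier[OF torus_aut_hom that] .
  have D: "h \<in> carrier Aut_Uq" if "h \<in> carrier (diagram_group q)" for h
    using that diagram_aut(1) by (auto simp: carrier_diagram_group)
  \<comment> \<open>The product rule of the semidirect product is h t = (h t h^-1) h. The action is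
    defined through a preimage under \<open>torus_aut\<close>, so it is evaluated for each of the
    two elements \<open>h\<close>.\<close>
  have conj: "torus_aut q (conj_action q h l) \<otimes>\<^bsub>Aut_Uq\<^esub> h = h \<otimes>\<^bsub>Aut_Uq\<^esub> torus_aut q l"
    "conj_action q h l \<in> carrier torus"
    if h: "h \<in> carrier (diagram_group q)" and l: "l \<in> carrier torus" for h l
  proof -
    obtain a b c where abc: "l = (a, b, c)" by (metis prod_cases3)
    have nz: "a \<noteq> 0" "b \<noteq> 0" "c \<noteq> 0" using l by (simp_all add: abc torus_simps)
    from h consider "h = \<one>\<^bsub>Aut_Uq\<^esub>" | "h = diagram_aut q" by (auto simp: carrier_diagram_group)
    then have "torus_aut q (conj_action q h l) = h \<otimes>\<^bsub>Aut_Uq\<^esub> torus_aut q l \<otimes>\<^bsub>Aut_Uq\<^esub> inv\<^bsub>Aut_Uq\<^esub> h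
        \<and> conj_action q h l \<in> carrier torus"
      by cases (use nz T[OF l] in \<open>simp_all add: abc conj_action_simps diagram_conj_torus torus_simps\<close>)
    then show "torus_aut q (conj_action q h l) \<otimes>\<^bsub>Aut_Uq\<^esub> h = h \<otimes>\<^bsub>Aut_Uq\<^esub> torus_aut q l"
      "conj_action q h l \<in> carrier torus"
      using T[OF l] D[OF h] by (simp_all add: m_assoc)
  qed
  have carrier: "carrier ?S = carrier torus \<times> carrier (diagram_group q)"
    by (simp add: semidirect_product_def)
  show "?\<Theta> \<in> hom ?S Aut_Uq"
  proof (rule homI)
    fix x y assume "x \<in> carrier ?S" "y \<in> carrier ?S"
    then obtain l h l' h' where xy: "x = (l, h)" "y = (l', h')"
      and in_c: "l \<in> carrier torus" "h \<in> carrier (diagram_group q)" "l' \<in> carrier torus" "h' \<in> carrier (diagram_group q)"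
      by (auto simp: carrier)
    note c = T[OF in_c(1)] D[OF in_c(2)] T[OF in_c(3)] D[OF in_c(4)] T[OF conj(2)[OF in_c(2,3)]]
    have "?\<Theta> (x \<otimes>\<^bsub>?S\<^esub> y) = torus_aut q (l \<otimes>\<^bsub>torus\<^esub> conj_action q h l') \<otimes>\<^bsub>Aut_Uq\<^esub> (h \<otimes>\<^bsub>Aut_Uq\<^esub> h')"
      by (simp add: xy semidirect_product_def diagram_group_simps)
    also have "\<dots> = torus_aut q l \<otimes>\<^bsub>Aut_Uq\<^esub> (torus_aut q (conj_action q h l') \<otimes>\<^bsub>Aut_Uq\<^esub> h) \<otimes>\<^bsub>Aut_Uq\<^esub> h'"
      using c by (simp add: hom_mult[OF torus_aut_hom in_c(1) conj(2)[OF in_c(2,3)]] m_assoc)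
    also have "\<dots> = ?\<Theta> x \<otimes>\<^bsub>Aut_Uq\<^esub> ?\<Theta> y"
      using c by (simp add: conj(1)[OF in_c(2,3)] xy m_assoc)
    finally show "?\<Theta> (x \<otimes>\<^bsub>?S\<^esub> y) = ?\<Theta> x \<otimes>\<^bsub>Aut_Uq\<^esub> ?\<Theta> y" .
  qed (auto simp: carrier T D)
  show "bij_betw ?\<Theta> (carrier ?S) (carrier Aut_Uq)"
  proof (rule bij_betw_imageI)
    show "inj_on ?\<Theta> (carrier ?S)"
    proof (rule inj_onI, clarsimp simp: carrier simp del: split_paired_All)
      fix a b c a' b' c' :: 'k and h h'
      let ?l = "(a, b, c)" and ?m = "(a', b', c')"
      assume l: "?l \<in> carrier torus" "?m \<in> carrier torus"
        and h: "h \<in> carrier (diagram_group q)" "h' \<in> carrier (diagram_group q)"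
        and eq: "torus_aut q ?l \<otimes>\<^bsub>Aut_Uq\<^esub> h = torus_aut q ?m \<otimes>\<^bsub>Aut_Uq\<^esub> h'"
      have "h = h'"
        using h eq torus_aut_neq_diagram[OF l] torus_aut_neq_diagram[OF l(2,1)] T[OF l(1)] T[OF l(2)]
        by (auto simp: carrier_diagram_group)
      then have "torus_aut q ?l = torus_aut q ?m"
        using eq T[OF l(1)] T[OF l(2)] D[OF h(1)] by simp
      then have "?l = ?m" using torus_aut_inj l by (auto dest: inj_onD)
      then show "a = a' \<and> b = b' \<and> c = c' \<and> h = h'" using \<open>h = h'\<close> by simp
    qed
    show "?\<Theta> ` carrier ?S = carrier Aut_Uq"
    proof
      show "?\<Theta> ` carrier ?S \<subseteq> carrier Aut_Uq" by (auto simp: carrier T D)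
      show "carrier Aut_Uq \<subseteq> ?\<Theta> ` carrier ?S"
      proof
        fix f assume "f \<in> carrier Aut_Uq"
        then obtain l h where "l \<in> carrier torus" "h \<in> carrier (diagram_group q)" "f = torus_aut q l \<otimes>\<^bsub>Aut_Uq\<^esub> h"
          by (rule Aut_cases)
        then show "f \<in> ?\<Theta> ` carrier ?S" by (intro image_eqI[of _ _ "(l, h)"]) (simp_all add: carrier)
      qed
    qed
  qed
qed

end

theorem theorem2p7:
  fixes q :: "'k :: field_char_0"
  assumes "q \<noteq> 0"
    and "\<And>n :: nat. n > 0 \<Longrightarrow> q ^ n \<noteq> 1"
  shows "Aut (Uq q) \<cong> semidirect_product torus (diagram_group q) (conj_action q)"
proof -
  interpret qparam q by unfold_locales (use assms in auto)
  show ?thesis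
    using group.iso_sym[OF group_semidirect is_isoI[OF semidirect_iso]] .
qed

end
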